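(* Let $M$ be $\mathbb T=\mathbb R/\mathbb Z$ or $I=[0,1]$, let $T:M\to M$ be a Morse–Smale homeomorphism of period one, let $(\Omega,\mathscr F,\mathbb P)=(\mathcal A^{\mathbb N},\mathcal F^{\mathbb N},p^{\mathbb N})$ with $\tau$ the shift on $\Omega$, and let $\Psi:\Omega\to\mathbb Z$ be a one-step random variable, $\Psi(\omega)=\Psi(\omega_0)$. Consider the skew product $$F_{T^\Psi}:\Omega\times M\to\Omega\times M,\qquad F_{T^\Psi}(\omega,x)=(\tau(\omega),f_{\omega_0}(x)),\quad f_{\omega_0}(x)=T^{\Psi(\omega_0)}(x).$$ If $\mathbb E[\Psi]=0$ and $0<\mathbb E[\Psi^2]<\infty$, then: (1) for $\mathrm{Leb}$-a.e. $x\in M$, denoting by $(p,q)$ the open arc between consecutive fixed points $p,q$ of $T$ that contains $x$, for every $\gamma\in(p,q)$ and for $J$ equal to either of the arcs $[p,\gamma]$ or $[\gamma,q]$, $$\lim_{n\to\infty}\mathbb P\Big(\frac1n\sum_{j=0}^{n-1}\mathbf 1_{J}(f^j_\omega(x))\le\alpha\Big)=\frac2\pi\arcsin\sqrt\alpha\quad\text{for every }\alpha\in(0,1);$$ (2) $F_{T^\Psi}$ exhibits historical behavior for $(\mathbb P\times\mathrm{Leb})$-a.e. point; (3) for every pair of consecutive fixed points $p$ and $q$ of $T$, $$\mathcal L(\omega,x)=\{\lambda\delta_p+(1-\lambda)\delta_q:\lambda\in[0,1]\}\quad\text{for }\mathbb P\text{-a.e. }\omega\in\Omega\text{ and }x\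in(p,q).$$
   Context: $\mathcal A$ is an at most countable alphabet with discrete $\sigma$-algebra $\mathcal F$, and $p$ (as the marginal of $\mathbb P$) is a probability measure on $\mathcal A$ with full support. A homeomorphism $T$ of $M$ is Morse–Smale of period one if it has a non-empty set of periodic points consisting solely of sinks and sources of period one (fixed points). $f^0_\omega=\mathrm{id}$ and $f^n_\omega=f_{\omega_{n-1}}\circ\dots\circ f_{\omega_0}$ for $n\ge1$. $\mathrm{Leb}$ is Lebesgue measure on $M$. Historical behavior for $(\mathbb P\times\mathrm{Leb})$-a.e. point: for $(\mathbb P\times\mathrm{Leb})$-a.e. $(\omega,x)$ there is a continuous $\varphi:M\to\mathbb R$ such that $\lim_{n\to\infty}\frac1n\sum_{j=0}^{n-1}\varphi(f^j_\omega(x))$ does not exist. $\mathcal L(\omega,x)$ is the set of weak$^*$ accumulation points of $\frac1n\sum_{j=0}^{n-1}\delta_{f^j_\omega(x)}$, $n\ge1$.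
   Formalization: Part (1) is stated on the circle only for orientation-preserving T; it fails for an orientation-reversing T with one sink and one source that swaps the two arcs, e.g. with Ψ=±1 equiprobable. Parts (2) and (3) are unrestricted. *)

theory Defs
  imports "HOL-Probability.Probability"
begin

text \<open>
  The circle \<open>\<real>/\<int>\<close> is represented on the fundamental domain \<open>[0,1)\<close>, a point standing for its
  class modulo 1.  Its topology is the quotient topology of the projection
  \<^const>\<open>frac\<close>\<open> : \<real> \<rightarrow> [0,1)\<close> (lemma \<open>quotient_map_frac\<close>), not the subspace topology.
\<close>

definition circle :: "real topology" where
  "circle = topology (\<lambda>U. U \<subseteq> {0..<1} \<and> open (frac -` U))"

definition unit_interval :: "real topology" where
  "unit_interval = top_of_set {0..1}"

lemma openin_circle: "openin circle U \<longleftrightarrow> U \<subseteq> {0..<1} \<and> open (frac -` U :: real set)"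
proof -
  have "istopology (\<lambda>U :: real set. U \<subseteq> {0..<1} \<and> open (frac -` U))"
    unfolding istopology_def
  proof (intro conjI allI impI)
    fix S T :: "real set"
    assume "S \<subseteq> {0..<1} \<and> open (frac -` S)" "T \<subseteq> {0..<1} \<and> open (frac -` T)"
    then show "S \<inter> T \<subseteq> {0..<1}" "open (frac -` (S \<inter> T))"
      by (auto simp: vimage_Int)
  next
    fix K :: "real set set"
    assume "\<forall>S\<in>K. S \<subseteq> {0..<1} \<and> open (frac -` S)"
    then show "\<Union>K \<subseteq> {0..<1}" "open (frac -` \<Union>K)"
      by (auto simp: vimage_Union)
  qed
  then show ?thesis
    unfolding circle_def by simp
qed

lemma topspace_circle [simp]: "topspace circle = {0..<1}"
proof -
  have "frac -` {0..<1} = (UNIV :: real set)"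
    by (auto simp: frac_lt_1)
  then have "openin circle {0..<1}"
    by (simp add: openin_circle)
  then show ?thesis
    by (metis openin_circle openin_subset openin_topspace subset_antisym)
qed

lemma topspace_unit_interval [simp]: "topspace unit_interval = {0..1}"
  by (simp add: unit_interval_def)

lemma quotient_map_frac: "quotient_map euclideanreal circle frac"
proof -
  have "x \<in> range frac" if "0 \<le> x" "x < 1" for x :: real
    using that by (metis frac_eq rangeI)
  then have "range frac = {0..<1 :: real}"
    by (auto simp: frac_lt_1)
  then show ?thesis
    by (auto simp: quotient_map_def openin_circle vimage_def)
qed

definition leb :: "real topology \<Rightarrow> real measure" where
  "leb X = restrict_space lborel (topspace X)"

definition borel_of :: "'x topology \<Rightarrow> 'x measure" where
  "borel_of X = sigma (topspace X) {U. openin X U}"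

lemma space_borel_of [simp]: "space (borel_of X) = topspace X"
  by (simp add: borel_of_def space_measure_of_conv)

text \<open>
  On the circle, \<open>open_arc X a b\<close> runs from \<open>a\<close> to \<open>b\<close> in the positive direction, through \<open>0\<close> if
  \<open>b < a\<close>.
\<close>

definition open_arc :: "real topology \<Rightarrow> real \<Rightarrow> real \<Rightarrow> real set" where
  "open_arc X a b =
     (if X = circle \<and> b < a then {x \<in> topspace X. a < x \<or> x < b} else {a<..<b})"

definition closed_arc :: "real topology \<Rightarrow> real \<Rightarrow> real \<Rightarrow> real set" where
  "closed_arc X a b = insert a (insert b (open_arc X a b))"

definition int_iter :: "'x topology \<Rightarrow> ('x \<Rightarrow> 'x) \<Rightarrow> int \<Rightarrow> 'x \<Rightarrow> 'x" where
  "int_iter X T k =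
     (if 0 \<le> k then T ^^ nat k else inv_into (topspace X) T ^^ nat (- k))"

definition periodic_points :: "'x topology \<Rightarrow> ('x \<Rightarrow> 'x) \<Rightarrow> 'x set" where
  "periodic_points X T = {x \<in> topspace X. \<exists>n>0. (T ^^ n) x = x}"

definition fixed_points :: "'x topology \<Rightarrow> ('x \<Rightarrow> 'x) \<Rightarrow> 'x set" where
  "fixed_points X T = {x \<in> topspace X. T x = x}"

text \<open>
  A sink is an asymptotically stable fixed point.  Stability cannot be dropped: on the circle,
  the unique fixed point of a homeomorphism can attract all points while being repelling on one
  side.
\<close>

definition sink :: "'x topology \<Rightarrow> ('x \<Rightarrow> 'x) \<Rightarrow> 'x \<Rightarrow> bool" where
  "sink X T a \<longleftrightarrow>
     a \<in> fixed_points X T \<and>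
     (\<forall>V. openin X V \<and> a \<in> V \<longrightarrow>
        (\<exists>U. openin X U \<and> a \<in> U \<and> (\<forall>n. (T ^^ n) ` U \<subseteq> V))) \<and>
     (\<exists>W. openin X W \<and> a \<in> W \<and> (\<forall>x\<in>W. limitin X (\<lambda>n. (T ^^ n) x) a sequentially))"

definition source :: "'x topology \<Rightarrow> ('x \<Rightarrow> 'x) \<Rightarrow> 'x \<Rightarrow> bool" where
  "source X T a \<longleftrightarrow> sink X (inv_into (topspace X) T) a"

definition morse_smale_period_one :: "'x topology \<Rightarrow> ('x \<Rightarrow> 'x) \<Rightarrow> bool" where
  "morse_smale_period_one X T \<longleftrightarrow>
     homeomorphic_map X X T \<and>
     periodic_points X T \<noteq> {} \<and>
     (\<forall>a \<in> periodic_points X T. T a = a \<and> (sink X T a \<or> source X T a))"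

text \<open>
  The disjunct \<open>X = circle\<close> admits arcs through \<open>0\<close>.  In particular, if \<open>T\<close> has exactly two fixed
  points on the circle, then both ordered pairs are consecutive.
\<close>

definition consecutive_fixed_points ::
  "real topology \<Rightarrow> (real \<Rightarrow> real) \<Rightarrow> real \<Rightarrow> real \<Rightarrow> bool" where
  "consecutive_fixed_points X T a b \<longleftrightarrow>
     a \<in> fixed_points X T \<and> b \<in> fixed_points X T \<and> a \<noteq> b \<and> (a < b \<or> X = circle) \<and>
     open_arc X a b \<inter> fixed_points X T = {}"

text \<open>
  An orientation-reversing circle homeomorphism can be Morse--Smale of period one, with one sink
  and one source.  It then interchanges the two arcs, and the arcsine law for the time spent in a
  subarc fails, for instance, if \<open>\<Psi> = \<plusminus>1\<close>.
\<close>

definition circle_orientation_preserving :: "(real \<Rightarrow> real) \<Rightarrow> bool" where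
  "circle_orientation_preserving T \<longleftrightarrow>
     (\<exists>G. continuous_on UNIV G \<and> strict_mono G \<and>
        (\<forall>x. G (x + 1) = G x + 1) \<and> (\<forall>x. T (frac x) = frac (G x)))"

definition path_measure :: "'a pmf \<Rightarrow> (nat \<Rightarrow> 'a) measure" where
  "path_measure \<mu> = (\<Pi>\<^sub>M n\<in>(UNIV :: nat set). measure_pmf \<mu>)"

primrec rand_iter :: "('a \<Rightarrow> 'x \<Rightarrow> 'x) \<Rightarrow> (nat \<Rightarrow> 'a) \<Rightarrow> nat \<Rightarrow> 'x \<Rightarrow> 'x" where
  "rand_iter f \<omega> 0 = id"
| "rand_iter f \<omega> (Suc n) = f (\<omega> n) \<circ> rand_iter f \<omega> n"

definition skew_product ::
  "('a \<Rightarrow> 'x \<Rightarrow> 'x) \<Rightarrow> (nat \<Rightarrow> 'a) \<times> 'x \<Rightarrow> (nat \<Rightarrow> 'a) \<times> 'x" where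
  "skew_product f = (\<lambda>(\<omega>, x). (\<lambda>n. \<omega> (Suc n), f (\<omega> 0) x))"

lemma skew_product_funpow:
  "(skew_product f ^^ n) (\<omega>, x) = (\<lambda>k. \<omega> (k + n), rand_iter f \<omega> n x)"
  by (induction n) (auto simp: skew_product_def)

definition historical_behavior_ae ::
  "(nat \<Rightarrow> 'a) measure \<Rightarrow> real topology \<Rightarrow>
   ((nat \<Rightarrow> 'a) \<times> real \<Rightarrow> (nat \<Rightarrow> 'a) \<times> real) \<Rightarrow> bool" where
  "historical_behavior_ae P X F \<longleftrightarrow>
     (AE z in P \<Otimes>\<^sub>M leb X. \<exists>\<phi>. continuous_map X euclideanreal \<phi> \<and>
        \<not> convergent (\<lambda>n. (\<Sum>j<n. \<phi> (snd ((F ^^ j) z))) / real n))"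

lemma historical_behavior_ae_skew_product:
  "historical_behavior_ae P X (skew_product f) \<longleftrightarrow>
     (AE (\<omega>, x) in P \<Otimes>\<^sub>M leb X. \<exists>\<phi>. continuous_map X euclideanreal \<phi> \<and>
        \<not> convergent (\<lambda>n. (\<Sum>j<n. \<phi> (rand_iter f \<omega> j x)) / real n))"
  unfolding historical_behavior_ae_def
  by (intro AE_cong) (auto simp: skew_product_funpow split: prod.splits)

text \<open>
  The measure \<open>\<Sum>i\<in>I. c i \<cdot> \<delta>\<^bsub>y i\<^esub>\<close> on the Borel sets of \<open>X\<close>
\<close>

definition dirac_sum :: "'x topology \<Rightarrow> 'i set \<Rightarrow> ('i \<Rightarrow> real) \<Rightarrow> ('i \<Rightarrow> 'x) \<Rightarrow> 'x measure" where
  "dirac_sum X I c y =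
     measure_of (topspace X) (sets (borel_of X))
       (\<lambda>A. \<Sum>i\<in>I. ennreal (c i) * emeasure (return (borel_of X) (y i)) A)"

lemma sets_dirac_sum [simp]: "sets (dirac_sum X I c y) = sets (borel_of X)"
  unfolding dirac_sum_def by (metis sets.sets_measure_of_eq space_borel_of)

lemma emeasure_dirac_sum:
  assumes "A \<in> sets (borel_of X)"
  shows "emeasure (dirac_sum X I c y) A =
    (\<Sum>i\<in>I. ennreal (c i) * emeasure (return (borel_of X) (y i)) A)"
proof (rule emeasure_measure_of_sigma[where \<Omega> = "topspace X" and M = "sets (borel_of X)"
      and \<mu> = "\<lambda>A. \<Sum>i\<in>I. ennreal (c i) * emeasure (return (borel_of X) (y i)) A",
      folded dirac_sum_def])
  show "sigma_algebra (topspace X) (sets (borel_of X))"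
    by (metis sets.sigma_algebra_axioms space_borel_of)
  show "positive (sets (borel_of X))
     (\<lambda>A. \<Sum>i\<in>I. ennreal (c i) * emeasure (return (borel_of X) (y i)) A)"
    by (simp add: positive_def)
  show "countably_additive (sets (borel_of X))
     (\<lambda>A. \<Sum>i\<in>I. ennreal (c i) * emeasure (return (borel_of X) (y i)) A)"
    unfolding countably_additive_def
  proof (intro allI impI)
    fix B :: "nat \<Rightarrow> 'a set"
    assume B: "range B \<subseteq> sets (borel_of X)" "disjoint_family B" "\<Union> (range B) \<in> sets (borel_of X)"
    have "(\<Sum>n. \<Sum>i\<in>I. ennreal (c i) * emeasure (return (borel_of X) (y i)) (B n)) =
        (\<Sum>i\<in>I. \<Sum>n. ennreal (c i) * emeasure (return (borel_of X) (y i)) (B n))"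
      by (rule suminf_sum) auto
    also have "\<dots> = (\<Sum>i\<in>I. ennreal (c i) * (\<Sum>n. emeasure (return (borel_of X) (y i)) (B n)))"
      by simp
    also have "\<dots> =
        (\<Sum>i\<in>I. ennreal (c i) * emeasure (return (borel_of X) (y i)) (\<Union> (range B)))"
      using B by (intro sum.cong refl arg_cong2[where f = "(*)"] suminf_emeasure) auto
    finally show "(\<Sum>n. \<Sum>i\<in>I. ennreal (c i) * emeasure (return (borel_of X) (y i)) (B n)) =
        (\<Sum>i\<in>I. ennreal (c i) * emeasure (return (borel_of X) (y i)) (\<Union> (range B)))" .
  qed
qed fact

definition empirical_measure :: "'x topology \<Rightarrow> (nat \<Rightarrow> 'x) \<Rightarrow> nat \<Rightarrow> 'x measure" where
  "empirical_measure X y n = dirac_sum X {..<n} (\<lambda>_. 1 / real n) y"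

definition dirac_mix :: "'x topology \<Rightarrow> real \<Rightarrow> 'x \<Rightarrow> 'x \<Rightarrow> 'x measure" where
  "dirac_mix X l a b =
     dirac_sum X UNIV (\<lambda>i. if i then l else 1 - l) (\<lambda>i. if i then a else b)"

lemma emeasure_dirac_mix:
  assumes "A \<in> sets (borel_of X)"
  shows "emeasure (dirac_mix X l a b) A =
    ennreal l * emeasure (return (borel_of X) a) A +
    ennreal (1 - l) * emeasure (return (borel_of X) b) A"
  unfolding dirac_mix_def emeasure_dirac_sum[OF assms] UNIV_bool
  by (simp only: sum.insert finite.intros sum.empty insert_iff empty_iff simp_thms if_True
      if_False add_0_left add_0_right add.commute)

text \<open>
  The weak* topology on the Borel probability measures: the coarsest topology making all maps
  \<open>\<mu> \<mapsto> \<integral>\<phi> d\<mu>\<close>, for \<open>\<phi>\<close> continuous, continuous.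
\<close>

definition weak_star :: "'x topology \<Rightarrow> 'x measure topology" where
  "weak_star X =
     pullback_topology {\<mu>. prob_space \<mu> \<and> sets \<mu> = sets (borel_of X)}
       (\<lambda>\<mu>. \<lambda>\<phi>\<in>{\<phi>. continuous_map X euclideanreal \<phi>}. \<integral>x. \<phi> x \<partial>\<mu>)
       (product_topology (\<lambda>_. euclideanreal) {\<phi>. continuous_map X euclideanreal \<phi>})"

definition accumulation_points :: "'y topology \<Rightarrow> (nat \<Rightarrow> 'y) \<Rightarrow> 'y set" where
  "accumulation_points Y s =
     {\<mu> \<in> topspace Y. \<forall>U. openin Y U \<and> \<mu> \<in> U \<longrightarrow> (\<exists>\<^sub>F n in sequentially. s n \<in> U)}"

definition limit_measures ::
  "'x topology \<Rightarrow> ('a \<Rightarrow> 'x \<Rightarrow> 'x) \<Rightarrow> (nat \<Rightarrow> 'a) \<Rightarrow> 'x \<Rightarrow> 'x measure set" where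
  "limit_measures X f \<omega> x =
     accumulation_points (weak_star X) (empirical_measure X (\<lambda>j. rand_iter f \<omega> j x))"

end

theory Submission
  imports Defs
begin

text \<open>
  On an arc between consecutive fixed points \<open>p\<close> and \<open>q\<close>, the random orbit of \<open>x\<close> is
  \<open>T\<^bsup>S\<^sub>j\<^esup> x\<close>, where \<open>S\<^sub>j = \<Psi>(\<omega>\<^sub>0) + \<dots> + \<Psi>(\<omega>\<^bsub>j-1\<^esub>)\<close> is a centered integer random walk, and
  \<open>T\<^bsup>k\<^esup> x\<close> tends to one end of the arc as \<open>k \<rightarrow> \<infinity>\<close> and to the other as \<open>k \<rightarrow> -\<infinity>\<close>
  (\<open>orbit_ends\<close>). So the orbit sits near one end while the walk is large and positive and near the
  other end while it is large and negative, and all three claims are about the fraction of time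
  that the walk spends on a half-line.

  \<^item> The arcsine law. By the combinatorial argument of Sparre Andersen and Feller, the number
    of positive sums among \<open>S\<^sub>1, \<dots>, S\<^sub>n\<close> is distributed like the time of the first maximum of
    \<open>S\<^sub>0, \<dots>, S\<^sub>n\<close>. The latter splits the walk into two independent pieces, so that its law is
    \<open>P(k) = a\<^sub>k b\<^bsub>n-k\<^esub>\<close> (\<open>prob_npos_splits\<close>). Together with \<open>P(S\<^sub>n > 0) \<rightarrow> 1/2\<close>, which is the central limit
    theorem, this determines the asymptotics of all moments through a recursion
    (\<open>splitting_moments_asymp\<close>), and the limits are the moments of the arcsine law. Convergence of
    moments on \<open>[0,1]\<close> implies convergence in law. The threshold \<open>0\<close> may be replaced by any other
    (\<open>arcsine_above\<close>, \<open>arcsine_below\<close>), because by \<open>expected_visits\<close> the walk is expected to spend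
    only \<open>O(\<surd>n)\<close> of the first \<open>n\<close> steps in a given finite set. If \<open>T\<close> preserves the arc, the
    times at which the orbit is in \<open>[p,\<gamma>]\<close> or \<open>[\<gamma>,q]\<close> are exactly those at which the walk is in
    some half-line (\<open>orbit_threshold\<close>).

  \<^item> Oscillation. The arcsine law bounds from below, uniformly in the level, the probability that
    the walk spends more than a fraction \<open>\<rho> < 1\<close> of a long time above a given level; Kolmogorov's
    0-1 law turns this into an almost sure statement. With the almost surely vanishing density of the visits to finite sets, this makes almost every path
    oscillating (\<open>AE_oscillating\<close>): the fraction of time spent on the positive half-line
    accumulates at every point of \<open>[0,1]\<close>.

  \<^item> Limit measures. Along an oscillating path the time averages of a continuous function \<open>\<phi>\<close>
    are \<open>\<phi>(a) V\<^sub>n + \<phi>(b) (1 - V\<^sub>n) + o(1)\<close>, where \<open>a\<close> and \<open>b\<close> are the two ends and \<open>V\<^sub>n\<close> is the fraction of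
    time on the positive half-line (\<open>time_average\<close>). Hence the accumulation points of the empirical
    measures are exactly the convex combinations of \<open>\<delta>\<^sub>a\<close> and \<open>\<delta>\<^sub>b\<close>, and a function that
    distinguishes \<open>a\<close> from \<open>b\<close> has no time average.

  The set of exceptional paths is the same for all starting points, since the walk does not depend
  on \<open>x\<close>. The convergence of \<open>T\<^bsup>k\<^esup> x\<close> is derived from \<open>T \<circ> T\<close>, which is increasing on
  every arc even if \<open>T\<close> reverses the orientation of the circle.
\<close>

section \<open>Positive partial sums and the first maximum\<close>

text \<open>
  The number of positive sums of nonempty suffixes. Reading time from right to left makes the
  recursion primitive; for independent and identically distributed steps it does not affect the law.
\<close>

primrec npos :: "int list \<Rightarrow> nat" where
  "npos [] = 0"
| "npos (x # xs) = npos xs + (if x + sum_list xs > 0 then 1 else 0)"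

definition suffixes_pos :: "int list \<Rightarrow> bool" where
  "suffixes_pos xs \<longleftrightarrow> (\<forall>k<length xs. sum_list (drop k xs) > 0)"

definition prefixes_nonpos :: "int list \<Rightarrow> bool" where
  "prefixes_nonpos xs \<longleftrightarrow> (\<forall>k\<le>length xs. sum_list (take k xs) \<le> 0)"

text \<open>
  In terms of the prefix sums \<open>s\<^sub>0, s\<^sub>1, \<dots>\<close>, the two conditions say that \<open>s\<^sub>j < s\<^sub>k\<close> for \<open>j < k\<close> and
  \<open>s\<^sub>j \<le> s\<^sub>k\<close> for \<open>j > k\<close>: the maximum is attained at \<open>k\<close> for the first time.
\<close>

definition first_max_at :: "nat \<Rightarrow> int list \<Rightarrow> bool" where
  "first_max_at k xs \<longleftrightarrow> suffixes_pos (take k xs) \<and> prefixes_nonpos (drop k xs)"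

lemma npos_le: "npos xs \<le> length xs"
  by (induction xs) auto

lemma suffixes_pos_Cons: "suffixes_pos (x # xs) \<longleftrightarrow> x + sum_list xs > 0 \<and> suffixes_pos xs"
  unfolding suffixes_pos_def
  by (auto simp: less_Suc_eq_0_disj)

lemma suffixes_pos_sum: "suffixes_pos xs \<Longrightarrow> sum_list xs \<ge> 0"
  by (cases xs) (auto simp: suffixes_pos_Cons dest: less_imp_le)

lemma prefixes_nonpos_sum: "prefixes_nonpos xs \<Longrightarrow> sum_list xs \<le> 0"
  unfolding prefixes_nonpos_def by (metis order_refl take_all)

lemma prefixes_nonpos_snoc:
  "prefixes_nonpos (xs @ [x]) \<longleftrightarrow> prefixes_nonpos xs \<and> sum_list xs + x \<le> 0"
  unfolding prefixes_nonpos_def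
  by (auto simp: le_Suc_eq)

text \<open>
  If the last sum is at most \<open>0 = s\<^sub>0\<close>, it is irrelevant for the first maximum.
\<close>

lemma first_max_at_snoc:
  assumes "sum_list (xs @ [x]) \<le> 0" "k \<le> length xs"
  shows "first_max_at k (xs @ [x]) \<longleftrightarrow> first_max_at k xs"
proof -
  have "sum_list (drop k xs) + x \<le> 0" if "suffixes_pos (take k xs)"
    using suffixes_pos_sum[OF that] assms(1) arg_cong[OF append_take_drop_id[of k xs], of sum_list]
    by (simp del: append_take_drop_id)
  then show ?thesis
    using assms(2) by (auto simp: first_max_at_def prefixes_nonpos_snoc)
qed

text \<open>
  If the last sum exceeds \<open>s\<^sub>0 = 0\<close>, the first maximum is not at time \<open>0\<close>, and the walk may as well be
  started at time \<open>1\<close>.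
\<close>

lemma first_max_at_Cons:
  assumes "sum_list (x # xs) > 0"
  shows "first_max_at (Suc k) (x # xs) \<longleftrightarrow> first_max_at k xs"
proof -
  have "x + sum_list (take k xs) > 0" if "prefixes_nonpos (drop k xs)"
    using prefixes_nonpos_sum[OF that] assms arg_cong[OF append_take_drop_id[of k xs], of sum_list]
    by (simp del: append_take_drop_id)
  then show ?thesis
    by (auto simp: first_max_at_def suffixes_pos_Cons)
qed

lemma not_first_max_at_0: "sum_list xs > 0 \<Longrightarrow> \<not> first_max_at 0 xs"
  using prefixes_nonpos_sum by (fastforce simp: first_max_at_def)

lemma not_first_max_at_length:
  assumes "sum_list xs \<le> 0" "xs \<noteq> []" shows "\<not> first_max_at (length xs) xs"
  using assms by (auto simp: first_max_at_def suffixes_pos_def)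

lemma prob_bind_pmf:
  "measure_pmf.prob (bind_pmf p f) A = (\<integral>x. measure_pmf.prob (f x) A \<partial>p)"
proof -
  have "ennreal (measure_pmf.prob (bind_pmf p f) A) = (\<integral>\<^sup>+x. ennreal (measure_pmf.prob (f x) A) \<partial>p)"
    by (simp add: measure_pmf.emeasure_eq_measure[symmetric])
  also have "\<dots> = ennreal (\<integral>x. measure_pmf.prob (f x) A \<partial>p)"
    by (intro nn_integral_eq_integral measure_pmf.integrable_const_bound[where B = 1]) auto
  finally show ?thesis
    by (simp add: integral_nonneg_AE)
qed

lemma replicate_pmf_Suc': "replicate_pmf (Suc n) p = bind_pmf p (\<lambda>x. map_pmf (Cons x) (replicate_pmf n p))"
  by (simp add: map_pmf_def)

lemma replicate_pmf_snoc:
  "replicate_pmf (Suc n) p = bind_pmf p (\<lambda>x. map_pmf (\<lambda>xs. xs @ [x]) (replicate_pmf n p))"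
proof -
  have "replicate_pmf (n + 1) p = bind_pmf (replicate_pmf n p) (\<lambda>xs. bind_pmf p (\<lambda>x. return_pmf (xs @ [x])))"
    unfolding replicate_pmf_distrib by (simp add: bind_assoc_pmf bind_return_pmf)
  also have "\<dots> = bind_pmf p (\<lambda>x. bind_pmf (replicate_pmf n p) (\<lambda>xs. return_pmf (xs @ [x])))"
    by (rule bind_commute_pmf)
  finally show ?thesis by (simp add: map_pmf_def)
qed

lemma prob_replicate_Cons:
  "measure_pmf.prob (replicate_pmf (Suc n) p) A =
     (\<integral>x. measure_pmf.prob (replicate_pmf n p) {xs. x # xs \<in> A} \<partial>p)"
  unfolding replicate_pmf_Suc' prob_bind_pmf measure_map_pmf by (simp add: vimage_def)

lemma prob_replicate_snoc:
  "measure_pmf.prob (replicate_pmf (Suc n) p) A =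
     (\<integral>x. measure_pmf.prob (replicate_pmf n p) {xs. xs @ [x] \<in> A} \<partial>p)"
  unfolding replicate_pmf_snoc prob_bind_pmf measure_map_pmf by (simp add: vimage_def)

lemma prob_replicate_cong:
  assumes "\<And>xs. length xs = n \<Longrightarrow> xs \<in> A \<longleftrightarrow> xs \<in> B"
  shows "measure_pmf.prob (replicate_pmf n p) A = measure_pmf.prob (replicate_pmf n p) B"
proof (rule measure_prob_cong_0)
qed (use assms in \<open>auto simp: pmf_eq_0_set_pmf set_replicate_pmf\<close>)

lemma map_rev_replicate_pmf: "map_pmf rev (replicate_pmf n p) = replicate_pmf n p"
proof (induction n)
  case (Suc n)
  have "map_pmf rev (replicate_pmf (Suc n) p) =
      bind_pmf p (\<lambda>x. map_pmf (\<lambda>xs. xs @ [x]) (map_pmf rev (replicate_pmf n p)))"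
    unfolding replicate_pmf_Suc' map_bind_pmf by (simp add: map_pmf_comp)
  also have "\<dots> = replicate_pmf (Suc n) p"
    unfolding Suc replicate_pmf_snoc ..
  finally show ?case .
qed simp

text \<open>
  Jointly with the total sum \<open>s\<close>, both quantities obey the same recursion in \<open>n\<close>. If \<open>s \<le> 0\<close>, the
  number of positive suffix sums is unchanged by removing the first step, and the first maximum by
  removing the last one; if \<open>s > 0\<close>, removing the first step lowers both by one. It
  does not matter which step is removed because the steps are exchangeable.
\<close>

lemma prob_npos_eq_first_max:
  assumes "k \<le> n"
  shows "measure_pmf.prob (replicate_pmf n p) {xs. npos xs = k \<and> sum_list xs = s} =
         measure_pmf.prob (replicate_pmf n p) {xs. first_max_at k xs \<and> sum_list xs = s}"
  using assms
proof (induction n arbitrary: k s)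
  case 0
  then show ?case
    by (simp add: first_max_at_def suffixes_pos_def prefixes_nonpos_def indicator_def)
next
  case (Suc n)
  let ?R = "replicate_pmf n p" and ?R' = "replicate_pmf (Suc n) p"
  let ?N = "{xs. npos xs = k \<and> sum_list xs = s}" and ?E = "{xs. first_max_at k xs \<and> sum_list xs = s}"
  show ?case
  proof (cases "s \<le> 0")
    case s: True
    show ?thesis
    proof (cases "k = Suc n")
      case True
      have "measure_pmf.prob ?R' ?N = measure_pmf.prob ?R' {}"
      proof (rule prob_replicate_cong)
        fix xs :: "int list" assume l: "length xs = Suc n"
        then obtain y ys where xs: "xs = y # ys" by (cases xs) auto
        show "xs \<in> ?N \<longleftrightarrow> xs \<in> {}"
          using npos_le[of ys] l s True by (auto simp: xs)
      qed
      moreover have "measure_pmf.prob ?R' ?E = measure_pmf.prob ?R' {}"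
        by (rule prob_replicate_cong) (use s True not_first_max_at_length in fastforce)
      ultimately show ?thesis by simp
    next
      case False
      with Suc.prems have k: "k \<le> n" by simp
      have "measure_pmf.prob ?R' ?N = (\<integral>x. measure_pmf.prob ?R {xs. npos xs = k \<and> sum_list xs = s - x} \<partial>p)"
        unfolding prob_replicate_Cons
        by (intro integral_cong_AE AE_I2 arg_cong[where f = "measure _"]) (use s in auto)
      also have "\<dots> = (\<integral>x. measure_pmf.prob ?R {xs. first_max_at k xs \<and> sum_list xs = s - x} \<partial>p)"
        by (simp add: Suc.IH k)
      also have "\<dots> = measure_pmf.prob ?R' ?E"
        unfolding prob_replicate_snoc
        by (intro integral_cong_AE AE_I2 prob_replicate_cong)
           (use s first_max_at_snoc k in auto)
      finally show ?thesis .
    qed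
  next
    case s: False
    show ?thesis
    proof (cases k)
      case 0
      have "measure_pmf.prob ?R' ?N = measure_pmf.prob ?R' {}"
      proof (rule prob_replicate_cong)
        fix xs :: "int list" assume l: "length xs = Suc n"
        then obtain y ys where xs: "xs = y # ys" by (cases xs) auto
        show "xs \<in> ?N \<longleftrightarrow> xs \<in> {}"
          using l s 0 by (auto simp: xs)
      qed
      moreover have "measure_pmf.prob ?R' ?E = measure_pmf.prob ?R' {}"
        by (rule prob_replicate_cong) (use s 0 not_first_max_at_0 in auto)
      ultimately show ?thesis by simp
    next
      case k: (Suc j)
      have "measure_pmf.prob ?R' ?N = (\<integral>x. measure_pmf.prob ?R {xs. npos xs = j \<and> sum_list xs = s - x} \<partial>p)"
        unfolding prob_replicate_Cons
        by (intro integral_cong_AE AE_I2 arg_cong[where f = "measure _"]) (use s k in auto)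
      also have "\<dots> = (\<integral>x. measure_pmf.prob ?R {xs. first_max_at j xs \<and> sum_list xs = s - x} \<partial>p)"
        using Suc.prems k by (simp add: Suc.IH)
      also have "\<dots> = measure_pmf.prob ?R' ?E"
        unfolding prob_replicate_Cons
        by (intro integral_cong_AE AE_I2 arg_cong[where f = "measure _"]) (use s first_max_at_Cons k in auto)
      finally show ?thesis .
    qed
  qed
qed

text \<open>
  The steps before and after the first maximum are independent of each other, and the conditions on
  them are separate.
\<close>

lemma prob_npos_splits:
  assumes "k \<le> n"
  shows "measure_pmf.prob (replicate_pmf n p) {xs. npos xs = k} =
         measure_pmf.prob (replicate_pmf k p) {xs. suffixes_pos xs} *
         measure_pmf.prob (replicate_pmf (n - k) p) {xs. prefixes_nonpos xs}"
proof -
  let ?R = "replicate_pmf n p"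
  have sum_s: "measure_pmf.prob ?R {xs. Q xs} =
      (\<integral>s. measure_pmf.prob ?R {xs. Q xs \<and> sum_list xs = s} \<partial>count_space UNIV)" for Q
  proof -
    have "ennreal (measure_pmf.prob ?R {xs. Q xs}) = emeasure ?R {xs. Q xs}"
      by (simp add: measure_pmf.emeasure_eq_measure)
    also have "\<dots> = (\<integral>\<^sup>+s. emeasure ?R {xs. Q xs \<and> sum_list xs = s} \<partial>count_space UNIV)"
    proof -
      have "{xs. Q xs} = (\<Union>s\<in>UNIV. {xs. Q xs \<and> sum_list xs = s})" by auto
      then show ?thesis
        by (simp only:) (rule emeasure_UN_countable, auto simp: disjoint_family_on_def)
    qed
    finally have *: "ennreal (measure_pmf.prob ?R {xs. Q xs}) =
        (\<integral>\<^sup>+s. ennreal (measure_pmf.prob ?R {xs. Q xs \<and> sum_list xs = s}) \<partial>count_space UNIV)"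
      by (simp add: measure_pmf.emeasure_eq_measure)
    show ?thesis
      by (subst integral_eq_nn_integral) (auto simp: *[symmetric])
  qed
  have "measure_pmf.prob ?R {xs. npos xs = k} = measure_pmf.prob ?R {xs. first_max_at k xs}"
    unfolding sum_s[of "\<lambda>xs. npos xs = k"] sum_s[of "first_max_at k"]
    by (simp add: prob_npos_eq_first_max assms)
  also have "\<dots> = measure_pmf.prob (map_pmf (\<lambda>(xs, ys). xs @ ys)
      (pair_pmf (replicate_pmf k p) (replicate_pmf (n - k) p))) {xs. first_max_at k xs}"
    (is "_ = measure_pmf.prob ?R2 _")
  proof -
    have "?R = map_pmf (\<lambda>(xs, ys). xs @ ys) (pair_pmf (replicate_pmf k p) (replicate_pmf (n - k) p))"
    using replicate_pmf_distrib[of k "n - k" p] assms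
    by (simp add: pair_pmf_def map_bind_pmf map_pmf_def bind_assoc_pmf bind_return_pmf)
    then show ?thesis by simp
  qed
  also have "measure_pmf.prob ?R2 {xs. first_max_at k xs} =
      measure_pmf.prob (pair_pmf (replicate_pmf k p) (replicate_pmf (n - k) p))
        ({xs. suffixes_pos xs} \<times> {xs. prefixes_nonpos xs})"
    unfolding measure_map_pmf
    by (rule measure_prob_cong_0)
       (auto simp: pmf_eq_0_set_pmf set_replicate_pmf first_max_at_def)
  also have "\<dots> = measure_pmf.prob (replicate_pmf k p) {xs. suffixes_pos xs} *
         measure_pmf.prob (replicate_pmf (n - k) p) {xs. prefixes_nonpos xs}"
    by (rule measure_pmf_prob_product) auto
  finally show ?thesis .
qed

section \<open>Convolutions of regularly growing sequences\<close>

text \<open>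
  The coefficients of \<open>(1 - X)\<^bsup>-(i+1)\<^esup>\<close>, asymptotic to \<open>n\<^sup>i / i!\<close>. Normalizing by them instead of by
  powers of \<open>n\<close> makes the convolution of the normalizing sequences an exact identity.
\<close>

definition rising :: "nat \<Rightarrow> nat \<Rightarrow> real" where
  "rising i n = of_nat ((n + i) choose i)"

lemma rising_pos: "rising i n > 0"
  by (simp add: rising_def zero_less_binomial)

lemma rising_0: "rising 0 n = 1"
  by (simp add: rising_def)

lemma rising_mono: "m \<le> n \<Longrightarrow> rising i m \<le> rising i n"
  by (simp add: rising_def binomial_right_mono)

lemma sum_rising: "(\<Sum>k\<le>n. rising i k) = rising (Suc i) n"
  using choose_rising_sum(1)[of i n] by (simp add: rising_def add.commute flip: of_nat_sum)

lemma fps_rising: "Abs_fps (rising i) = Abs_fps (\<lambda>_. 1) ^ Suc i"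
proof (induction i)
  case (Suc i)
  have "Abs_fps (rising (Suc i)) = Abs_fps (rising i) * Abs_fps (\<lambda>_. 1)"
    by (rule fps_ext) (simp add: fps_mult_nth sum_rising atLeast0AtMost)
  then show ?case
    by (simp add: Suc mult.commute)
qed (simp add: rising_0)

lemma rising_convolution:
  "(\<Sum>k\<le>n. rising i k * rising j (n - k)) = rising (Suc (i + j)) n"
proof -
  have "Abs_fps (rising i) * Abs_fps (rising j) = Abs_fps (rising (Suc (i + j)))"
    by (simp add: fps_rising power_add mult_ac)
  then show ?thesis
    by (simp add: fps_eq_iff fps_mult_nth atLeast0AtMost)
qed

lemma rising_asymp: "(\<lambda>n. rising i n / real n ^ i) \<longlonglongrightarrow> 1 / fact i"
proof (induction i)
  case (Suc i)
  have step: "rising (Suc i) n = rising i n * (real n + real i + 1) / real (Suc i)" for n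
    using Suc_times_binomial[of i "n + i"]
    by (simp add: rising_def field_simps flip: of_nat_mult of_nat_add of_nat_Suc) 
  have "(\<lambda>n. rising i n / real n ^ i * ((real n + real i + 1) / real n) / real (Suc i))
      \<longlonglongrightarrow> 1 / fact i * 1 / real (Suc i)"
  proof (rule tendsto_divide[OF tendsto_mult[OF Suc] tendsto_const])
    show "(\<lambda>n. (real n + real i + 1) / real n) \<longlonglongrightarrow> 1" by real_asymp
  qed auto
  moreover have "rising i n / real n ^ i * ((real n + real i + 1) / real n) / real (Suc i) =
      rising (Suc i) n / real n ^ Suc i" for n
    by (simp only: step power_Suc times_divide_times_eq divide_divide_eq_left mult_ac)
  ultimately show ?case by (simp add: mult.commute)
qed (simp add: rising_0)

lemma rising_ratio_null:
  assumes "i < j"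
  shows "(\<lambda>n. rising i n / rising j n) \<longlonglongrightarrow> 0"
proof -
  have "(\<lambda>n. (rising i n / real n ^ i) / (rising j n / real n ^ j) * (1 / real n ^ (j - i)))
      \<longlonglongrightarrow> (1 / fact i) / (1 / fact j) * 0"
  proof (rule tendsto_mult[OF tendsto_divide[OF rising_asymp rising_asymp]])
    show "(\<lambda>n. 1 / real n ^ (j - i)) \<longlonglongrightarrow> 0"
      using assms LIMSEQ_inverse_realpow_zero
      by (intro tendsto_divide_0[OF tendsto_const] filterlim_at_top_imp_at_infinity filterlim_pow_at_top filterlim_real_sequentially) auto
  qed auto
  moreover have "\<forall>\<^sub>F n in sequentially. (rising i n / real n ^ i) / (rising j n / real n ^ j) * (1 / real n ^ (j - i)) = rising i n / rising j n"
  proof (rule eventually_mono[OF eventually_gt_at_top[of 0]])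
    fix n :: nat assume "n > 0"
    moreover have "real n ^ j = real n ^ i * real n ^ (j - i)"
      using assms by (simp flip: power_add)
    ultimately show "(rising i n / real n ^ i) / (rising j n / real n ^ j) * (1 / real n ^ (j - i)) = rising i n / rising j n"
      by (simp add: field_simps)
  qed
  ultimately show ?thesis
    by (auto elim: Lim_transform_eventually)
qed

text \<open>
  The weights of the average add up to one and the weight of each fixed \<open>k\<close> tends to zero, so this is
  an instance of Toeplitz's lemma.
\<close>

lemma rising_average_null:
  assumes "e \<longlonglongrightarrow> (0 :: real)"
  shows "(\<lambda>n. (\<Sum>k\<le>n. rising i k * rising j (n - k) * e k) / rising (Suc (i + j)) n) \<longlonglongrightarrow> 0"
proof (rule LIMSEQ_I)
  fix r :: real assume r: "r > 0"
  let ?W = "rising (Suc (i + j))"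
  obtain K where K: "\<And>k. k \<ge> K \<Longrightarrow> \<bar>e k\<bar> < r / 2"
    using LIMSEQ_D[OF assms, of "r / 2"] r by auto
  define C where "C = (\<Sum>k<K. rising i k * \<bar>e k\<bar>)"
  have "(\<lambda>n. C * (rising j n / ?W n)) \<longlonglongrightarrow> C * 0"
    by (intro tendsto_intros rising_ratio_null) auto
  then obtain N where N: "\<And>n. n \<ge> N \<Longrightarrow> \<bar>C * (rising j n / ?W n)\<bar> < r / 2"
    using LIMSEQ_D[of "\<lambda>n. C * (rising j n / ?W n)" 0 "r / 2"] r by auto
  have "\<bar>(\<Sum>k\<le>n. rising i k * rising j (n - k) * e k) / ?W n\<bar> < r" if "n \<ge> max N K" for n
  proof -
    have "\<bar>\<Sum>k\<le>n. rising i k * rising j (n - k) * e k\<bar> \<le> (\<Sum>k\<le>n. rising i k * rising j (n - k) * \<bar>e k\<bar>)"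
      by (rule order_trans[OF sum_abs]) (simp add: abs_mult rising_pos less_imp_le)
    also have "\<dots> \<le> (\<Sum>k\<le>n. (if k < K then rising i k * \<bar>e k\<bar> * rising j n else 0) +
        rising i k * rising j (n - k) * (r / 2))"
    proof (rule sum_mono)
      fix k assume "k \<in> {..n}"
      show "rising i k * rising j (n - k) * \<bar>e k\<bar> \<le>
          (if k < K then rising i k * \<bar>e k\<bar> * rising j n else 0) + rising i k * rising j (n - k) * (r / 2)"
      proof (cases "k < K")
        case True
        have "rising i k * \<bar>e k\<bar> * rising j (n - k) \<le> rising i k * \<bar>e k\<bar> * rising j n"
          by (intro mult_left_mono rising_mono) (auto simp: rising_pos less_imp_le)
        moreover have "rising i k * rising j (n - k) * (r / 2) \<ge> 0"
          using r by (simp add: rising_pos less_imp_le)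
        ultimately show ?thesis using True by (simp add: mult_ac)
      next
        case False
        then have "\<bar>e k\<bar> \<le> r / 2" using K[of k] by simp
        then show ?thesis
          using False by (simp only: if_False add_0_left) (intro mult_left_mono, auto simp: rising_pos less_imp_le)
      qed
    qed
    also have "\<dots> = (\<Sum>k\<le>n. if k < K then rising i k * \<bar>e k\<bar> * rising j n else 0) + ?W n * (r / 2)"
      by (simp only: sum.distrib rising_convolution flip: sum_distrib_right)
    also have "(\<Sum>k\<le>n. if k < K then rising i k * \<bar>e k\<bar> * rising j n else 0) = C * rising j n"
    proof -
      have "{..n} \<inter> {k. k < K} = {..<K}" using that by auto
      then show ?thesis
        by (simp add: sum.If_cases C_def sum_distrib_right)
    qed
    finally have "\<bar>\<Sum>k\<le>n. rising i k * rising j (n - k) * e k\<bar> / ?W n \<le> (C * rising j n + ?W n * (r / 2)) / ?W n"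
      by (intro divide_right_mono) (auto simp: rising_pos less_imp_le)
    also have "\<dots> = C * (rising j n / ?W n) + r / 2"
      using rising_pos[of "Suc (i + j)" n] by (simp add: field_simps)
    also have "\<dots> < r" using abs_ge_self[THEN le_less_trans, OF N[of n]] that by linarith
    finally show ?thesis
      using rising_pos[of "Suc (i + j)" n] by simp
  qed
  then show "\<exists>no. \<forall>n\<ge>no. norm ((\<Sum>k\<le>n. rising i k * rising j (n - k) * e k) / ?W n - 0) < r"
    unfolding real_norm_def diff_zero by blast
qed

text \<open>
  Replacing the normalized factors by their limits costs only weighted averages of null sequences.
\<close>

lemma convolution_asymp:
  fixes u v :: "nat \<Rightarrow> real"
  assumes u: "(\<lambda>n. u n / rising i n) \<longlonglongrightarrow> \<alpha>" and v: "(\<lambda>n. v n / rising j n) \<longlonglongrightarrow> \<beta>"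
  shows "(\<lambda>n. (\<Sum>k\<le>n. u k * v (n - k)) / rising (Suc (i + j)) n) \<longlonglongrightarrow> \<alpha> * \<beta>"
proof -
  let ?w = "\<lambda>n k. rising i k * rising j (n - k)"
  let ?W = "rising (Suc (i + j))"
  define x where "x n = u n / rising i n" for n
  define y where "y n = v n / rising j n" for n
  have ux: "u n = rising i n * x n" and vy: "v n = rising j n * y n" for n
    using rising_pos[of i n] rising_pos[of j n] by (auto simp: x_def y_def)
  have xl: "x \<longlonglongrightarrow> \<alpha>" and yl: "y \<longlonglongrightarrow> \<beta>"
    using u v unfolding x_def y_def by blast+
  obtain B where B: "\<And>n. \<bar>y n\<bar> \<le> B"
    using convergent_imp_Bseq[OF convergentI[OF yl]] by (auto simp: Bseq_def)
  have null1: "(\<lambda>n. (\<Sum>k\<le>n. ?w n k * \<bar>x k - \<alpha>\<bar>) / ?W n) \<longlonglongrightarrow> 0"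
    by (intro rising_average_null tendsto_rabs_zero) (use xl LIM_zero in blast)
  have null2: "(\<lambda>n. (\<Sum>k\<le>n. ?w n k * \<bar>y (n - k) - \<beta>\<bar>) / ?W n) \<longlonglongrightarrow> 0"
  proof -
    have "(\<lambda>n. (\<Sum>k\<le>n. rising j k * rising i (n - k) * \<bar>y k - \<beta>\<bar>) / rising (Suc (j + i)) n) \<longlonglongrightarrow> 0"
      by (intro rising_average_null tendsto_rabs_zero) (use yl LIM_zero in blast)
    moreover have "(\<Sum>k\<le>n. ?w n k * \<bar>y (n - k) - \<beta>\<bar>) =
        (\<Sum>k\<le>n. rising j k * rising i (n - k) * \<bar>y k - \<beta>\<bar>)" for n
      by (rule sum.reindex_bij_witness[where i = "\<lambda>k. n - k" and j = "\<lambda>k. n - k"]) auto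
    ultimately show ?thesis by (simp add: add.commute)
  qed
  have "(\<lambda>n. (\<Sum>k\<le>n. u k * v (n - k)) / ?W n - \<alpha> * \<beta>) \<longlonglongrightarrow> 0"
  proof (rule Lim_null_comparison)
    show "(\<lambda>n. B * ((\<Sum>k\<le>n. ?w n k * \<bar>x k - \<alpha>\<bar>) / ?W n) +
        \<bar>\<alpha>\<bar> * ((\<Sum>k\<le>n. ?w n k * \<bar>y (n - k) - \<beta>\<bar>) / ?W n)) \<longlonglongrightarrow> 0"
      using tendsto_add[OF tendsto_mult_left[OF null1, of B] tendsto_mult_left[OF null2, of "\<bar>\<alpha>\<bar>"]]
      by simp
    show "\<forall>\<^sub>F n in sequentially. norm ((\<Sum>k\<le>n. u k * v (n - k)) / ?W n - \<alpha> * \<beta>) \<le>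
        B * ((\<Sum>k\<le>n. ?w n k * \<bar>x k - \<alpha>\<bar>) / ?W n) +
        \<bar>\<alpha>\<bar> * ((\<Sum>k\<le>n. ?w n k * \<bar>y (n - k) - \<beta>\<bar>) / ?W n)"
    proof (intro always_eventually allI)
      fix n
      have W: "?W n > 0" by (rule rising_pos)
      have "(\<Sum>k\<le>n. u k * v (n - k)) - \<alpha> * \<beta> * ?W n =
          (\<Sum>k\<le>n. ?w n k * (x k * y (n - k) - \<alpha> * \<beta>))"
        unfolding rising_convolution[symmetric] sum_distrib_left sum_subtractf[symmetric]
        by (intro sum.cong refl) (simp add: ux vy algebra_simps)
      also have "\<bar>\<dots>\<bar> \<le> (\<Sum>k\<le>n. ?w n k * (B * \<bar>x k - \<alpha>\<bar> + \<bar>\<alpha>\<bar> * \<bar>y (n - k) - \<beta>\<bar>))"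
      proof (rule sum_abs[THEN order_trans], rule sum_mono)
        fix k
        have "x k * y (n - k) - \<alpha> * \<beta> = y (n - k) * (x k - \<alpha>) + \<alpha> * (y (n - k) - \<beta>)"
          by (simp add: algebra_simps)
        also have "\<bar>\<dots>\<bar> \<le> B * \<bar>x k - \<alpha>\<bar> + \<bar>\<alpha>\<bar> * \<bar>y (n - k) - \<beta>\<bar>"
          by (rule abs_triangle_ineq[THEN order_trans]) (auto simp: abs_mult intro!: mult_right_mono B)
        finally show "\<bar>?w n k * (x k * y (n - k) - \<alpha> * \<beta>)\<bar> \<le>
            ?w n k * (B * \<bar>x k - \<alpha>\<bar> + \<bar>\<alpha>\<bar> * \<bar>y (n - k) - \<beta>\<bar>)"
          by (simp add: abs_mult rising_pos less_imp_le mult_left_mono)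
      qed
      also have "\<dots> = B * (\<Sum>k\<le>n. ?w n k * \<bar>x k - \<alpha>\<bar>) +
        \<bar>\<alpha>\<bar> * (\<Sum>k\<le>n. ?w n k * \<bar>y (n - k) - \<beta>\<bar>)"
        by (simp add: sum_distrib_left sum.distrib algebra_simps)
      finally have "\<bar>(\<Sum>k\<le>n. u k * v (n - k)) - \<alpha> * \<beta> * ?W n\<bar> / ?W n \<le> \<dots> / ?W n"
        using W by (intro divide_right_mono) auto
      moreover have "\<bar>(\<Sum>k\<le>n. u k * v (n - k)) - \<alpha> * \<beta> * ?W n\<bar> / ?W n = \<bar>(\<Sum>k\<le>n. u k * v (n - k)) / ?W n - \<alpha> * \<beta>\<bar>"
        proof -
        have "(\<Sum>k\<le>n. u k * v (n - k)) / ?W n - \<alpha> * \<beta> = ((\<Sum>k\<le>n. u k * v (n - k)) - \<alpha> * \<beta> * ?W n) / ?W n"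
          using W by (simp add: diff_divide_distrib)
        then show ?thesis using W by (simp only: abs_divide abs_of_pos)
      qed
      ultimately show "norm ((\<Sum>k\<le>n. u k * v (n - k)) / ?W n - \<alpha> * \<beta>) \<le>
        B * ((\<Sum>k\<le>n. ?w n k * \<bar>x k - \<alpha>\<bar>) / ?W n) +
        \<bar>\<alpha>\<bar> * ((\<Sum>k\<le>n. ?w n k * \<bar>y (n - k) - \<beta>\<bar>) / ?W n)"
        by (simp add: add_divide_distrib)
    qed
  qed
  then show ?thesis by (rule LIM_zero_cancel)
qed

section \<open>Moments of a splitting law\<close>

lemma XD_power_mult:
  fixes P A :: "real fps"
  shows "(fps_XD ^^ m) (P * A) = (\<Sum>j\<le>m. of_nat (m choose j) * ((fps_XD ^^ (m - j)) P * (fps_XD ^^ j) A))"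
proof (rule fps_ext)
  fix n
  have "fps_nth ((fps_XD ^^ m) (P * A)) n = (\<Sum>k=0..n. (real n ^ m) * (fps_nth P k * fps_nth A (n - k)))"
    unfolding fps_mult_fps_XD_shift by (simp add: fps_mult_nth sum_distrib_left)
  also have "\<dots> = (\<Sum>k=0..n. \<Sum>j\<le>m. real (m choose j) * (real k ^ (m - j) * fps_nth P k * (real (n - k) ^ j * fps_nth A (n - k))))"
  proof (rule sum.cong[OF refl])
    fix k assume "k \<in> {0..n}"
    then have "real n = real (n - k) + real k" by simp
    then have "real n ^ m = (\<Sum>j\<le>m. real (m choose j) * real (n - k) ^ j * real k ^ (m - j))"
      by (simp only: binomial_ring)
    then show "real n ^ m * (fps_nth P k * fps_nth A (n - k)) =
        (\<Sum>j\<le>m. real (m choose j) * (real k ^ (m - j) * fps_nth P k * (real (n - k) ^ j * fps_nth A (n - k))))"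
      by (simp add: sum_distrib_left sum_distrib_right mult_ac)
  qed
  also have "\<dots> = (\<Sum>j\<le>m. of_nat (m choose j) * (\<Sum>k=0..n. real k ^ (m - j) * fps_nth P k * (real (n - k) ^ j * fps_nth A (n - k))))"
    by (subst sum.swap) (simp add: sum_distrib_left)
  also have "\<dots> = fps_nth (\<Sum>j\<le>m. of_nat (m choose j) * ((fps_XD ^^ (m - j)) P * (fps_XD ^^ j) A)) n"
    unfolding fps_sum_nth fps_mult_fps_XD_shift
    by (intro sum.cong refl)
       (simp add: fps_of_nat[symmetric] fps_mult_nth[of "Abs_fps _" "Abs_fps _"])
  finally show "fps_nth ((fps_XD ^^ m) (P * A)) n = \<dots>" .
qed

text \<open>
  Let \<open>A\<close>, \<open>B\<close> and \<open>P\<close> be the generating functions of \<open>a\<close>, \<open>b\<close> and \<open>p\<close>, and let \<open>D = X d/dX\<close>. The hypotheses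
  say that \<open>A B = 1/(1-X)\<close> and \<open>(D A) B = P/(1-X)\<close>; multiplying the latter by \<open>A\<close> gives \<open>D A = P A\<close>,
  which is Sparre Andersen's identity. The \<open>m\<close>-th moments have the generating function
  \<open>(D\<^sup>m A) B\<close>, so the recursion is Leibniz's rule for \<open>D\<^sup>m (P A)\<close>.
\<close>

lemma moment_recursion:
  fixes a b p :: "nat \<Rightarrow> real"
  assumes total: "\<And>n. (\<Sum>k\<le>n. a k * b (n - k)) = 1"
    and mean: "\<And>n. (\<Sum>k\<le>n. real k * a k * b (n - k)) = (\<Sum>k\<le>n. p k)"
  defines "M \<equiv> \<lambda>m n. \<Sum>k\<le>n. real k ^ m * a k * b (n - k)"
  shows "M (Suc m) n = (\<Sum>j\<le>m. real (m choose j) * (\<Sum>k\<le>n. real k ^ (m - j) * p k * M j (n - k)))"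
proof -
  define A B P H where "A = Abs_fps a" "B = Abs_fps b" "P = Abs_fps p" "H = Abs_fps (\<lambda>_. 1 :: real)"
  have AB: "A * B = H"
    using total by (auto simp: fps_eq_iff fps_mult_nth A_B_P_H_def atLeast0AtMost)
  have DAB: "fps_XD A * B = H * P"
    unfolding mult.commute[of H] using mean
    by (auto simp: fps_eq_iff fps_mult_nth A_B_P_H_def atLeast0AtMost)
  have "H * (fps_XD A) = H * (P * A)"
    using arg_cong[OF DAB, of "(*) A"] by (simp only: AB[symmetric] mult_ac)
  \<comment> \<open>the factor \<open>1/(1-X)\<close> can be cancelled since power series over the reals form a domain\<close>
  moreover have "H \<noteq> 0" by (auto simp: A_B_P_H_def fps_eq_iff)
  ultimately have DA: "fps_XD A = P * A" by simp
  have M: "fps_nth ((fps_XD ^^ m) A * B) n = M m n" for m n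
    unfolding fps_mult_fps_XD_shift by (simp add: fps_mult_nth A_B_P_H_def M_def atLeast0AtMost)
  have "(fps_XD ^^ Suc m) A * B = (\<Sum>j\<le>m. of_nat (m choose j) * ((fps_XD ^^ (m - j)) P * ((fps_XD ^^ j) A * B)))"
    by (simp only: funpow_Suc_right o_apply DA XD_power_mult sum_distrib_right mult.assoc)
  then have "M (Suc m) n = fps_nth (\<Sum>j\<le>m. of_nat (m choose j) * ((fps_XD ^^ (m - j)) P * ((fps_XD ^^ j) A * B))) n"
    by (simp only: M[symmetric])
  also have "\<dots> = (\<Sum>j\<le>m. real (m choose j) * (\<Sum>k\<le>n. real k ^ (m - j) * p k * M j (n - k)))"
    unfolding fps_sum_nth
  proof (intro sum.cong refl)
    fix j
    have "fps_nth (of_nat (m choose j) * ((fps_XD ^^ (m - j)) P * ((fps_XD ^^ j) A * B))) n =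
        real (m choose j) * fps_nth ((fps_XD ^^ (m - j)) P * ((fps_XD ^^ j) A * B)) n"
      by (simp add: fps_of_nat[symmetric])
    also have "fps_nth ((fps_XD ^^ (m - j)) P * ((fps_XD ^^ j) A * B)) n = (\<Sum>k\<le>n. real k ^ (m - j) * p k * M j (n - k))"
      unfolding fps_mult_nth[of "(fps_XD ^^ (m - j)) P"] M
      unfolding fps_mult_fps_XD_shift by (simp add: A_B_P_H_def atLeast0AtMost)
    finally show "fps_nth (of_nat (m choose j) * ((fps_XD ^^ (m - j)) P * ((fps_XD ^^ j) A * B))) n =
        real (m choose j) * (\<Sum>k\<le>n. real k ^ (m - j) * p k * M j (n - k))" .
  qed
  finally show ?thesis .
qed

text \<open>
  This product is \<open>(2m choose m) / 4\<^sup>m\<close>.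
\<close>

definition arcsine_moment :: "nat \<Rightarrow> real" where
  "arcsine_moment m = (\<Prod>i<m. (2 * real i + 1) / (2 * real i + 2))"

lemma arcsine_moment_Suc:
  "arcsine_moment (Suc m) = arcsine_moment m * ((2 * real m + 1) / (2 * real m + 2))"
  by (simp add: arcsine_moment_def)

lemma sum_arcsine_moment: "(\<Sum>j\<le>m. arcsine_moment j) = 2 * (real m + 1) * arcsine_moment (Suc m)"
proof (induction m)
  case 0
  show ?case by (simp add: arcsine_moment_def)
next
  case (Suc m)
  have "(\<Sum>j\<le>Suc m. arcsine_moment j) = (2 * real m + 3) * arcsine_moment (Suc m)"
    using Suc by (simp add: algebra_simps)
  also have "\<dots> = 2 * (real (Suc m) + 1) * arcsine_moment (Suc (Suc m))"
    unfolding arcsine_moment_Suc[of "Suc m"] by (simp add: field_simps)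
  finally show ?case .
qed

text \<open>
  If the moments of order \<open>j \<le> m\<close> grow like \<open>c\<^sub>j n\<^sup>j\<close>, the recursion and the asymptotics of convolutions
  show that the next moment grows like \<open>c n\<^bsup>m+1\<^esup>\<close> with \<open>2 (m + 1) c = c\<^sub>0 + \<dots> + c\<^sub>m\<close>. By
  \<open>sum_arcsine_moment\<close> the moments of the arcsine law are the solution of this recursion.
\<close>

lemma splitting_moments_asymp:
  fixes a b p :: "nat \<Rightarrow> real"
  assumes total: "\<And>n. (\<Sum>k\<le>n. a k * b (n - k)) = 1"
    and mean: "\<And>n. (\<Sum>k\<le>n. real k * a k * b (n - k)) = (\<Sum>k\<le>n. p k)"
    and p: "p \<longlonglongrightarrow> 1 / 2"
  shows "(\<lambda>n. (\<Sum>k\<le>n. real k ^ m * a k * b (n - k)) / real n ^ m) \<longlonglongrightarrow> arcsine_moment m"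
proof -
  define M where "M m n = (\<Sum>k\<le>n. real k ^ m * a k * b (n - k))" for m n
  have rec: "M (Suc m) n = (\<Sum>j\<le>m. real (m choose j) * (\<Sum>k\<le>n. real k ^ (m - j) * p k * M j (n - k)))" for m n
    unfolding M_def by (rule moment_recursion[OF total mean])
  have pk: "(\<lambda>n. real n ^ i * p n / rising i n) \<longlonglongrightarrow> fact i / 2" for i
  proof -
    have "(\<lambda>n. p n / (rising i n / real n ^ i)) \<longlonglongrightarrow> (1 / 2) / (1 / fact i)"
      by (intro tendsto_intros p rising_asymp) auto
    then show ?thesis by (simp add: mult.commute)
  qed
  have "(\<lambda>n. M m n / rising m n) \<longlonglongrightarrow> fact m * arcsine_moment m"
  proof (induction m rule: less_induct)
    case (less m)
    show ?case
    proof (cases m)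
      case 0
      then show ?thesis by (simp add: M_def rising_0 total arcsine_moment_def)
    next
      case (Suc l)
      have "(\<lambda>n. \<Sum>j\<le>l. real (l choose j) * ((\<Sum>k\<le>n. real k ^ (l - j) * p k * M j (n - k)) / rising (Suc l) n))
          \<longlonglongrightarrow> (\<Sum>j\<le>l. real (l choose j) * (fact (l - j) / 2 * (fact j * arcsine_moment j)))"
      proof (intro tendsto_sum tendsto_mult_left)
        fix j assume j: "j \<in> {..l}"
        then have "(\<lambda>n. M j n / rising j n) \<longlonglongrightarrow> fact j * arcsine_moment j"
          using less.IH[of j] Suc by simp
        from convolution_asymp[OF pk[of "l - j"] this]
        show "(\<lambda>n. (\<Sum>k\<le>n. real k ^ (l - j) * p k * M j (n - k)) / rising (Suc l) n) \<longlonglongrightarrow> fact (l - j) / 2 * (fact j * arcsine_moment j)"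
          using j by simp
      qed
      also have "(\<Sum>j\<le>l. real (l choose j) * (fact (l - j) / 2 * (fact j * arcsine_moment j))) =
          (\<Sum>j\<le>l. fact l / 2 * arcsine_moment j)"
      proof (intro sum.cong refl)
        fix j assume "j \<in> {..l}"
        then have "fact j * fact (l - j) * real (l choose j) = fact l"
          by (metis binomial_fact_lemma atMost_iff of_nat_fact of_nat_mult)
        then show "real (l choose j) * (fact (l - j) / 2 * (fact j * arcsine_moment j)) = fact l / 2 * arcsine_moment j"
          by (simp add: field_simps)
      qed
      also have "\<dots> = fact (Suc l) * arcsine_moment (Suc l)"
        unfolding sum_distrib_left[symmetric] sum_arcsine_moment by (simp add: algebra_simps)
      finally show ?thesis
        unfolding Suc rec sum_divide_distrib[of _ _ "rising (Suc l) _"] times_divide_eq_right[symmetric] .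
    qed
  qed
  then have "(\<lambda>n. (M m n / rising m n) * (rising m n / real n ^ m)) \<longlonglongrightarrow> fact m * arcsine_moment m * (1 / fact m)"
    by (intro tendsto_mult rising_asymp)
  moreover have "(M m n / rising m n) * (rising m n / real n ^ m) = M m n / real n ^ m" for n
    using less_imp_neq[OF rising_pos[of m n]] by simp
  ultimately show ?thesis
    by (simp only:) (simp add: M_def)
qed

section \<open>The method of moments on the unit interval\<close>

text \<open>
  By Weierstrass's theorem, the continuous step functions that test weak convergence are uniform
  limits of polynomials on \<open>[0,1]\<close>.
\<close>

lemma moments_imp_weak_conv:
  fixes M_seq :: "nat \<Rightarrow> real measure" and M :: "real measure"
  assumes "\<And>n. real_distribution (M_seq n)" and "real_distribution M"
    and supp: "\<And>n. AE x in M_seq n. x \<in> {0..1}" "AE x in M. x \<in> {0..1}"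
    and mom: "\<And>m. (\<lambda>n. \<integral>x. x ^ m \<partial>M_seq n) \<longlonglongrightarrow> (\<integral>x. x ^ m \<partial>M)"
  shows "weak_conv_m M_seq M"
proof (rule integral_cts_step_conv_imp_weak_conv)
  fix x y :: real assume xy: "x < y"
  let ?f = "cts_step x y"
  interpret M: real_distribution M by fact
  interpret N: real_distribution "M_seq n" for n by fact
  have pow_N: "integrable (M_seq n) (\<lambda>x. x ^ m)" for n m
    by (rule N.integrable_const_bound[where B = 1, OF eventually_mono[OF supp(1)]])
       (auto intro!: power_le_one)
  have pow_M: "integrable M (\<lambda>x. x ^ m)" for m
    by (rule M.integrable_const_bound[where B = 1, OF eventually_mono[OF supp(2)]])
       (auto intro!: power_le_one)
  note pow = pow_N pow_M
  have fm: "integrable (M_seq n) ?f" "integrable M ?f" for n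
    using N.integrable_cts_step M.integrable_cts_step xy by auto
  have close: "\<bar>integral\<^sup>L Q f - integral\<^sup>L Q g\<bar> \<le> e"
    if "prob_space Q" "integrable Q f" "integrable Q g" "AE x in Q. x \<in> {0..1}"
      "\<And>x. x \<in> {0..1} \<Longrightarrow> \<bar>f x - g x\<bar> < e" for Q and f g :: "real \<Rightarrow> real" and e
  proof -
    interpret Q: prob_space Q by fact
    have "\<bar>integral\<^sup>L Q f - integral\<^sup>L Q g\<bar> = \<bar>\<integral>x. f x - g x \<partial>Q\<bar>"
      using that by simp
    also have "\<dots> \<le> (\<integral>x. \<bar>f x - g x\<bar> \<partial>Q)"
      by (rule integral_abs_bound)
    also have "\<dots> \<le> (\<integral>x. e \<partial>Q)"
    proof (rule integral_mono_AE)
      show "AE x in Q. \<bar>f x - g x\<bar> \<le> e"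
        using that(4) by (rule eventually_mono) (use that(5) less_imp_le in blast)
    qed (use that(2,3) in auto)
    finally show ?thesis by (simp add: Q.prob_space)
  qed
  show "(\<lambda>n. integral\<^sup>L (M_seq n) ?f) \<longlonglongrightarrow> integral\<^sup>L M ?f"
  proof (rule LIMSEQ_I)
    fix r :: real assume r: "r > 0"
    have "continuous_on {0..1} ?f"
      using uniformly_continuous_imp_continuous[OF cts_step_uniformly_continuous[OF xy]]
      by (rule continuous_on_subset) auto
    then obtain g where g: "real_polynomial_function g" "\<And>z. z \<in> {0..1} \<Longrightarrow> \<bar>?f z - g z\<bar> < r / 3"
      using Stone_Weierstrass_real_polynomial_function[of "{0..1}" ?f "r / 3"] r by auto
    then obtain a d where gs: "g = (\<lambda>x. \<Sum>i\<le>d. a i * x ^ i)"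
      by (auto simp: real_polynomial_function_iff_sum)
    have gi: "integrable (M_seq n) g" "integrable M g" for n
      unfolding gs using pow by auto
    have "(\<lambda>n. \<Sum>i\<le>d. a i * (\<integral>x. x ^ i \<partial>M_seq n)) \<longlonglongrightarrow> (\<Sum>i\<le>d. a i * (\<integral>x. x ^ i \<partial>M))"
      by (intro tendsto_intros mom)
    moreover have "integral\<^sup>L (M_seq n) g = (\<Sum>i\<le>d. a i * (\<integral>x. x ^ i \<partial>M_seq n))"
      "integral\<^sup>L M g = (\<Sum>i\<le>d. a i * (\<integral>x. x ^ i \<partial>M))" for n
      unfolding gs using pow by (auto simp: Bochner_Integration.integral_sum)
    ultimately have "(\<lambda>n. integral\<^sup>L (M_seq n) g) \<longlonglongrightarrow> integral\<^sup>L M g"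
      by simp
    then obtain N where N: "\<And>n. n \<ge> N \<Longrightarrow> \<bar>integral\<^sup>L (M_seq n) g - integral\<^sup>L M g\<bar> < r / 3"
      using LIMSEQ_D[of "\<lambda>n. integral\<^sup>L (M_seq n) g" _ "r / 3"] r by auto
    have "norm (integral\<^sup>L (M_seq n) ?f - integral\<^sup>L M ?f) < r" if "n \<ge> N" for n
    proof -
      have "\<bar>integral\<^sup>L (M_seq n) ?f - integral\<^sup>L (M_seq n) g\<bar> \<le> r / 3"
        by (rule close[OF N.prob_space_axioms fm(1) gi(1) supp(1) g(2)])
      moreover have "\<bar>integral\<^sup>L M ?f - integral\<^sup>L M g\<bar> \<le> r / 3"
        by (rule close[OF M.prob_space_axioms fm(2) gi(2) supp(2) g(2)])
      ultimately show ?thesis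
        using N[OF that] unfolding real_norm_def by linarith
    qed
    then show "\<exists>no. \<forall>n\<ge>no. norm (integral\<^sup>L (M_seq n) ?f - integral\<^sup>L M ?f) < r"
      by blast
  qed
qed fact+

section \<open>The arcsine law and its moments\<close>

text \<open>
  The uniform distribution on \<open>[0, \<pi>/2]\<close>. The square of the sine of an angle with this distribution
  obeys the arcsine law.
\<close>

definition quarter_period :: "real measure" where
  "quarter_period = density lborel (\<lambda>t. indicator {0..pi / 2} t * (2 / pi))"

definition arcsine_law :: "real measure" where
  "arcsine_law = distr quarter_period borel (\<lambda>t. (sin t)\<^sup>2)"

lemma sets_quarter_period [simp, measurable_cong]: "sets quarter_period = sets borel"
  by (simp add: quarter_period_def)

lemma space_quarter_period [simp]: "space quarter_period = UNIV"
  by (simp add: quarter_period_def)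

lemma emeasure_quarter_period:
  assumes "A \<in> sets borel"
  shows "emeasure quarter_period A = ennreal (2 / pi) * emeasure lborel (A \<inter> {0..pi / 2})"
proof -
  have "emeasure quarter_period A = (\<integral>\<^sup>+t. ennreal (2 / pi) * indicator (A \<inter> {0..pi / 2}) t \<partial>lborel)"
    unfolding quarter_period_def using assms
    by (subst emeasure_density) (auto intro!: nn_integral_cong split: split_indicator)
  also have "\<dots> = ennreal (2 / pi) * emeasure lborel (A \<inter> {0..pi / 2})"
    using assms by (intro nn_integral_cmult_indicator) auto
  finally show ?thesis .
qed

lemma prob_space_quarter_period: "prob_space quarter_period"
proof
  show "emeasure quarter_period (space quarter_period) = 1"
    by (simp add: emeasure_quarter_period flip: ennreal_mult)
qed

lemma real_distribution_arcsine_law: "real_distribution arcsine_law"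
proof -
  interpret prob_space quarter_period by (rule prob_space_quarter_period)
  show ?thesis unfolding arcsine_law_def by (rule real_distribution_distr) measurable
qed

lemma integral_sin_power:
  "(\<integral>t. (sin t) ^ (2 * m) * indicator {0..pi / 2} t \<partial>lborel) = pi / 2 * arcsine_moment m"
proof (induction m)
  case 0
  show ?case by (simp add: arcsine_moment_def)
next
  case (Suc m)
  let ?I = "\<lambda>m. \<integral>t. (sin t :: real) ^ (2 * m) * indicator {0..pi / 2} t \<partial>lborel"
  have int: "integrable lborel (\<lambda>t. (sin t :: real) ^ (2 * m) * indicator {0..pi / 2} t)" for m
    using borel_integrable_atLeastAtMost[of 0 "pi / 2" "\<lambda>t. (sin t :: real) ^ (2 * m)"]
    by (simp add: set_integrable_def indicator_def if_distrib mult.commute cong: if_cong)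
  have "(\<integral>t. ((2 * real m + 1) * (sin t) ^ (2 * m) - (2 * real m + 2) * (sin t) ^ (2 * Suc m)) * indicator {0..pi / 2} t \<partial>lborel) =
      sin (pi / 2) ^ (2 * m + 1) * cos (pi / 2) - sin 0 ^ (2 * m + 1) * cos 0"
  \<comment> \<open>the antiderivative \<open>sin\<^bsup>2m+1\<^esup> t cos t\<close> vanishes at both ends\<close>
  proof (rule integral_FTC_Icc_real)
    fix t :: real
    have "DERIV (\<lambda>t. sin t ^ (2 * m + 1)) t :> real (2 * m + 1) * (cos t * sin t ^ (2 * m + 1 - Suc 0))"
      by (rule DERIV_power) (rule DERIV_sin)
    from DERIV_mult[OF this DERIV_cos]
    have "DERIV (\<lambda>t. sin t ^ (2 * m + 1) * cos t) t :>
        (2 * real m + 1) * (sin t ^ (2 * m) * (cos t)\<^sup>2) - sin t ^ (2 * m) * (sin t)\<^sup>2"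
      by (rule DERIV_cong) (simp add: power2_eq_square algebra_simps)
    then show "DERIV (\<lambda>t. sin t ^ (2 * m + 1) * cos t) t :>
        (2 * real m + 1) * (sin t) ^ (2 * m) - (2 * real m + 2) * (sin t) ^ (2 * Suc m)"
      by (rule DERIV_cong) (simp add: cos_squared_eq algebra_simps power2_eq_square[of "sin t"])
  qed auto
  also have "\<dots> = 0" by simp
  also have "(\<integral>t. ((2 * real m + 1) * (sin t) ^ (2 * m) - (2 * real m + 2) * (sin t) ^ (2 * Suc m)) * indicator {0..pi / 2} t \<partial>lborel) =
     (2 * real m + 1) * ?I m - (2 * real m + 2) * ?I (Suc m)"
    using int[of m] int[of "Suc m"] by (simp add: left_diff_distrib mult.assoc del: mult_Suc_right)
  finally show ?case
    using Suc by (simp add: arcsine_moment_Suc field_simps)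
qed

lemma arcsine_law_moments: "(\<integral>x. x ^ m \<partial>arcsine_law) = arcsine_moment m"
proof -
  have "(\<integral>x. x ^ m \<partial>arcsine_law) = (\<integral>t. sin t ^ (2 * m) \<partial>quarter_period)"
    unfolding arcsine_law_def by (subst integral_distr) (auto simp: power_mult)
  also have "\<dots> = (\<integral>t. 2 / pi * (sin t ^ (2 * m) * indicator {0..pi / 2} t) \<partial>lborel)"
    unfolding quarter_period_def
    by (subst integral_density) (auto simp: mult_ac intro!: Bochner_Integration.integral_cong)
  also have "\<dots> = 2 / pi * (pi / 2 * arcsine_moment m)"
    by (simp only: integral_mult_right_zero integral_sin_power)
  finally show ?thesis by simp
qed

lemma sin_squared_le_iff:
  assumes "0 \<le> t" "t \<le> pi / 2" "0 \<le> \<alpha>" "\<alpha> \<le> 1"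
  shows "(sin t)\<^sup>2 \<le> \<alpha> \<longleftrightarrow> t \<le> arcsin (sqrt \<alpha>)"
proof -
  have "sin t \<ge> 0" using assms by (simp add: sin_ge_zero)
  have rng: "- 1 \<le> sqrt \<alpha>" "sqrt \<alpha> \<le> 1"
    using assms real_sqrt_ge_zero[of \<alpha>] by (linarith, simp)
  have "(sin t)\<^sup>2 \<le> \<alpha> \<longleftrightarrow> sqrt ((sin t)\<^sup>2) \<le> sqrt \<alpha>"
    by (rule real_sqrt_le_iff[symmetric])
  also have "\<dots> \<longleftrightarrow> sin t \<le> sqrt \<alpha>"
    using \<open>sin t \<ge> 0\<close> by simp
  also have "\<dots> \<longleftrightarrow> sin t \<le> sin (arcsin (sqrt \<alpha>))"
    using rng by simp
  also have "\<dots> \<longleftrightarrow> t \<le> arcsin (sqrt \<alpha>)"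
    by (rule sin_mono_le_eq) (use assms rng arcsin_lbound[of "sqrt \<alpha>"] arcsin_ubound[of "sqrt \<alpha>"] in linarith)+
  finally show ?thesis .
qed

lemma cdf_arcsine_law:
  assumes "0 < \<alpha>" "\<alpha> < 1"
  shows "cdf arcsine_law \<alpha> = 2 / pi * arcsin (sqrt \<alpha>)"
proof -
  have rng: "- 1 \<le> sqrt \<alpha>" "sqrt \<alpha> \<le> 1"
    using assms real_sqrt_ge_zero[of \<alpha>] by (linarith, simp)
  have ub: "arcsin (sqrt \<alpha>) \<le> pi / 2" "0 \<le> arcsin (sqrt \<alpha>)"
    using rng arcsin_ubound[of "sqrt \<alpha>"] arcsin_le_arcsin[of 0 "sqrt \<alpha>"] assms by auto
  have "emeasure arcsine_law {..\<alpha>} = emeasure quarter_period {t. (sin t)\<^sup>2 \<le> \<alpha>}"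
    unfolding arcsine_law_def by (subst emeasure_distr) (auto simp: vimage_def)
  also have "\<dots> = ennreal (2 / pi) * emeasure lborel ({t. (sin t)\<^sup>2 \<le> \<alpha>} \<inter> {0..pi / 2})"
    by (rule emeasure_quarter_period) measurable
  also have "{t. (sin t)\<^sup>2 \<le> \<alpha>} \<inter> {0..pi / 2} = {0..arcsin (sqrt \<alpha>)}"
    using assms sin_squared_le_iff ub by auto
  also have "ennreal (2 / pi) * emeasure lborel {0..arcsin (sqrt \<alpha>)} = ennreal (2 / pi * arcsin (sqrt \<alpha>))"
    using ub by (simp flip: ennreal_mult)
  finally show ?thesis
    using ub by (simp add: cdf_def measure_def)
qed

lemma isCont_cdf_arcsine_law:
  assumes "0 < \<alpha>" "\<alpha> < 1"
  shows "isCont (cdf arcsine_law) \<alpha>"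
proof -
  have "\<forall>\<^sub>F x in nhds \<alpha>. x \<in> {0<..<1}"
    using assms by (intro eventually_nhds_in_open) auto
  then have "\<forall>\<^sub>F x in nhds \<alpha>. cdf arcsine_law x = 2 / pi * arcsin (sqrt x)"
    by eventually_elim (simp add: cdf_arcsine_law)
  moreover have "- 1 < sqrt \<alpha>" "sqrt \<alpha> < 1"
    using assms real_sqrt_gt_zero[of \<alpha>] by (linarith, simp)
  then have "isCont (\<lambda>x. 2 / pi * arcsin (sqrt x)) \<alpha>"
    by (intro continuous_mult continuous_const isCont_o2[OF isCont_real_sqrt isCont_arcsin]) auto
  ultimately show ?thesis
    by (simp add: isCont_cong)
qed

lemma (in prob_space) arcsine_law_by_moments:
  fixes X :: "nat \<Rightarrow> 'a \<Rightarrow> real"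
  assumes [measurable]: "\<And>n. random_variable borel (X n)"
    and rng: "\<And>n \<omega>. \<omega> \<in> space M \<Longrightarrow> X n \<omega> \<in> {0..1}"
    and mom: "\<And>m. (\<lambda>n. expectation (\<lambda>\<omega>. X n \<omega> ^ m)) \<longlonglongrightarrow> arcsine_moment m"
    and \<alpha>: "\<alpha> \<in> {0<..<1}"
  shows "(\<lambda>n. prob {\<omega> \<in> space M. X n \<omega> \<le> \<alpha>}) \<longlonglongrightarrow> 2 / pi * arcsin (sqrt \<alpha>)"
proof -
  have "weak_conv_m (\<lambda>n. distr M borel (X n)) arcsine_law"
  proof (rule moments_imp_weak_conv)
    show "real_distribution arcsine_law" by (rule real_distribution_arcsine_law)
    show "AE x in arcsine_law. x \<in> {0..1}"
      unfolding arcsine_law_def by (subst AE_distr_iff) (auto simp: abs_square_le_1)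
    show "AE x in distr M borel (X n). x \<in> {0..1}" for n
      by (subst AE_distr_iff) (use rng in auto)
    show "(\<lambda>n. \<integral>x. x ^ m \<partial>distr M borel (X n)) \<longlonglongrightarrow> (\<integral>x. x ^ m \<partial>arcsine_law)" for m
      using mom[of m] by (simp add: integral_distr arcsine_law_moments)
  qed auto
  then have "(\<lambda>n. cdf (distr M borel (X n)) \<alpha>) \<longlonglongrightarrow> cdf arcsine_law \<alpha>"
    using \<alpha> isCont_cdf_arcsine_law by (auto simp: weak_conv_m_def weak_conv_def)
  moreover have "cdf (distr M borel (X n)) \<alpha> = prob {\<omega> \<in> space M. X n \<omega> \<le> \<alpha>}" for n
    by (simp add: cdf_def measure_distr vimage_def Int_def conj_commute)
  ultimately show ?thesis
    using \<alpha> by (simp add: cdf_arcsine_law)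
qed

lemma std_normal_singleton: "measure std_normal_distribution {x} = 0"
proof -
  have "AE y in lborel. y \<noteq> x" by (rule AE_lborel_singleton)
  then have "AE y in lborel. y \<in> {x} \<longrightarrow> ennreal (std_normal_density y) = 0"
    by eventually_elim simp
  then have "{x} \<in> null_sets std_normal_distribution"
    by (simp add: null_sets_density_iff)
  then show ?thesis by (simp add: measure_eq_0_null_sets)
qed

lemma isCont_cdf_std_normal: "isCont (cdf std_normal_distribution) x"
proof -
  interpret N: real_distribution std_normal_distribution by (rule real_dist_normal_dist)
  show ?thesis by (simp add: N.isCont_cdf std_normal_singleton)
qed

lemma cdf_std_normal_0: "cdf std_normal_distribution 0 = 1 / 2"
proof -
  interpret N: real_distribution std_normal_distribution by (rule real_dist_normal_dist)
  let ?d = "\<lambda>x. ennreal (std_normal_density x)"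
  have d: "?d \<in> borel_measurable lborel" by measurable
  have "emeasure std_normal_distribution {..0} = (\<integral>\<^sup>+x. ?d x * indicator {..0} x \<partial>lborel)"
    by (rule emeasure_density[OF d]) simp
  also have "\<dots> = (\<integral>\<^sup>+x. ?d (- x) * indicator {..0} (- x) \<partial>lborel)"
    using nn_integral_real_affine[of "\<lambda>x. ?d x * indicator {..0} x" "-1" 0] by simp
  also have "\<dots> = (\<integral>\<^sup>+x. ?d x * indicator {0..} x \<partial>lborel)"
    by (intro nn_integral_cong) (auto simp: normal_density_def split: split_indicator)
  also have "\<dots> = emeasure std_normal_distribution {0..}"
    by (rule emeasure_density[OF d, symmetric]) simp
  finally
  have "measure std_normal_distribution {..0} = measure std_normal_distribution {0..}"
    by (simp add: measure_def)
  moreover have "measure std_normal_distribution ({..0} \<union> {0<..}) = measure std_normal_distribution {..0} + measure std_normal_distribution {0<..}"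
    by (rule N.finite_measure_Union) auto
  moreover have "measure std_normal_distribution ({0} \<union> {0<..}) = measure std_normal_distribution {0} + measure std_normal_distribution {0<..}"
    by (rule N.finite_measure_Union) auto
  moreover have "{..0} \<union> {0<..} = (UNIV :: real set)" "{0} \<union> {0<..} = {0::real..}" by auto
  ultimately show "cdf std_normal_distribution 0 = 1 / 2"
    using N.prob_space std_normal_singleton[of 0] by (simp add: cdf_def)
qed

section \<open>Integer-valued random walks\<close>

lemma measurable_path_coordinate: "(\<lambda>\<omega>. \<omega> i) \<in> measurable (path_measure \<nu>) (measure_pmf \<nu>)"
  unfolding path_measure_def by (rule measurable_component_singleton) simp

lemma distr_path_coordinate: "distr (path_measure \<nu>) (measure_pmf \<nu>) (\<lambda>\<omega>. \<omega> i) = measure_pmf \<nu>"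
  unfolding path_measure_def
  by (rule distr_PiM_component) (auto intro: measure_pmf.prob_space_axioms)

lemma integral_path_coordinate:
  fixes g :: "'a \<Rightarrow> real"
  shows "(\<integral>\<omega>. g (\<omega> i) \<partial>path_measure \<nu>) = (\<integral>a. g a \<partial>\<nu>)"
    and "integrable (path_measure \<nu>) (\<lambda>\<omega>. g (\<omega> i)) \<longleftrightarrow> integrable \<nu> g"
proof -
  have m: "(\<lambda>\<omega>. \<omega> i) \<in> measurable (path_measure \<nu>) (measure_pmf \<nu>)"
    by (rule measurable_path_coordinate)
  show "(\<integral>\<omega>. g (\<omega> i) \<partial>path_measure \<nu>) = (\<integral>a. g a \<partial>\<nu>)"
    using integral_distr[OF m, of g] by (simp add: distr_path_coordinate)
  show "integrable (path_measure \<nu>) (\<lambda>\<omega>. g (\<omega> i)) \<longleftrightarrow> integrable \<nu> g"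
    using integrable_distr_eq[OF m, of g] by (simp add: distr_path_coordinate)
qed

locale integer_walk =
  fixes \<nu> :: "'a::countable pmf" and \<Psi> :: "'a \<Rightarrow> int"
  assumes square_integrable: "integrable \<nu> (\<lambda>a. (real_of_int (\<Psi> a))\<^sup>2)"
    and centered: "(\<integral>a. real_of_int (\<Psi> a) \<partial>\<nu>) = 0"
    and nondegenerate: "(\<integral>a. (real_of_int (\<Psi> a))\<^sup>2 \<partial>\<nu>) > 0"
begin

abbreviation \<Omega> :: "(nat \<Rightarrow> 'a) measure" where "\<Omega> \<equiv> path_measure \<nu>"

definition walk :: "nat \<Rightarrow> (nat \<Rightarrow> 'a) \<Rightarrow> int" where
  "walk n \<omega> = (\<Sum>i<n. \<Psi> (\<omega> i))"

lemma walk_0 [simp]: "walk 0 \<omega> = 0" and walk_Suc: "walk (Suc n) \<omega> = walk n \<omega> + \<Psi> (\<omega> n)"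
  by (simp_all add: walk_def)

sublocale coords: sequence_space "measure_pmf \<nu>" ..

sublocale prob_space \<Omega>
  unfolding path_measure_def by (rule prob_space_PiM) (rule measure_pmf.prob_space_axioms)

lemma space_path [simp]: "space \<Omega> = UNIV"
  by (simp add: path_measure_def space_PiM)

lemma measurable_coord [measurable]: "(\<lambda>\<omega>. \<omega> i) \<in> measurable \<Omega> (count_space UNIV)"
  using measurable_path_coordinate[of i \<nu>] by (simp cong: measurable_cong_sets)

lemma measurable_step [measurable]: "(\<lambda>\<omega>. \<Psi> (\<omega> i)) \<in> measurable \<Omega> (count_space UNIV)"
  by measurable

lemma measurable_walk [measurable]: "walk n \<in> measurable \<Omega> (count_space UNIV)"
proof (induction n)
  case 0
  show ?case by (simp add: walk_def)
next
  case (Suc n)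
  have "(\<lambda>\<omega>. (\<lambda>s \<omega>. s + \<Psi> (\<omega> n)) (walk n \<omega>) \<omega>) \<in> measurable \<Omega> (count_space UNIV)"
    by (rule measurable_compose_countable[OF _ Suc]) measurable
  then show ?case by (simp add: walk_Suc[abs_def])
qed

lemma events_Collect:
  assumes "h \<in> measurable \<Omega> (count_space UNIV)"
  shows "{\<omega>. Q (h \<omega>)} \<in> events"
  using measurable_sets[OF assms, of "Collect Q"] by (simp add: vimage_def)

lemma borel_measurable_walk [measurable]: "(\<lambda>\<omega>. g (walk n \<omega>)) \<in> borel_measurable \<Omega>" for g :: "int \<Rightarrow> real"
  by measurable

lemma measurable_steps [measurable]:
  "(\<lambda>\<omega>. map (\<lambda>i. \<Psi> (\<omega> i)) [0..<n]) \<in> measurable \<Omega> (count_space UNIV)"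
proof (induction n)
  case (Suc n)
  have "(\<lambda>\<omega>. (\<lambda>xs \<omega>. xs @ [\<Psi> (\<omega> n)]) (map (\<lambda>i. \<Psi> (\<omega> i)) [0..<n]) \<omega>) \<in> measurable \<Omega> (count_space UNIV)"
    by (rule measurable_compose_countable[OF _ Suc]) measurable
  then show ?case by simp
qed simp

lemmas distr_coord = distr_path_coordinate[where \<nu> = \<nu>]

lemmas integral_coord = integral_path_coordinate[where \<nu> = \<nu>]

lemma indep_coords: "indep_vars (\<lambda>_. measure_pmf \<nu>) (\<lambda>i \<omega>. \<omega> i) UNIV"
proof (subst indep_vars_iff_distr_eq_PiM)
  show "random_variable (measure_pmf \<nu>) (\<lambda>\<omega>. \<omega> i)" for i
    using measurable_coord by (simp cong: measurable_cong_sets)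
  show "distr \<Omega> (Pi\<^sub>M UNIV (\<lambda>_. measure_pmf \<nu>)) (\<lambda>x. \<lambda>i\<in>UNIV. x i) =
      Pi\<^sub>M UNIV (\<lambda>i. distr \<Omega> (measure_pmf \<nu>) (\<lambda>\<omega>. \<omega> i))"
    by (simp add: distr_coord restrict_UNIV) (simp add: path_measure_def distr_id2)
qed auto

lemma indep_steps: "indep_vars (\<lambda>_. borel) (\<lambda>i \<omega>. real_of_int (\<Psi> (\<omega> i))) UNIV"
  using indep_vars_compose2[OF indep_coords, of "\<lambda>_ a. real_of_int (\<Psi> a)" "\<lambda>_. borel"] by simp

text \<open>
  The bridge from paths to lists: the first \<open>n\<close> steps form a list of independent samples.
\<close>

lemma distr_steps:
  "distr \<Omega> (count_space UNIV) (\<lambda>\<omega>. map (\<lambda>i. \<Psi> (\<omega> i)) [0..<n]) =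
     measure_pmf (replicate_pmf n (map_pmf \<Psi> \<nu>))"
proof (induction n)
  case 0
  have "distr \<Omega> (count_space UNIV) (\<lambda>\<omega>. [] :: int list) = return (count_space UNIV) []"
    by (intro distr_const) (auto simp: prob_space_axioms)
  then show ?case by (simp add: return_pmf.rep_eq)
next
  case (Suc n)
  let ?l = "\<lambda>n \<omega>. map (\<lambda>i. \<Psi> (\<omega> i)) [0..<n]"
  have iter: "\<Omega> = distr (measure_pmf \<nu> \<Otimes>\<^sub>M \<Omega>) \<Omega> (\<lambda>(s, \<omega>). case_nat s \<omega>)"
    unfolding path_measure_def by (rule coords.PiM_iter[symmetric])
  have mcase: "(\<lambda>(s, \<omega>). case_nat s \<omega>) \<in> measurable (measure_pmf \<nu> \<Otimes>\<^sub>M \<Omega>) \<Omega>"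
    unfolding path_measure_def by (rule measurable_case_nat'[of "\<lambda>x. fst x" _ _ "\<lambda>x. snd x", simplified split_beta'[symmetric]]; measurable)
  show ?case
  proof (rule measure_eqI)
    fix A assume "A \<in> sets (distr \<Omega> (count_space UNIV) (?l (Suc n)))"
    have A: "?l (Suc n) -` A \<in> sets \<Omega>"
      using measurable_sets[OF measurable_steps[of "Suc n"], of A] by simp
    have cons: "?l (Suc n) (case_nat s \<omega>) = \<Psi> s # ?l n \<omega>" for s \<omega>
      by (simp add: upt_conv_Cons map_Suc_upt[symmetric] del: upt_Suc)
    have "emeasure (distr \<Omega> (count_space UNIV) (?l (Suc n))) A = emeasure \<Omega> (?l (Suc n) -` A)"
      by (subst emeasure_distr) auto
    also have "\<dots> = emeasure (measure_pmf \<nu> \<Otimes>\<^sub>M \<Omega>) ((\<lambda>(s, \<omega>). case_nat s \<omega>) -` (?l (Suc n) -` A) \<inter> space (measure_pmf \<nu> \<Otimes>\<^sub>M \<Omega>))"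
      by (subst iter, subst emeasure_distr[OF mcase A]) simp
    also have "\<dots> = (\<integral>\<^sup>+s. emeasure \<Omega> (Pair s -` ((\<lambda>(s, \<omega>). case_nat s \<omega>) -` (?l (Suc n) -` A) \<inter> space (measure_pmf \<nu> \<Otimes>\<^sub>M \<Omega>))) \<partial>\<nu>)"
      by (intro emeasure_pair_measure_alt measurable_sets[OF mcase A])
    also have "\<dots> = (\<integral>\<^sup>+s. emeasure (distr \<Omega> (count_space UNIV) (?l n)) {xs. \<Psi> s # xs \<in> A} \<partial>\<nu>)"
      by (intro nn_integral_cong, subst emeasure_distr) (auto simp: space_pair_measure cons simp del: upt_Suc intro!: arg_cong[where f = "emeasure _"])
    also have "\<dots> = emeasure (measure_pmf (replicate_pmf (Suc n) (map_pmf \<Psi> \<nu>))) A"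
      unfolding Suc replicate_pmf_Suc' by (simp add: vimage_def)
    finally show "emeasure (distr \<Omega> (count_space UNIV) (?l (Suc n))) A =
        emeasure (measure_pmf (replicate_pmf (Suc n) (map_pmf \<Psi> \<nu>))) A" .
  qed simp
qed

lemma prob_steps:
  "prob {\<omega>. Q (map (\<lambda>i. \<Psi> (\<omega> i)) [0..<n])} = measure_pmf.prob (replicate_pmf n (map_pmf \<Psi> \<nu>)) {xs. Q xs}"
  unfolding distr_steps[symmetric] by (subst measure_distr) (auto simp: vimage_def)

subsection \<open>The number of positive partial sums\<close>

text \<open>
  The times \<open>1, \<dots>, n\<close> are inspected; the initial value \<open>0\<close> is not counted.
\<close>

definition positives :: "nat \<Rightarrow> (nat \<Rightarrow> 'a) \<Rightarrow> nat" where
  "positives n \<omega> = (\<Sum>j<n. if walk (Suc j) \<omega> > 0 then 1 else 0)"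

lemma positives_le: "positives n \<omega> \<le> n"
proof -
  have "positives n \<omega> \<le> (\<Sum>j<n. 1)"
    unfolding positives_def by (intro sum_mono) auto
  then show ?thesis by simp
qed

lemma positives_npos: "positives n \<omega> = npos (rev (map (\<lambda>i. \<Psi> (\<omega> i)) [0..<n]))"
proof (induction n)
  case (Suc n)
  have "sum_list (rev (map (\<lambda>i. \<Psi> (\<omega> i)) [0..<n])) = walk n \<omega>"
    by (simp add: sum_list_rev walk_def interv_sum_list_conv_sum_set_nat atLeast0LessThan)
  then show ?case
    using Suc by (simp add: positives_def walk_Suc add.commute)
qed (simp add: positives_def)

lemma measurable_positives [measurable]: "positives n \<in> measurable \<Omega> (count_space UNIV)"
  unfolding positives_npos[abs_def] by (rule measurable_compose[OF measurable_steps]) simp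

definition positive_suffix_prob :: "nat \<Rightarrow> real" where
  "positive_suffix_prob n = measure_pmf.prob (replicate_pmf n (map_pmf \<Psi> \<nu>)) {xs. suffixes_pos xs}"

definition nonpositive_prefix_prob :: "nat \<Rightarrow> real" where
  "nonpositive_prefix_prob n = measure_pmf.prob (replicate_pmf n (map_pmf \<Psi> \<nu>)) {xs. prefixes_nonpos xs}"

lemma prob_positives:
  assumes "k \<le> n"
  shows "prob {\<omega>. positives n \<omega> = k} = positive_suffix_prob k * nonpositive_prefix_prob (n - k)"
proof -
  let ?R = "replicate_pmf n (map_pmf \<Psi> \<nu>)"
  have "prob {\<omega>. positives n \<omega> = k} = measure_pmf.prob ?R {xs. npos (rev xs) = k}"
    unfolding positives_npos by (rule prob_steps[of "\<lambda>xs. npos (rev xs) = k"])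
  also have "\<dots> = measure_pmf.prob (map_pmf rev ?R) {xs. npos xs = k}"
    by (simp add: vimage_def)
  also have "\<dots> = measure_pmf.prob ?R {xs. npos xs = k}"
    by (simp only: map_rev_replicate_pmf)
  finally show ?thesis
    unfolding positive_suffix_prob_def nonpositive_prefix_prob_def prob_npos_splits[OF assms] .
qed

lemma expectation_positives:
  fixes g :: "nat \<Rightarrow> real"
  shows "expectation (\<lambda>\<omega>. g (positives n \<omega>)) =
    (\<Sum>k\<le>n. g k * positive_suffix_prob k * nonpositive_prefix_prob (n - k))"
proof -
  have "expectation (\<lambda>\<omega>. g (positives n \<omega>)) =
      expectation (\<lambda>\<omega>. \<Sum>k\<le>n. g k * indicator {\<omega>. positives n \<omega> = k} \<omega>)"
  proof (intro Bochner_Integration.integral_cong refl)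
    fix \<omega>
    have "(\<Sum>k\<le>n. g k * indicator {\<omega>. positives n \<omega> = k} \<omega>) = (\<Sum>k\<le>n. if k = positives n \<omega> then g k else 0)"
      by (intro sum.cong) (auto simp: indicator_def)
    then show "g (positives n \<omega>) = (\<Sum>k\<le>n. g k * indicator {\<omega>. positives n \<omega> = k} \<omega>)"
      using positives_le[of n \<omega>] by simp
  qed
  also have "\<dots> = (\<Sum>k\<le>n. g k * prob {\<omega>. positives n \<omega> = k})"
    by (subst Bochner_Integration.integral_sum) (auto simp: emeasure_finite less_top[symmetric] intro!: integrable_mult_right integrable_real_indicator events_Collect[OF measurable_positives])
  also have "\<dots> = (\<Sum>k\<le>n. g k * positive_suffix_prob k * nonpositive_prefix_prob (n - k))"
    by (intro sum.cong) (auto simp: prob_positives)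
  finally show ?thesis .
qed

lemma expectation_positives_id: "expectation (\<lambda>\<omega>. real (positives n \<omega>)) = (\<Sum>k\<le>n. prob {\<omega>. walk k \<omega> > 0})"
proof -
  have "expectation (\<lambda>\<omega>. real (positives n \<omega>)) = expectation (\<lambda>\<omega>. \<Sum>j<n. indicator {\<omega>. walk (Suc j) \<omega> > 0} \<omega>)"
    unfolding positives_def of_nat_sum
    by (intro Bochner_Integration.integral_cong refl sum.cong) (simp add: indicator_def)
  also have "\<dots> = (\<Sum>j<n. prob {\<omega>. walk (Suc j) \<omega> > 0})"
    by (subst Bochner_Integration.integral_sum) (auto simp: emeasure_finite less_top[symmetric] intro!: integrable_real_indicator events_Collect[OF measurable_walk])
  also have "\<dots> = (\<Sum>k<Suc n. prob {\<omega>. walk k \<omega> > 0})"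
    by (subst sum.lessThan_Suc_shift) simp
  finally show ?thesis by (simp only: lessThan_Suc_atMost)
qed

subsection \<open>Moments of the walk\<close>

definition \<sigma> :: real where "\<sigma> = sqrt (\<integral>a. (real_of_int (\<Psi> a))\<^sup>2 \<partial>\<nu>)"

lemma \<sigma>_pos: "\<sigma> > 0" and \<sigma>_squared: "\<sigma>\<^sup>2 = (\<integral>a. (real_of_int (\<Psi> a))\<^sup>2 \<partial>\<nu>)"
  using nondegenerate by (auto simp: \<sigma>_def)

lemma integrable_step_pmf: "integrable \<nu> (\<lambda>a. real_of_int (\<Psi> a))"
  by (rule measure_pmf.square_integrable_imp_integrable) (use square_integrable in auto)

lemma integrable_step: "integrable \<Omega> (\<lambda>\<omega>. real_of_int (\<Psi> (\<omega> i)))"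
  "integrable \<Omega> (\<lambda>\<omega>. (real_of_int (\<Psi> (\<omega> i)))\<^sup>2)"
  using integral_coord(2)[of "\<lambda>a. real_of_int (\<Psi> a)"] integrable_step_pmf
    integral_coord(2)[of "\<lambda>a. (real_of_int (\<Psi> a))\<^sup>2"] square_integrable by simp_all

lemma indep_walk_step:
  "indep_var borel (\<lambda>\<omega>. real_of_int (\<Psi> (\<omega> n))) borel (\<lambda>\<omega>. real_of_int (walk n \<omega>))"
  using indep_vars_sum[of "{..<n}" n "\<lambda>i \<omega>. real_of_int (\<Psi> (\<omega> i))"] indep_vars_subset[OF indep_steps]
  by (simp add: walk_def)

lemma prob_walk_pos_tendsto: "(\<lambda>n. prob {\<omega>. walk n \<omega> > 0}) \<longlonglongrightarrow> 1 / 2"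
proof -
  let ?D = "\<lambda>n. distr \<Omega> borel (\<lambda>\<omega>. (\<Sum>i<n. real_of_int (\<Psi> (\<omega> i))) / sqrt (real n * \<sigma>\<^sup>2))"
  have "weak_conv_m (\<lambda>n. ?D n) std_normal_distribution"
  proof (rule central_limit_theorem_zero_mean[OF indep_steps])
    show "\<sigma> > 0" by (rule \<sigma>_pos)
    show z: "expectation (\<lambda>\<omega>. real_of_int (\<Psi> (\<omega> n))) = 0" for n
      using integral_coord(1)[of "\<lambda>a. real_of_int (\<Psi> a)"] centered by simp
    show "integrable \<Omega> (\<lambda>\<omega>. (real_of_int (\<Psi> (\<omega> n)))\<^sup>2)" for n
      by (rule integrable_step)
    show "variance (\<lambda>\<omega>. real_of_int (\<Psi> (\<omega> n))) = \<sigma>\<^sup>2" for n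
      using integral_coord(1)[of "\<lambda>a. (real_of_int (\<Psi> a))\<^sup>2"] by (simp add: z \<sigma>_squared)
    show "distr \<Omega> borel (\<lambda>\<omega>. real_of_int (\<Psi> (\<omega> n))) = distr (measure_pmf \<nu>) borel (\<lambda>a. real_of_int (\<Psi> a))" for n
    proof -
      have m: "(\<lambda>\<omega>. \<omega> n) \<in> measurable \<Omega> (measure_pmf \<nu>)"
        using measurable_coord by (simp cong: measurable_cong_sets)
      show ?thesis
        by (subst distr_coord[of n, symmetric], subst distr_distr[OF _ m]) (auto simp: comp_def)
    qed
  qed
  then have "(\<lambda>n. cdf (?D n) 0) \<longlonglongrightarrow> 1 / 2"
    using isCont_cdf_std_normal[of 0] by (auto simp: weak_conv_m_def weak_conv_def cdf_std_normal_0)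
  then have "(\<lambda>n. 1 - cdf (?D n) 0) \<longlonglongrightarrow> 1 - 1 / 2"
    by (intro tendsto_intros)
  moreover have "\<forall>\<^sub>F n in sequentially. 1 - cdf (?D n) 0 = prob {\<omega>. walk n \<omega> > 0}"
  proof (rule eventually_mono[OF eventually_gt_at_top[of 0]])
    fix n :: nat assume n: "n > 0"
    have "cdf (?D n) 0 = prob {\<omega>. walk n \<omega> \<le> 0}"
    proof -
      have "(\<Sum>i<n. real_of_int (\<Psi> (\<omega> i))) / sqrt (n * \<sigma>\<^sup>2) \<le> 0 \<longleftrightarrow> walk n \<omega> \<le> 0" for \<omega>
      proof -
        have "sqrt (n * \<sigma>\<^sup>2) > 0" using n \<sigma>_pos by simp
        then have "(\<Sum>i<n. real_of_int (\<Psi> (\<omega> i))) / sqrt (n * \<sigma>\<^sup>2) \<le> 0 \<longleftrightarrow> real_of_int (walk n \<omega>) \<le> 0"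
          by (simp only: divide_le_0_iff walk_def of_int_sum) linarith
        then show ?thesis by simp
      qed
      then show ?thesis
        unfolding cdf_def by (subst measure_distr) (auto simp: vimage_def)
    qed
    moreover have "prob {\<omega>. walk n \<omega> > 0} = 1 - prob {\<omega>. walk n \<omega> \<le> 0}"
    proof -
      have "{\<omega>. walk n \<omega> > 0} = space \<Omega> - {\<omega>. walk n \<omega> \<le> 0}" by auto
      then show ?thesis by (simp only:) (subst prob_compl, auto intro: events_Collect[OF measurable_walk])
    qed
    ultimately show "1 - cdf (?D n) 0 = prob {\<omega>. walk n \<omega> > 0}"
      by simp
  qed
  ultimately show ?thesis
    by (simp add: Lim_transform_eventually)
qed

text \<open>
  The hypothesis on the mean in \<open>splitting_moments_asymp\<close> holds by linearity of the expectation, with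
  \<open>p\<^sub>k = P(S\<^sub>k > 0)\<close>; the central limit theorem supplies \<open>p\<^sub>k \<rightarrow> 1/2\<close>.
\<close>

lemma positives_moments:
  "(\<lambda>n. expectation (\<lambda>\<omega>. (real (positives n \<omega>) / real n) ^ m)) \<longlonglongrightarrow> arcsine_moment m"
proof -
  have "(\<lambda>n. (\<Sum>k\<le>n. real k ^ m * positive_suffix_prob k * nonpositive_prefix_prob (n - k)) / real n ^ m)
      \<longlonglongrightarrow> arcsine_moment m"
  proof (rule splitting_moments_asymp)
    show "(\<Sum>k\<le>n. positive_suffix_prob k * nonpositive_prefix_prob (n - k)) = 1" for n
      using expectation_positives[of "\<lambda>_. 1" n] prob_space by simp
    show "(\<Sum>k\<le>n. real k * positive_suffix_prob k * nonpositive_prefix_prob (n - k)) =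
        (\<Sum>k\<le>n. prob {\<omega>. walk k \<omega> > 0})" for n
      using expectation_positives[of real n] by (simp add: expectation_positives_id)
    show "(\<lambda>n. prob {\<omega>. walk n \<omega> > 0}) \<longlonglongrightarrow> 1 / 2"
      by (rule prob_walk_pos_tendsto)
  qed
  moreover have "expectation (\<lambda>\<omega>. (real (positives n \<omega>) / real n) ^ m) =
      (\<Sum>k\<le>n. real k ^ m * positive_suffix_prob k * nonpositive_prefix_prob (n - k)) / real n ^ m" for n
    using expectation_positives[of "\<lambda>k. (real k / real n) ^ m" n]
    by (simp add: power_divide sum_divide_distrib)
  ultimately show ?thesis by simp
qed

end

section \<open>Frequencies along a sequence\<close>

definition freq :: "(nat \<Rightarrow> bool) \<Rightarrow> nat \<Rightarrow> real" where
  "freq P n = (\<Sum>j<n. of_bool (P j)) / real n"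

lemma freq_nonneg: "freq P n \<ge> 0"
  by (auto simp: freq_def intro!: divide_nonneg_nonneg sum_nonneg)

lemma freq_le_1: "freq P n \<le> 1"
proof -
  have "(\<Sum>j<n. of_bool (P j) :: real) \<le> (\<Sum>j<n. 1)" by (rule sum_mono) auto
  then show ?thesis by (cases "n = 0") (auto simp: freq_def divide_le_eq)
qed

lemma freq_diff_le: "\<bar>freq P n - freq Q n\<bar> \<le> freq (\<lambda>j. P j \<noteq> Q j) n"
proof -
  have "\<bar>(\<Sum>j<n. of_bool (P j)) - (\<Sum>j<n. of_bool (Q j))\<bar> \<le> (\<Sum>j<n. \<bar>of_bool (P j) - of_bool (Q j) :: real\<bar>)"
    unfolding sum_subtractf[symmetric] by (rule sum_abs)
  also have "\<dots> = (\<Sum>j<n. of_bool (P j \<noteq> Q j))"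
    by (intro sum.cong) auto
  finally have "\<bar>(\<Sum>j<n. of_bool (P j)) - (\<Sum>j<n. of_bool (Q j)) :: real\<bar> / real n \<le> (\<Sum>j<n. of_bool (P j \<noteq> Q j)) / real n"
    by (rule divide_right_mono) simp
  then show ?thesis
    by (simp add: freq_def diff_divide_distrib[symmetric])
qed

lemma freq_mono: "(\<And>j. P j \<Longrightarrow> Q j) \<Longrightarrow> freq P n \<le> freq Q n"
  unfolding freq_def by (intro divide_right_mono sum_mono) auto

lemma freq_add_le:
  assumes "\<And>j. \<not> (P j \<and> Q j)"
  shows "freq P n + freq Q n \<le> 1"
proof -
  have "freq P n + freq Q n = freq (\<lambda>j. P j \<or> Q j) n"
    unfolding freq_def add_divide_distrib[symmetric] sum.distrib[symmetric]
    using assms by (intro arg_cong2[where f = "(/)"] sum.cong refl) auto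
  then show ?thesis by (simp add: freq_le_1)
qed

lemma freq_Suc_diff: "\<bar>freq P (Suc n) - freq P n\<bar> \<le> 1 / real (Suc n)"
proof (cases "n = 0")
  case True
  then show ?thesis by (simp add: freq_def)
next
  case False
  have "freq P (Suc n) * real (Suc n) = freq P n * real n + of_bool (P n)"
    using False by (simp add: freq_def)
  then have "(freq P (Suc n) - freq P n) * real (Suc n) = of_bool (P n) - freq P n"
    by (simp add: algebra_simps)
  moreover have "\<bar>of_bool (P n) - freq P n\<bar> \<le> 1"
    using freq_nonneg[of P n] freq_le_1[of P n] by auto
  ultimately have "\<bar>freq P (Suc n) - freq P n\<bar> * real (Suc n) \<le> 1"
    by (metis abs_mult abs_of_nat)
  then show ?thesis by (simp add: le_divide_eq)
qed

lemma freq_scale: "n \<le> m \<Longrightarrow> real n * freq P n \<le> real m * freq P m"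
  by (auto simp: freq_def simp del: sum_of_bool_eq intro!: sum_mono2 sum_nonneg)

lemma freq_shift: "\<bar>freq (\<lambda>j. P (Suc j)) n - freq P n\<bar> \<le> 1 / real n"
proof -
  have "(\<Sum>j<n. of_bool (P (Suc j))) - (\<Sum>j<n. of_bool (P j)) = of_bool (P n) - (of_bool (P 0) :: real)"
    by (induction n) (auto simp del: sum_of_bool_eq)
  then have "\<bar>(\<Sum>j<n. of_bool (P (Suc j))) - (\<Sum>j<n. of_bool (P j))\<bar> \<le> (1 :: real)"
    by simp
  then have "\<bar>(\<Sum>j<n. of_bool (P (Suc j))) - (\<Sum>j<n. of_bool (P j)) :: real\<bar> / real n \<le> 1 / real n"
    by (rule divide_right_mono) simp
  then show ?thesis
    by (simp only: freq_def diff_divide_distrib[symmetric] abs_divide abs_of_nat)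
qed

text \<open>
  The count \<open>n \<cdot> freq P n\<close> is nondecreasing in \<open>n\<close>, so between consecutive powers of two the frequency
  is at most twice its value at the larger one.
\<close>

lemma freq_null_of_dyadic:
  assumes "(\<lambda>k. freq P (2 ^ k)) \<longlonglongrightarrow> 0"
  shows "freq P \<longlonglongrightarrow> 0"
proof (rule LIMSEQ_I)
  fix e :: real assume "e > 0"
  then obtain k0 where k0: "\<And>k. k \<ge> k0 \<Longrightarrow> freq P (2 ^ k) < e / 2"
    using order_tendstoD(2)[OF assms, of "e / 2"] by (auto simp: eventually_sequentially)
  have "freq P n < e" if n: "n \<ge> 2 ^ k0" for n
  proof -
    have "n \<ge> 1" using n le_trans[of 1 "2 ^ k0" n] by simp
    then obtain k where k: "2 ^ k \<le> n" "n < 2 ^ (k + 1)"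
      using ex_power_ivl1[of 2 n] by auto
    have "(2 :: nat) ^ k0 < 2 ^ (k + 1)" using n k(2) by linarith
    then have "k0 \<le> k + 1" by (metis less_imp_le nat_power_less_imp_less zero_less_numeral)
    have "real n * freq P n \<le> real (2 ^ (k + 1)) * freq P (2 ^ (k + 1))"
      using k(2) by (intro freq_scale) simp
    also have "\<dots> \<le> real n * (2 * freq P (2 ^ (k + 1)))"
    proof -
      have "(2 ^ (k + 1) :: nat) \<le> n * 2" using k(1) by simp
      then have "real (2 ^ (k + 1)) \<le> real n * 2" by (metis of_nat_le_iff of_nat_mult of_nat_numeral)
      then have "real (2 ^ (k + 1)) * freq P (2 ^ (k + 1)) \<le> real n * 2 * freq P (2 ^ (k + 1))"
        by (rule mult_right_mono) (rule freq_nonneg)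
      then show ?thesis by (simp only: mult.assoc)
    qed
    finally have "freq P n \<le> 2 * freq P (2 ^ (k + 1))"
      using \<open>n \<ge> 1\<close> by simp
    then show ?thesis using k0[OF \<open>k0 \<le> k + 1\<close>] by linarith
  qed
  then show "\<exists>no. \<forall>n\<ge>no. norm (freq P n - 0) < e"
    using freq_nonneg[of P] by (intro exI[of _ "2 ^ k0"]) simp
qed

text \<open>
  For a bounded sequence \<open>u\<close> this means \<open>limsup u \<ge> \<rho>\<close>.
\<close>

definition nearly_often :: "(nat \<Rightarrow> real) \<Rightarrow> real \<Rightarrow> bool" where
  "nearly_often u \<rho> \<longleftrightarrow> (\<forall>e>0. \<exists>\<^sub>F n in sequentially. u n > \<rho> - e)"

lemma nearly_often_iff_nat:
  "nearly_often u \<rho> \<longleftrightarrow> (\<forall>i::nat. \<forall>N. \<exists>n\<ge>N. u n > \<rho> - 1 / (real i + 1))"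
proof
  assume "nearly_often u \<rho>"
  then show "\<forall>i::nat. \<forall>N. \<exists>n\<ge>N. u n > \<rho> - 1 / (real i + 1)"
    by (auto simp: nearly_often_def frequently_sequentially)
next
  assume *: "\<forall>i::nat. \<forall>N. \<exists>n\<ge>N. u n > \<rho> - 1 / (real i + 1)"
  show "nearly_often u \<rho>"
    unfolding nearly_often_def frequently_sequentially
  proof (intro allI impI)
    fix e :: real and N assume "e > 0"
    then obtain i :: nat where "1 / (real i + 1) < e"
      using nat_approx_posE[of e] by (auto simp: add.commute)
    moreover obtain n where "n \<ge> N" "u n > \<rho> - 1 / (real i + 1)" using * by blast
    ultimately show "\<exists>n\<ge>N. \<rho> - e < u n" by (intro exI[of _ n]) auto
  qed
qed

lemma nearly_often_perturb:
  assumes "nearly_often u \<rho>" and "(\<lambda>n. u n - v n) \<longlonglongrightarrow> 0"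
  shows "nearly_often v \<rho>"
  unfolding nearly_often_def
proof (intro allI impI)
  fix e :: real assume e: "e > 0"
  have "\<exists>\<^sub>F n in sequentially. u n > \<rho> - e / 2"
    using assms(1) e by (simp add: nearly_often_def)
  moreover have "\<forall>\<^sub>F n in sequentially. u n - v n < e / 2"
    using order_tendstoD(2)[OF assms(2), of "e / 2"] e by simp
  ultimately show "\<exists>\<^sub>F n in sequentially. v n > \<rho> - e"
    by (rule frequently_rev_mp[OF _ eventually_mono]) auto
qed

text \<open>
  The properties of a single path of the walk that determine the limit measures.
\<close>

definition oscillating :: "(nat \<Rightarrow> int) \<Rightarrow> bool" where
  "oscillating s \<longleftrightarrow> (\<forall>K. freq (\<lambda>j. \<bar>s j\<bar> \<le> K) \<longlonglongrightarrow> 0) \<and>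
     nearly_often (freq (\<lambda>j. s j > 0)) 1 \<and> nearly_often (freq (\<lambda>j. s j < 0)) 1"

text \<open>
  The frequency comes close to \<open>0\<close> and to \<open>1\<close> at arbitrarily late times and changes by at most
  \<open>1/(n+1)\<close> at time \<open>n\<close>, so it cannot jump over \<open>l\<close>.
\<close>

lemma oscillating_frequently_near:
  assumes s: "oscillating s" and l: "0 \<le> l" "l \<le> 1" and e: "e > 0"
  shows "\<exists>\<^sub>F n in sequentially. \<bar>freq (\<lambda>j. s j > 0) n - l\<bar> < e"
  unfolding frequently_sequentially
proof
  fix N0
  let ?V = "freq (\<lambda>j. s j > 0)"
  obtain N1 :: nat where N1: "1 / real (Suc N1) < e"
    using nat_approx_posE[OF e] by auto
  define N where "N = max N0 (Suc N1)"
  have up: "\<exists>n\<ge>k. ?V n > l - e" for k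
  proof -
    have "\<exists>\<^sub>F n in sequentially. ?V n > 1 - e"
      using s e by (simp add: oscillating_def nearly_often_def)
    then obtain n where "n \<ge> k" "?V n > 1 - e" by (auto simp: frequently_sequentially)
    then show ?thesis using l by (intro exI[of _ n]) auto
  qed
  obtain a where a: "a \<ge> N" "?V a < l + e"
  proof -
    have "\<exists>\<^sub>F n in sequentially. freq (\<lambda>j. s j < 0) n > 1 - e"
      using s e by (simp add: oscillating_def nearly_often_def)
    then obtain n where n: "n \<ge> N" "freq (\<lambda>j. s j < 0) n > 1 - e" by (auto simp: frequently_sequentially)
    moreover have "?V n + freq (\<lambda>j. s j < 0) n \<le> 1" by (rule freq_add_le) auto
    ultimately show thesis using l by (intro that[of n]) auto
  qed
  define n where "n = (LEAST n. n \<ge> a \<and> ?V n > l - e)"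
  have n: "n \<ge> a \<and> ?V n > l - e"
    unfolding n_def by (rule LeastI_ex) (use up[of a] in blast)
  have "?V n < l + e"
  proof (cases "n = a")
    case False
    then obtain k where k: "n = Suc k" "k \<ge> a" using n by (cases n) auto
    have "\<not> (k \<ge> a \<and> ?V k > l - e)"
      using not_less_Least[of k "\<lambda>n. n \<ge> a \<and> ?V n > l - e"] k unfolding n_def[symmetric] by auto
    then have "?V k \<le> l - e" using k by auto
    moreover have "\<bar>?V n - ?V k\<bar> \<le> 1 / real n"
      using freq_Suc_diff[of _ k] by (simp add: k)
    moreover have "1 / real n \<le> 1 / real (Suc N1)"
      using a n by (intro divide_left_mono) (auto simp: N_def)
    ultimately show ?thesis using N1 e by linarith
  qed (use a in simp)
  then show "\<exists>n\<ge>N0. \<bar>?V n - l\<bar> < e"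
    using n a by (intro exI[of _ n]) (auto simp: N_def abs_less_iff)
qed

section \<open>Occupation times\<close>

context integer_walk
begin

lemma shows integrable_walk: "integrable \<Omega> (\<lambda>\<omega>. real_of_int (walk n \<omega>))"
    and integrable_walk_squared: "integrable \<Omega> (\<lambda>\<omega>. (real_of_int (walk n \<omega>))\<^sup>2)"
    and expectation_walk_squared: "expectation (\<lambda>\<omega>. (real_of_int (walk n \<omega>))\<^sup>2) = real n * \<sigma>\<^sup>2"
proof -
  show int: "integrable \<Omega> (\<lambda>\<omega>. real_of_int (walk n \<omega>))" for n
    unfolding walk_def of_int_sum by (intro Bochner_Integration.integrable_sum integrable_step)
  have "integrable \<Omega> (\<lambda>\<omega>. (real_of_int (walk n \<omega>))\<^sup>2) \<and>
    expectation (\<lambda>\<omega>. (real_of_int (walk n \<omega>))\<^sup>2) = real n * \<sigma>\<^sup>2"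
  proof (induction n)
    case (Suc n)
    let ?w = "\<lambda>\<omega>. real_of_int (walk n \<omega>)" and ?x = "\<lambda>\<omega>. real_of_int (\<Psi> (\<omega> n))"
    have cross: "integrable \<Omega> (\<lambda>\<omega>. ?x \<omega> * ?w \<omega>)" "expectation (\<lambda>\<omega>. ?x \<omega> * ?w \<omega>) = 0"
      using indep_var_integrable[OF indep_walk_step integrable_step(1) int]
        indep_var_lebesgue_integral[OF indep_walk_step integrable_step(1) int]
        integral_coord(1)[of "\<lambda>a. real_of_int (\<Psi> a)"] centered by auto
    have "(\<lambda>\<omega>. (real_of_int (walk (Suc n) \<omega>))\<^sup>2) = (\<lambda>\<omega>. (?w \<omega>)\<^sup>2 + 2 * (?x \<omega> * ?w \<omega>) + (?x \<omega>)\<^sup>2)"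
      by (simp add: walk_Suc power2_sum fun_eq_iff)
    moreover have "expectation (\<lambda>\<omega>. (?x \<omega>)\<^sup>2) = \<sigma>\<^sup>2"
      using integral_coord(1)[of "\<lambda>a. (real_of_int (\<Psi> a))\<^sup>2"] by (simp add: \<sigma>_squared)
    ultimately show ?case
      using Suc cross integrable_step(2) by (auto simp: algebra_simps)
  qed simp
  then show "integrable \<Omega> (\<lambda>\<omega>. (real_of_int (walk n \<omega>))\<^sup>2)"
    "expectation (\<lambda>\<omega>. (real_of_int (walk n \<omega>))\<^sup>2) = real n * \<sigma>\<^sup>2" by auto
qed

lemma expectation_abs_walk: "expectation (\<lambda>\<omega>. \<bar>real_of_int (walk n \<omega>)\<bar>) \<le> \<sigma> * sqrt (real n)"
proof (cases "n = 0")
  case False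
  define t where "t = \<sigma> * sqrt (real n)"
  have t: "t > 0" "t\<^sup>2 = real n * \<sigma>\<^sup>2"
    using False \<sigma>_pos by (auto simp: t_def power_mult_distrib)
  \<comment> \<open>this value of \<open>t\<close> optimizes the bound \<open>\<bar>w\<bar> \<le> (w\<^sup>2 / t + t) / 2\<close>\<close>
  have "expectation (\<lambda>\<omega>. \<bar>real_of_int (walk n \<omega>)\<bar>) \<le> expectation (\<lambda>\<omega>. ((real_of_int (walk n \<omega>))\<^sup>2 / t + t) / 2)"
  proof (rule integral_mono)
    fix \<omega>
    have "0 \<le> (\<bar>real_of_int (walk n \<omega>)\<bar> - t)\<^sup>2" by simp
    then show "\<bar>real_of_int (walk n \<omega>)\<bar> \<le> ((real_of_int (walk n \<omega>))\<^sup>2 / t + t) / 2"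
      using t(1) by (simp add: field_simps power2_eq_square)
  qed (use integrable_walk integrable_walk_squared in auto)
  also have "\<dots> = (t\<^sup>2 / t + t) / 2"
    using integrable_walk_squared[of n] by (simp add: expectation_walk_squared prob_space[simplified] t(2))
  also have "\<dots> = t" using t(1) by (simp add: power2_eq_square)
  finally show ?thesis by (simp add: t_def)
qed simp

definition mean_abs_step :: real where "mean_abs_step = (\<integral>a. \<bar>real_of_int (\<Psi> a)\<bar> \<partial>\<nu>)"

lemma mean_abs_step_pos: "mean_abs_step > 0"
proof (rule ccontr)
  assume "\<not> mean_abs_step > 0"
  then have "mean_abs_step = 0"
    unfolding mean_abs_step_def by (simp add: integral_nonneg_AE antisym not_less)
  then have "AE a in \<nu>. \<bar>real_of_int (\<Psi> a)\<bar> = 0"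
    unfolding mean_abs_step_def
    by (subst (asm) integral_nonneg_eq_0_iff_AE) (use integrable_step_pmf in auto)
  then have "(\<integral>a. (real_of_int (\<Psi> a))\<^sup>2 \<partial>\<nu>) = (\<integral>a. 0 \<partial>\<nu>)"
    by (intro integral_cong_AE) auto
  with nondegenerate show False by simp
qed

text \<open>
  By convexity \<open>\<bar>s + x - y\<bar> \<ge> \<bar>s - y\<bar> + sgn (s - y) x\<close>, with an additional \<open>\<bar>x\<bar>\<close> on the right if
  \<open>s = y\<close>. For the walk \<open>s\<close> and the next step \<open>x\<close>, the term with the sign has mean zero
  since \<open>x\<close> is centered and independent of \<open>s\<close>.
\<close>

lemma expectation_abs_walk_Suc:
  "expectation (\<lambda>\<omega>. \<bar>real_of_int (walk n \<omega> - y)\<bar>) + prob {\<omega>. walk n \<omega> = y} * mean_abs_step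
     \<le> expectation (\<lambda>\<omega>. \<bar>real_of_int (walk (Suc n) \<omega> - y)\<bar>)"
proof -
  let ?x = "\<lambda>\<omega>. real_of_int (\<Psi> (\<omega> n))"
  let ?s = "\<lambda>\<omega>. sgn (real_of_int (walk n \<omega>) - real_of_int y)"
  let ?i = "\<lambda>\<omega>. of_bool (walk n \<omega> = y) :: real"
  have int: "integrable \<Omega> (\<lambda>\<omega>. \<bar>real_of_int (walk n \<omega> - y)\<bar>)" for n
    using integrable_walk[of n] by simp
  have s: "integrable \<Omega> ?s"
    by (rule integrable_const_bound[where B = 1]) (auto simp: sgn_if)
  have i: "integrable \<Omega> ?i"
    by (rule integrable_const_bound[where B = 1]) auto
  have ax: "integrable \<Omega> (\<lambda>\<omega>. \<bar>?x \<omega>\<bar>)"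
    using integrable_step(1)[of n] by auto
  have ind1: "indep_var borel ?x borel ?s"
    using indep_var_compose[OF indep_walk_step, of "\<lambda>x. x" borel "\<lambda>w. sgn (w - real_of_int y)" borel n]
    by (simp add: comp_def)
  have ind2: "indep_var borel (\<lambda>\<omega>. \<bar>?x \<omega>\<bar>) borel ?i"
    using indep_var_compose[OF indep_walk_step, of abs borel "\<lambda>w. indicator {real_of_int y} w" borel n]
    by (simp add: comp_def indicator_def of_bool_def)
  have sx: "integrable \<Omega> (\<lambda>\<omega>. ?x \<omega> * ?s \<omega>)" "expectation (\<lambda>\<omega>. ?x \<omega> * ?s \<omega>) = 0"
    using indep_var_integrable[OF ind1 integrable_step(1) s]
      indep_var_lebesgue_integral[OF ind1 integrable_step(1) s]
      integral_coord(1)[of "\<lambda>a. real_of_int (\<Psi> a)"] centered by auto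
  have ix: "integrable \<Omega> (\<lambda>\<omega>. \<bar>?x \<omega>\<bar> * ?i \<omega>)"
    "expectation (\<lambda>\<omega>. \<bar>?x \<omega>\<bar> * ?i \<omega>) = mean_abs_step * prob {\<omega>. walk n \<omega> = y}"
  proof -
    show "integrable \<Omega> (\<lambda>\<omega>. \<bar>?x \<omega>\<bar> * ?i \<omega>)"
      by (rule indep_var_integrable[OF ind2 ax i])
    have "expectation ?i = expectation (indicator {\<omega>. walk n \<omega> = y})"
      by (intro Bochner_Integration.integral_cong) (auto simp: indicator_def)
    also have "\<dots> = prob {\<omega>. walk n \<omega> = y}"
      by simp
    finally show "expectation (\<lambda>\<omega>. \<bar>?x \<omega>\<bar> * ?i \<omega>) = mean_abs_step * prob {\<omega>. walk n \<omega> = y}"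
      using indep_var_lebesgue_integral[OF ind2 ax i] integral_coord(1)[of "\<lambda>a. \<bar>real_of_int (\<Psi> a)\<bar>"]
      by (simp add: mean_abs_step_def)
  qed
  have "expectation (\<lambda>\<omega>. \<bar>real_of_int (walk n \<omega> - y)\<bar>) + prob {\<omega>. walk n \<omega> = y} * mean_abs_step =
      expectation (\<lambda>\<omega>. \<bar>real_of_int (walk n \<omega> - y)\<bar> + ?x \<omega> * ?s \<omega> + \<bar>?x \<omega>\<bar> * ?i \<omega>)"
    using int[of n] sx ix by simp
  also have "\<dots> \<le> expectation (\<lambda>\<omega>. \<bar>real_of_int (walk (Suc n) \<omega> - y)\<bar>)"
  proof (rule integral_mono)
    show "integrable \<Omega> (\<lambda>\<omega>. \<bar>real_of_int (walk n \<omega> - y)\<bar> + ?x \<omega> * ?s \<omega> + \<bar>?x \<omega>\<bar> * ?i \<omega>)"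
      using int[of n] sx ix by simp
    show "\<bar>real_of_int (walk n \<omega> - y)\<bar> + ?x \<omega> * ?s \<omega> + \<bar>?x \<omega>\<bar> * ?i \<omega>
        \<le> \<bar>real_of_int (walk (Suc n) \<omega> - y)\<bar>" for \<omega>
      by (cases "walk n \<omega>" y rule: linorder_cases) (auto simp: walk_Suc)
  qed (rule int)
  finally show ?thesis .
qed

text \<open>
  Each visit to \<open>y\<close> raises the expectation of \<open>\<bar>S\<^sub>n - y\<bar>\<close> by at least \<open>E \<bar>X\<bar>\<close>, but that expectation cannot grow faster
  than \<open>E \<bar>S\<^sub>n\<bar> \<le> \<sigma> \<surd>n\<close>. This replaces the local limit theorem.
\<close>

lemma expected_visits: "(\<Sum>j<n. prob {\<omega>. walk j \<omega> = y}) \<le> \<sigma> / mean_abs_step * sqrt (real n)"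
proof -
  let ?e = "\<lambda>n. expectation (\<lambda>\<omega>. \<bar>real_of_int (walk n \<omega> - y)\<bar>)"
  have "(\<Sum>j<n. prob {\<omega>. walk j \<omega> = y} * mean_abs_step) \<le> (\<Sum>j<n. ?e (Suc j) - ?e j)"
    using expectation_abs_walk_Suc[of _ y] by (intro sum_mono) (simp add: le_diff_eq add.commute)
  also have "\<dots> = ?e n - ?e 0" by (rule sum_lessThan_telescope)
  also have "?e 0 = \<bar>real_of_int y\<bar>" using prob_space by simp
  also have "?e n \<le> expectation (\<lambda>\<omega>. \<bar>real_of_int (walk n \<omega>)\<bar> + \<bar>real_of_int y\<bar>)"
    using integrable_walk[of n] by (intro integral_mono) auto
  also have "\<dots> = expectation (\<lambda>\<omega>. \<bar>real_of_int (walk n \<omega>)\<bar>) + \<bar>real_of_int y\<bar>"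
    using integrable_walk[of n] prob_space by simp
  finally have "(\<Sum>j<n. prob {\<omega>. walk j \<omega> = y}) * mean_abs_step \<le> \<sigma> * sqrt (real n)"
    using expectation_abs_walk[of n] by (simp add: sum_distrib_right)
  then show ?thesis
    using mean_abs_step_pos by (simp add: field_simps)
qed

lemma measurable_freq [measurable]: "(\<lambda>\<omega>. freq (\<lambda>j. Q (walk j \<omega>)) n) \<in> borel_measurable \<Omega>"
  unfolding freq_def by measurable

lemma integrable_freq: "integrable \<Omega> (\<lambda>\<omega>. freq (\<lambda>j. Q (walk j \<omega>)) n)"
  by (rule integrable_const_bound[where B = 1]) (auto simp: freq_nonneg freq_le_1)

lemma expected_freq_bounded:
  obtains C where "C > 0" "\<And>n. expectation (\<lambda>\<omega>. freq (\<lambda>j. \<bar>walk j \<omega>\<bar> \<le> K) n) \<le> C / sqrt (real n)"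
proof
  let ?Y = "{-K..K}"
  define C where "C = (card ?Y + 1) * (\<sigma> / mean_abs_step)"
  show "C > 0" using \<sigma>_pos mean_abs_step_pos by (auto simp: C_def intro!: mult_pos_pos)
  fix n
  have "expectation (\<lambda>\<omega>. freq (\<lambda>j. \<bar>walk j \<omega>\<bar> \<le> K) n) =
      (\<Sum>j<n. prob {\<omega>. \<bar>walk j \<omega>\<bar> \<le> K}) / real n"
  proof -
    have "expectation (\<lambda>\<omega>. of_bool (\<bar>walk j \<omega>\<bar> \<le> K) :: real) = prob {\<omega>. \<bar>walk j \<omega>\<bar> \<le> K}" for j
    proof -
      have "expectation (\<lambda>\<omega>. of_bool (\<bar>walk j \<omega>\<bar> \<le> K) :: real) = expectation (indicator {\<omega>. \<bar>walk j \<omega>\<bar> \<le> K})"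
        by (intro Bochner_Integration.integral_cong) (auto simp: indicator_def)
      then show ?thesis by simp
    qed
    moreover have "integrable \<Omega> (\<lambda>\<omega>. of_bool (\<bar>walk j \<omega>\<bar> \<le> K) :: real)" for j
      by (rule integrable_const_bound[where B = 1]) auto
    ultimately show ?thesis
      unfolding freq_def integral_divide_zero by (subst Bochner_Integration.integral_sum) auto
  qed
  also have "(\<Sum>j<n. prob {\<omega>. \<bar>walk j \<omega>\<bar> \<le> K}) \<le> (\<Sum>j<n. \<Sum>y\<in>?Y. prob {\<omega>. walk j \<omega> = y})"
  proof (rule sum_mono)
    fix j
    have "{\<omega>. \<bar>walk j \<omega>\<bar> \<le> K} = (\<Union>y\<in>?Y. {\<omega>. walk j \<omega> = y})" by auto
    then show "prob {\<omega>. \<bar>walk j \<omega>\<bar> \<le> K} \<le> (\<Sum>y\<in>?Y. prob {\<omega>. walk j \<omega> = y})"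
      by (simp only:) (rule finite_measure_subadditive_finite, auto intro: events_Collect[OF measurable_walk])
  qed
  also have "\<dots> = (\<Sum>y\<in>?Y. \<Sum>j<n. prob {\<omega>. walk j \<omega> = y})" by (rule sum.swap)
  also have "\<dots> \<le> (\<Sum>y\<in>?Y. \<sigma> / mean_abs_step * sqrt (real n))"
    by (intro sum_mono expected_visits)
  also have "\<dots> \<le> C * sqrt (real n)"
    using \<sigma>_pos mean_abs_step_pos by (auto simp: C_def intro!: mult_right_mono divide_right_mono)
  finally have "expectation (\<lambda>\<omega>. freq (\<lambda>j. \<bar>walk j \<omega>\<bar> \<le> K) n) \<le> C * (sqrt (real n) / real n)"
    by (simp add: divide_right_mono)
  also have "sqrt (real n) / real n = 1 / sqrt (real n)"
    by (cases "n = 0") (auto simp: divide_simps)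
  finally show "expectation (\<lambda>\<omega>. freq (\<lambda>j. \<bar>walk j \<omega>\<bar> \<le> K) n) \<le> C / sqrt (real n)"
    by simp
qed

text \<open>
  The time above \<open>c\<close> differs from the number of positive sums only by visits to \<open>[-\<bar>c\<bar>, \<bar>c\<bar>]\<close> and by the
  last time. After division by \<open>n\<close> the difference tends to zero in mean, so the moments have the same
  limits.
\<close>

theorem arcsine_above:
  assumes "\<alpha> \<in> {0<..<1}"
  shows "(\<lambda>n. prob {\<omega>. freq (\<lambda>j. walk j \<omega> > c) n \<le> \<alpha>}) \<longlonglongrightarrow> 2 / pi * arcsin (sqrt \<alpha>)"
proof -
  let ?Y = "\<lambda>n \<omega>. freq (\<lambda>j. \<bar>walk j \<omega>\<bar> \<le> \<bar>c\<bar>) n"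
  let ?U = "\<lambda>n \<omega>. freq (\<lambda>j. walk j \<omega> > c) n"
  let ?V = "\<lambda>n \<omega>. real (positives n \<omega>) / real n"
  have V: "0 \<le> ?V n \<omega>" "?V n \<omega> \<le> 1" for n \<omega>
    using positives_le[of n \<omega>] by (auto simp: divide_le_eq)
  obtain C where C: "C > 0" "\<And>n. expectation (\<lambda>\<omega>. ?Y n \<omega>) \<le> C / sqrt (real n)"
    using expected_freq_bounded[of "\<bar>c\<bar>"] by blast
  have close: "\<bar>?U n \<omega> - ?V n \<omega>\<bar> \<le> ?Y n \<omega> + 1 / real n" for n \<omega>
  proof -
    have "real (positives n \<omega>) = (\<Sum>j<Suc n. of_bool (walk j \<omega> > 0))"
    proof -
      have "real (positives n \<omega>) = (\<Sum>j<n. of_bool (walk (Suc j) \<omega> > 0))"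
        unfolding positives_def of_nat_sum by (intro sum.cong) auto
      then show ?thesis
        by (simp only: sum.lessThan_Suc_shift walk_0 less_irrefl of_bool_eq add_0_left)
    qed
    then have "?V n \<omega> = freq (\<lambda>j. walk j \<omega> > 0) n + of_bool (walk n \<omega> > 0) / real n"
      by (simp add: freq_def add_divide_distrib)
    moreover have "\<bar>?U n \<omega> - freq (\<lambda>j. walk j \<omega> > 0) n\<bar> \<le> ?Y n \<omega>"
      by (rule order_trans[OF freq_diff_le freq_mono]) auto
    moreover have "0 \<le> of_bool (walk n \<omega> > 0) / real n" "of_bool (walk n \<omega> > 0) / real n \<le> 1 / real n"
      by (auto simp: divide_right_mono)
    ultimately show ?thesis by linarith
  qed
  have "(\<lambda>n. prob {\<omega> \<in> space \<Omega>. ?U n \<omega> \<le> \<alpha>}) \<longlonglongrightarrow> 2 / pi * arcsin (sqrt \<alpha>)"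
  proof (rule arcsine_law_by_moments)
    fix m
    have intU: "integrable \<Omega> (\<lambda>\<omega>. ?U n \<omega> ^ m)" for n
      by (rule integrable_const_bound[where B = 1]) (auto simp: freq_nonneg freq_le_1 power_le_one)
    have intV: "integrable \<Omega> (\<lambda>\<omega>. ?V n \<omega> ^ m)" for n
      by (rule integrable_const_bound[where B = 1])
         (use V in \<open>auto intro!: power_le_one AE_I2 simp: abs_of_nonneg zero_le_power\<close>)
    have "(\<lambda>n. expectation (\<lambda>\<omega>. ?U n \<omega> ^ m) - expectation (\<lambda>\<omega>. ?V n \<omega> ^ m)) \<longlonglongrightarrow> 0"
    proof (rule Lim_null_comparison)
      show "(\<lambda>n. real m * (C / sqrt (real n) + 1 / real n)) \<longlonglongrightarrow> 0"
        by real_asymp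
      show "\<forall>\<^sub>F n in sequentially. norm (expectation (\<lambda>\<omega>. ?U n \<omega> ^ m) - expectation (\<lambda>\<omega>. ?V n \<omega> ^ m))
          \<le> real m * (C / sqrt (real n) + 1 / real n)"
      proof (intro always_eventually allI)
        fix n
        have "norm (expectation (\<lambda>\<omega>. ?U n \<omega> ^ m) - expectation (\<lambda>\<omega>. ?V n \<omega> ^ m)) =
            \<bar>expectation (\<lambda>\<omega>. ?U n \<omega> ^ m - ?V n \<omega> ^ m)\<bar>"
          using intU intV by simp
        also have "\<dots> \<le> expectation (\<lambda>\<omega>. \<bar>?U n \<omega> ^ m - ?V n \<omega> ^ m\<bar>)"
          by (rule integral_abs_bound)
        also have "\<dots> \<le> expectation (\<lambda>\<omega>. real m * (?Y n \<omega> + 1 / real n))"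
        proof (rule integral_mono)
          fix \<omega>
          have "\<bar>?U n \<omega> ^ m - ?V n \<omega> ^ m\<bar> \<le> real m * \<bar>?U n \<omega> - ?V n \<omega>\<bar>"
            using norm_power_diff[of "?U n \<omega>" "?V n \<omega>" m] V freq_nonneg freq_le_1 by simp
          also have "\<dots> \<le> real m * (?Y n \<omega> + 1 / real n)"
            by (intro mult_left_mono close) simp
          finally show "\<bar>?U n \<omega> ^ m - ?V n \<omega> ^ m\<bar> \<le> real m * (?Y n \<omega> + 1 / real n)" .
        next
          show "integrable \<Omega> (\<lambda>\<omega>. \<bar>?U n \<omega> ^ m - ?V n \<omega> ^ m\<bar>)"
            using intU intV by auto
          show "integrable \<Omega> (\<lambda>\<omega>. real m * (?Y n \<omega> + 1 / real n))"
            by (intro integrable_mult_right Bochner_Integration.integrable_add integrable_freq) auto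
        qed
        also have "\<dots> = real m * (expectation (\<lambda>\<omega>. ?Y n \<omega>) + 1 / real n)"
          using integrable_freq[of "\<lambda>w. \<bar>w\<bar> \<le> \<bar>c\<bar>" n] prob_space by simp
        also have "\<dots> \<le> real m * (C / sqrt (real n) + 1 / real n)"
          using C(2) by (intro mult_left_mono add_right_mono) auto
        finally show "norm (expectation (\<lambda>\<omega>. ?U n \<omega> ^ m) - expectation (\<lambda>\<omega>. ?V n \<omega> ^ m))
          \<le> real m * (C / sqrt (real n) + 1 / real n)" .
      qed
    qed
    from tendsto_add[OF this positives_moments[of m]]
    show "(\<lambda>n. expectation (\<lambda>\<omega>. ?U n \<omega> ^ m)) \<longlonglongrightarrow> arcsine_moment m" by simp
  qed (use assms freq_nonneg freq_le_1 in auto)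
  then show ?thesis by simp
qed

end

section \<open>Almost sure oscillation\<close>

context integer_walk
begin

text \<open>
  At the times \<open>2\<^sup>k\<close> the expected frequencies are summable, so the frequencies themselves are almost
  surely summable.
\<close>

lemma AE_freq_bounded_null: "AE \<omega> in \<Omega>. freq (\<lambda>j. \<bar>walk j \<omega>\<bar> \<le> K) \<longlonglongrightarrow> 0"
proof -
  let ?Y = "\<lambda>k \<omega>. freq (\<lambda>j. \<bar>walk j \<omega>\<bar> \<le> K) (2 ^ k)"
  obtain C where C: "C > 0" "\<And>n. expectation (\<lambda>\<omega>. freq (\<lambda>j. \<bar>walk j \<omega>\<bar> \<le> K) n) \<le> C / sqrt (real n)"
    using expected_freq_bounded[of K] by blast
  have "(\<integral>\<^sup>+\<omega>. (\<Sum>k. ennreal (?Y k \<omega>)) \<partial>\<Omega>) = (\<Sum>k. \<integral>\<^sup>+\<omega>. ennreal (?Y k \<omega>) \<partial>\<Omega>)"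
    by (rule nn_integral_suminf) measurable
  also have "\<dots> \<le> (\<Sum>k. ennreal (C * (1 / sqrt 2) ^ k))"
  proof (intro suminf_le summableI)
    fix k
    have "(\<integral>\<^sup>+\<omega>. ennreal (?Y k \<omega>) \<partial>\<Omega>) = ennreal (expectation (?Y k))"
      by (intro nn_integral_eq_integral integrable_freq) (auto simp: freq_nonneg)
    also have "\<dots> \<le> ennreal (C * (1 / sqrt 2) ^ k)"
      using C(2)[of "2 ^ k"] by (intro ennreal_leI) (simp add: real_sqrt_power power_divide)
    finally show "(\<integral>\<^sup>+\<omega>. ennreal (?Y k \<omega>) \<partial>\<Omega>) \<le> ennreal (C * (1 / sqrt 2) ^ k)" .
  qed
  also have "\<dots> < \<infinity>"
  proof -
    have "summable (\<lambda>k. C * (1 / sqrt 2) ^ k)"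
      by (intro summable_mult summable_geometric) (simp add: real_less_rsqrt)
    then show ?thesis
      using C(1) by (subst suminf_ennreal2) auto
  qed
  finally have "AE \<omega> in \<Omega>. (\<Sum>k. ennreal (?Y k \<omega>)) \<noteq> \<infinity>"
    by (intro nn_integral_PInf_AE) auto
  then show ?thesis
  proof (rule eventually_mono)
    fix \<omega> assume "(\<Sum>k. ennreal (?Y k \<omega>)) \<noteq> \<infinity>"
    then have "summable (\<lambda>k. ?Y k \<omega>)"
      by (intro summable_suminf_not_top) (auto simp: freq_nonneg)
    then show "freq (\<lambda>j. \<bar>walk j \<omega>\<bar> \<le> K) \<longlonglongrightarrow> 0"
      by (intro freq_null_of_dyadic summable_LIMSEQ_zero)
  qed
qed

text \<open>
  An event that is invariant under the shift is determined by the coordinates from any time on.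
\<close>

lemma shift_invariant_zero_one:
  assumes A: "A \<in> events" and inv: "\<And>\<omega>. \<omega> \<in> A \<longleftrightarrow> (\<lambda>n. \<omega> (Suc n)) \<in> A"
  shows "prob A = 0 \<or> prob A = 1"
proof -
  define F where "F i = sigma_sets UNIV {(\<lambda>\<omega> :: nat \<Rightarrow> 'a. \<omega> i) -` B |B. True}" for i
  have inv_n: "\<omega> \<in> A \<longleftrightarrow> (\<lambda>i. \<omega> (i + n)) \<in> A" for n \<omega>
  proof (induction n arbitrary: \<omega>)
    case (Suc n)
    show ?case using Suc[of "\<lambda>i. \<omega> (Suc i)"] inv[of \<omega>] by simp
  qed simp
  show ?thesis
  proof (rule kolmogorov_0_1_law)
    show "sigma_algebra (space \<Omega>) (F i)" for i
      unfolding F_def space_path by (rule sigma_algebra_sigma_sets) auto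
    show "indep_sets F UNIV"
      using indep_coords unfolding indep_vars_def F_def by simp
    show "A \<in> tail_events F"
      unfolding tail_events_def
    proof (intro InterI, clarify)
      fix n
      let ?N = "sigma UNIV (\<Union> (F ` {n..}))"
      have sN: "sets ?N = sigma_sets UNIV (\<Union> (F ` {n..}))"
        by (rule sets_measure_of) auto
      have "(\<lambda>\<omega> i. \<omega> (i + n)) \<in> measurable ?N \<Omega>"
        unfolding path_measure_def
      proof (rule measurable_PiM_single')
        fix i
        show "(\<lambda>\<omega>. \<omega> (i + n)) \<in> measurable ?N (measure_pmf \<nu>)"
        proof (rule measurableI)
          fix B
          have "(\<lambda>\<omega> :: nat \<Rightarrow> 'a. \<omega> (i + n)) -` B \<in> F (i + n)"
            unfolding F_def by (intro sigma_sets.Basic) auto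
          then show "(\<lambda>\<omega>. \<omega> (i + n)) -` B \<inter> space ?N \<in> sets ?N"
            unfolding sN by (intro sigma_sets.Basic UN_I[of "i + n"]) auto
        qed simp
      qed auto
      from measurable_sets[OF this A]
      have "(\<lambda>\<omega> i. \<omega> (i + n)) -` A \<in> sets ?N" by simp
      moreover have "(\<lambda>\<omega> i. \<omega> (i + n)) -` A = A"
        using inv_n[of _ n] by blast
      ultimately show "A \<in> sigma_sets (space \<Omega>) (\<Union> (F ` {n..}))"
        by (simp add: sN)
    qed
  qed
qed

lemma walk_shift: "walk j (\<lambda>n. \<omega> (Suc n)) = walk (Suc j) \<omega> - \<Psi> (\<omega> 0)"
  by (simp add: walk_def sum.lessThan_Suc_shift del: sum.lessThan_Suc)

text \<open>
  The arcsine law bounds the probability that the fraction of time above \<open>c\<close> exceeds \<open>\<rho>\<close> infinitely often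
  from below by some \<open>\<delta> > 0\<close> that does not depend on \<open>c\<close>; as these events decrease in \<open>c\<close>, the bound holds
  for all \<open>c\<close> simultaneously. Deleting the first step translates the walk by a constant, which is
  absorbed by the quantification over \<open>c\<close>, so the event in question is shift-invariant.
\<close>

lemma AE_nearly_often_above:
  assumes \<rho>: "0 < \<rho>" "\<rho> < 1"
  shows "AE \<omega> in \<Omega>. \<forall>c. nearly_often (freq (\<lambda>j. walk j \<omega> > c)) \<rho>"
proof -
  let ?f = "\<lambda>c \<omega>. freq (\<lambda>j. walk j \<omega> > c)"
  define E where "E = {\<omega>. \<forall>c. nearly_often (?f c \<omega>) \<rho>}"
  define B where "B c = {\<omega>. \<forall>N. \<exists>n\<ge>N. ?f c \<omega> n > \<rho>}" for c
  define \<delta> where "\<delta> = 1 - 2 / pi * arcsin (sqrt \<rho>)"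
  have "Measurable.pred \<Omega> (\<lambda>\<omega>. \<forall>c. \<forall>i::nat. \<forall>N. \<exists>n. n \<ge> N \<and> ?f c \<omega> n > \<rho> - 1 / (real i + 1))"
    by measurable
  then have E: "E \<in> events"
    by (simp add: E_def nearly_often_iff_nat pred_def)
  have [measurable]: "{\<omega>. ?f c \<omega> n > \<rho>} \<in> events" for c n
  proof -
    have "Measurable.pred \<Omega> (\<lambda>\<omega>. ?f c \<omega> n > \<rho>)" by measurable
    then show ?thesis by (simp add: pred_def)
  qed
  have \<delta>: "\<delta> > 0"
  proof -
    have "arcsin (sqrt \<rho>) < arcsin 1"
      using \<rho> real_sqrt_gt_zero[of \<rho>] by (intro arcsin_less_arcsin) (linarith, auto)
    then show ?thesis by (simp add: \<delta>_def field_simps)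
  qed
  have BE: "(\<Inter>k. B (int k)) \<subseteq> E"
  proof
    fix \<omega> assume \<omega>: "\<omega> \<in> (\<Inter>k. B (int k))"
    have "nearly_often (?f c \<omega>) \<rho>" for c
      unfolding nearly_often_def frequently_sequentially
    proof (intro allI impI)
      fix e :: real and N assume "e > 0"
      obtain n where n: "n \<ge> N" "?f (int (nat c)) \<omega> n > \<rho>"
        proof -
        have "\<omega> \<in> B (int (nat c))" using \<omega> by blast
        then show thesis using that unfolding B_def by blast
      qed
      moreover have "?f (int (nat c)) \<omega> n \<le> ?f c \<omega> n"
        by (rule freq_mono) linarith
      ultimately show "\<exists>n\<ge>N. \<rho> - e < ?f c \<omega> n"
        using \<open>e > 0\<close> by (intro exI[of _ n]) auto
    qed
    then show "\<omega> \<in> E" by (simp add: E_def)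
  qed
  have probB: "B c \<in> events" "prob (B c) \<ge> \<delta>" for c
  proof -
    let ?U = "\<lambda>N. \<Union>n\<in>{N..}. {\<omega>. ?f c \<omega> n > \<rho>}"
    have BU: "B c = (\<Inter>N. ?U N)" by (auto simp: B_def)
    have U: "range ?U \<subseteq> events" by auto
    show "B c \<in> events" unfolding BU by measurable
    have dec: "decseq ?U" by (force simp: decseq_def)
    have "\<delta> \<le> prob (?U N)" for N
    proof (rule LIMSEQ_le_const2)
      show "(\<lambda>n. 1 - prob {\<omega>. ?f c \<omega> n \<le> \<rho>}) \<longlonglongrightarrow> \<delta>"
        unfolding \<delta>_def using \<rho> by (intro tendsto_intros arcsine_above) auto
      have "1 - prob {\<omega>. ?f c \<omega> n \<le> \<rho>} \<le> prob (?U N)" if "n \<ge> N" for n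
      proof -
        have "{\<omega>. ?f c \<omega> n \<le> \<rho>} = space \<Omega> - {\<omega>. ?f c \<omega> n > \<rho>}" by auto
        then have "1 - prob {\<omega>. ?f c \<omega> n \<le> \<rho>} = prob {\<omega>. ?f c \<omega> n > \<rho>}"
          by (simp only:) (subst prob_compl, auto)
        also have "\<dots> \<le> prob (?U N)"
          using that U by (intro finite_measure_mono) auto
        finally show ?thesis .
      qed
      then show "\<exists>M. \<forall>n\<ge>M. 1 - prob {\<omega>. ?f c \<omega> n \<le> \<rho>} \<le> prob (?U N)" by blast
    qed
    then show "prob (B c) \<ge> \<delta>"
      unfolding BU by (intro LIMSEQ_le_const[OF finite_Lim_measure_decseq[OF U dec]]) auto
  qed
  have "prob (\<Inter>k. B (int k)) \<ge> \<delta>"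
  proof (rule LIMSEQ_le_const[OF finite_Lim_measure_decseq])
    show "range (\<lambda>k. B (int k)) \<subseteq> events" using probB by auto
    show "decseq (\<lambda>k. B (int k))"
      unfolding decseq_def
    proof (intro allI impI subsetI)
      fix k l :: nat and \<omega> assume kl: "k \<le> l" "\<omega> \<in> B (int l)"
      have "?f (int l) \<omega> n \<le> ?f (int k) \<omega> n" for n
        using kl(1) by (intro freq_mono) linarith
      then show "\<omega> \<in> B (int k)"
        using kl(2) unfolding B_def by (blast intro: order.strict_trans2)
    qed
  qed (use probB in auto)
  also have "\<dots> \<le> prob E"
    by (rule finite_measure_mono[OF BE E])
  finally have "prob E \<noteq> 0" using \<delta> by linarith
  moreover have "prob E = 0 \<or> prob E = 1"
  proof (rule shift_invariant_zero_one[OF E])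
    fix \<omega> :: "nat \<Rightarrow> 'a"
    let ?\<theta> = "\<lambda>n. \<omega> (Suc n)"
    have f: "?f c ?\<theta> = freq (\<lambda>j. walk (Suc j) \<omega> > c + \<Psi> (\<omega> 0))" for c
      by (simp add: walk_shift less_diff_eq)
    have lim: "(\<lambda>n. ?f (c + \<Psi> (\<omega> 0)) \<omega> n - ?f c ?\<theta> n) \<longlonglongrightarrow> 0" for c
    proof (rule Lim_null_comparison)
      show "(\<lambda>n. 1 / real n) \<longlonglongrightarrow> 0" by real_asymp
      show "\<forall>\<^sub>F n in sequentially. norm (?f (c + \<Psi> (\<omega> 0)) \<omega> n - ?f c ?\<theta> n) \<le> 1 / real n"
        using freq_shift[of "\<lambda>j. walk j \<omega> > c + \<Psi> (\<omega> 0)"]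
        by (intro always_eventually allI) (simp only: f real_norm_def abs_minus_commute)
    qed
    have lim': "(\<lambda>n. ?f c ?\<theta> n - ?f (c + \<Psi> (\<omega> 0)) \<omega> n) \<longlonglongrightarrow> 0" for c
      using tendsto_minus[OF lim[of c]] by simp
    show "\<omega> \<in> E \<longleftrightarrow> ?\<theta> \<in> E"
    proof
      assume "\<omega> \<in> E"
      then show "?\<theta> \<in> E"
        using nearly_often_perturb[OF _ lim] by (simp add: E_def)
    next
      assume "?\<theta> \<in> E"
      then have "nearly_often (?f (c - \<Psi> (\<omega> 0)) ?\<theta>) \<rho>" for c by (simp add: E_def)
      then have "nearly_often (?f c \<omega>) \<rho>" for c
        using nearly_often_perturb[OF _ lim', of "c - \<Psi> (\<omega> 0)"] by simp
      then show "\<omega> \<in> E" by (simp add: E_def)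
    qed
  qed
  ultimately have "prob E = 1" by simp
  then have "AE \<omega> in \<Omega>. \<omega> \<in> E"
    using E prob_eq_1 by blast
  then show ?thesis by (simp add: E_def)
qed

lemma AE_nearly_often_positive: "AE \<omega> in \<Omega>. nearly_often (freq (\<lambda>j. walk j \<omega> > 0)) 1"
proof -
  have "AE \<omega> in \<Omega>. \<forall>i::nat. nearly_often (freq (\<lambda>j. walk j \<omega> > 0)) (1 - 1 / (real i + 2))"
    unfolding AE_all_countable
  proof
    fix i :: nat
    have "AE \<omega> in \<Omega>. \<forall>c. nearly_often (freq (\<lambda>j. walk j \<omega> > c)) (1 - 1 / (real i + 2))"
      by (rule AE_nearly_often_above) auto
    then show "AE \<omega> in \<Omega>. nearly_often (freq (\<lambda>j. walk j \<omega> > 0)) (1 - 1 / (real i + 2))"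
      by eventually_elim blast
  qed
  then show ?thesis
  proof (rule eventually_mono)
    fix \<omega> assume *: "\<forall>i::nat. nearly_often (freq (\<lambda>j. walk j \<omega> > 0)) (1 - 1 / (real i + 2))"
    show "nearly_often (freq (\<lambda>j. walk j \<omega> > 0)) 1"
      unfolding nearly_often_def
    proof (intro allI impI)
      fix e :: real assume "e > 0"
      then obtain i :: nat where i: "1 / (real i + 1) < e / 2"
        using nat_approx_posE[of "e / 2"] by (auto simp: add.commute)
      have "1 / (real i + 2) \<le> 1 / (real i + 1)" by (simp add: field_simps)
      then have le: "1 - e \<le> 1 - 1 / (real i + 2) - e / 2" using i by linarith
      have "\<exists>\<^sub>F n in sequentially. freq (\<lambda>j. walk j \<omega> > 0) n > 1 - 1 / (real i + 2) - e / 2"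
        using * \<open>e > 0\<close> by (auto simp: nearly_often_def)
      then show "\<exists>\<^sub>F n in sequentially. freq (\<lambda>j. walk j \<omega> > 0) n > 1 - e"
        by (rule frequently_elim1) (use le in linarith)
    qed
  qed
qed

lemma integer_walk_uminus: "integer_walk \<nu> (\<lambda>a. - \<Psi> a)"
  by standard (use square_integrable centered nondegenerate in auto)

theorem arcsine_below:
  assumes "\<alpha> \<in> {0<..<1}"
  shows "(\<lambda>n. prob {\<omega>. freq (\<lambda>j. walk j \<omega> < c) n \<le> \<alpha>}) \<longlonglongrightarrow> 2 / pi * arcsin (sqrt \<alpha>)"
proof -
  interpret neg: integer_walk \<nu> "\<lambda>a. - \<Psi> a" by (rule integer_walk_uminus)
  have "neg.walk j \<omega> = - walk j \<omega>" for j \<omega>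
    by (simp add: neg.walk_def walk_def sum_negf)
  then show ?thesis
    using neg.arcsine_above[OF assms, of "- c"] by simp
qed

theorem AE_oscillating: "AE \<omega> in \<Omega>. oscillating (\<lambda>j. walk j \<omega>)"
proof -
  interpret neg: integer_walk \<nu> "\<lambda>a. - \<Psi> a" by (rule integer_walk_uminus)
  have neg: "neg.walk j \<omega> = - walk j \<omega>" for j \<omega>
    by (simp add: neg.walk_def walk_def sum_negf)
  have "AE \<omega> in \<Omega>. \<forall>K. freq (\<lambda>j. \<bar>walk j \<omega>\<bar> \<le> K) \<longlonglongrightarrow> 0"
    unfolding AE_all_countable using AE_freq_bounded_null by blast
  moreover have "AE \<omega> in \<Omega>. nearly_often (freq (\<lambda>j. walk j \<omega> < 0)) 1"
    using neg.AE_nearly_often_positive by (simp add: neg)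
  ultimately show ?thesis
    using AE_nearly_often_positive by eventually_elim (simp add: oscillating_def)
qed

end

section \<open>Iterates of a homeomorphism\<close>

locale homeo =
  fixes X :: "'x topology" and T :: "'x \<Rightarrow> 'x"
  assumes homeomorphic: "homeomorphic_map X X T"
begin

abbreviation iter :: "int \<Rightarrow> 'x \<Rightarrow> 'x" where "iter \<equiv> int_iter X T"

abbreviation T_inv :: "'x \<Rightarrow> 'x" where "T_inv \<equiv> inv_into (topspace X) T"

lemma continuous_T: "continuous_map X X T"
  using homeomorphic homeomorphic_imp_continuous_map by blast

lemma bij_T: "bij_betw T (topspace X) (topspace X)"
  using homeomorphic_imp_injective_map[OF homeomorphic] homeomorphic_imp_surjective_map[OF homeomorphic]
  by (simp add: bij_betw_def)

lemma T_in: "x \<in> topspace X \<Longrightarrow> T x \<in> topspace X"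
  using bij_T by (auto simp: bij_betw_def)

lemma T_inv_in: "x \<in> topspace X \<Longrightarrow> T_inv x \<in> topspace X"
  using bij_T by (metis bij_betw_def inv_into_into)

lemma T_T_inv: "x \<in> topspace X \<Longrightarrow> T (T_inv x) = x"
  using bij_T by (metis bij_betw_inv_into_right)

lemma T_inv_T: "x \<in> topspace X \<Longrightarrow> T_inv (T x) = x"
  using bij_T by (metis bij_betw_inv_into_left)

lemma homeomorphic_T_inv: "homeomorphic_map X X T_inv"
proof -
  obtain g where g: "homeomorphic_maps X X T g"
    using homeomorphic by (auto simp: homeomorphic_map_maps)
  have "g x = T_inv x" if "x \<in> topspace X" for x
    using g that T_inv_T[of "g x"] by (auto simp: homeomorphic_maps_def continuous_map_def Pi_iff)
  moreover have "homeomorphic_map X X g"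
    using g homeomorphic_maps_map homeomorphic_maps_sym by blast
  ultimately show ?thesis
    using homeomorphic_map_eq by blast
qed

lemma homeo_T_inv: "homeo X T_inv"
  by standard (rule homeomorphic_T_inv)

lemma T_inv_T_inv: "x \<in> topspace X \<Longrightarrow> inv_into (topspace X) T_inv x = T x"
  by (metis T_in T_inv_T homeo.T_inv_T homeo_T_inv)

lemma funpow_in: "x \<in> topspace X \<Longrightarrow> (T ^^ n) x \<in> topspace X"
  by (induction n) (auto intro: T_in)

lemma iter_0 [simp]: "iter 0 x = x"
  by (simp add: int_iter_def)

lemma iter_of_nat: "iter (int n) x = (T ^^ n) x"
  by (simp add: int_iter_def)

lemma iter_neg_of_nat: "iter (- int n) x = (T_inv ^^ n) x"
  by (cases "n = 0") (auto simp: int_iter_def)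

lemma iter_in: "x \<in> topspace X \<Longrightarrow> iter k x \<in> topspace X"
  using funpow_in homeo.funpow_in[OF homeo_T_inv] by (simp add: int_iter_def)

lemma iter_Suc:
  assumes x: "x \<in> topspace X"
  shows "iter (k + 1) x = T (iter k x)"
proof (cases "k \<ge> 0")
  case True
  then show ?thesis by (simp add: int_iter_def nat_add_distrib)
next
  case False
  then obtain n where k: "k = - int (Suc n)"
    by (metis int_cases not_less zero_le_imp_eq_int negD leI)
  have "iter (k + 1) x = (T_inv ^^ n) x"
    unfolding k by (simp add: iter_neg_of_nat[symmetric])
  moreover have "iter k x = T_inv ((T_inv ^^ n) x)"
    unfolding k iter_neg_of_nat by simp
  ultimately show ?thesis
    using T_T_inv homeo.funpow_in[OF homeo_T_inv x] by simp
qed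

lemma iter_1: "x \<in> topspace X \<Longrightarrow> iter 1 x = T x"
  using iter_Suc[of x 0] by simp

lemma iter_pred:
  assumes x: "x \<in> topspace X"
  shows "iter (k - 1) x = T_inv (iter k x)"
  using iter_Suc[OF x, of "k - 1"] T_inv_T[OF iter_in[OF x]] by simp

lemma iter_add:
  assumes x: "x \<in> topspace X"
  shows "iter (a + b) x = iter a (iter b x)"
proof (induction a rule: int_induct[of _ 0])
  case (step1 i)
  then show ?case
    using iter_Suc[OF x, of "i + b"] iter_Suc[OF iter_in[OF x], of i b] by (simp add: algebra_simps)
next
  case (step2 i)
  then show ?case
    using iter_pred[OF x, of "i + b"] iter_pred[OF iter_in[OF x], of i b] by (simp add: algebra_simps)
qed simp

lemma rand_iter_eq:
  assumes x: "x \<in> topspace X"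
  shows "rand_iter (\<lambda>a. iter (\<Psi> a)) \<omega> n x = iter (\<Sum>i<n. \<Psi> (\<omega> i)) x"
proof (induction n)
  case (Suc n)
  then show ?case
    using iter_add[OF x, of "\<Psi> (\<omega> n)" "\<Sum>i<n. \<Psi> (\<omega> i)"] by (simp add: add.commute)
qed simp

lemma homeo_square: "homeo X (T \<circ> T)"
  by standard (use homeomorphic homeomorphic_map_compose in blast)

lemma iter_square:
  assumes x: "x \<in> topspace X"
  shows "int_iter X (T \<circ> T) k x = iter (2 * k) x"
proof -
  interpret sq: homeo X "T \<circ> T" by (rule homeo_square)
  have step: "sq.iter (i + 1) x = T (T (sq.iter i x))" "iter (2 * (i + 1)) x = T (T (iter (2 * i) x))" for i
    using sq.iter_Suc[OF x, of i] iter_Suc[OF x, of "2 * i"] iter_Suc[OF x, of "2 * i + 1"]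
    by (simp_all add: algebra_simps)
  show ?thesis
  proof (induction k rule: int_induct[of _ 0])
    case (step1 i)
    then show ?case by (simp only: step)
  next
    case (step2 i)
    have "T (T (sq.iter (i - 1) x)) = T (T (iter (2 * (i - 1)) x))"
      using step[of "i - 1"] step2 by simp
    then show ?case
      by (metis T_in T_inv_T iter_in sq.iter_in x)
  qed (simp add: int_iter_def)
qed

lemma limitin_T: "limitin X u a F \<Longrightarrow> limitin X (\<lambda>n. T (u n)) (T a) F"
  using continuous_map_limit[OF continuous_T] by (simp add: comp_def)

text \<open>
  A backward orbit that converges to \<open>a\<close> enters every neighborhood \<open>U\<close> of \<open>a\<close>. For \<open>U\<close> so small that its
  forward images avoid \<open>x\<close>, it could then not have come from \<open>x\<close>.
\<close>

lemma no_return_to_sink: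
  assumes haus: "Hausdorff_space X" and a: "sink X T a" and x: "x \<in> topspace X" "x \<noteq> a"
  shows "\<not> limitin X (\<lambda>n. iter (- int n) x) a sequentially"
proof
  assume lim: "limitin X (\<lambda>n. iter (- int n) x) a sequentially"
  have "a \<in> fixed_points X T" using a unfolding sink_def by (elim conjE)
  then have aX: "a \<in> topspace X" by (simp add: fixed_points_def)
  have "closedin X {x}"
    by (rule closedin_Hausdorff_singleton[OF haus x(1)])
  then have "openin X (topspace X - {x})" by (rule openin_diff[OF openin_topspace])
  moreover have "a \<in> topspace X - {x}" using aX x by auto
  moreover have "\<forall>V. openin X V \<and> a \<in> V \<longrightarrow> (\<exists>U. openin X U \<and> a \<in> U \<and> (\<forall>n. (T ^^ n) ` U \<subseteq> V))"
    using a unfolding sink_def by (elim conjE)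
  ultimately obtain U where U: "openin X U" "a \<in> U" "\<And>n. (T ^^ n) ` U \<subseteq> topspace X - {x}"
    by blast
  have "\<forall>\<^sub>F n in sequentially. iter (- int n) x \<in> U"
    using lim U by (auto simp: limitin_def)
  then obtain n where "iter (- int n) x \<in> U"
    using eventually_happens by force
  then have "iter (int n) (iter (- int n) x) \<in> topspace X - {x}"
    using U(3)[of n] by (auto simp: iter_of_nat)
  moreover have "iter (int n) (iter (- int n) x) = x"
    using iter_add[OF x(1), of "int n" "- int n"] by simp
  ultimately show False by simp
qed

lemma iter_T_inv: "int_iter X T_inv k x = iter (- k) x" if x: "x \<in> topspace X"
proof -
  interpret inv: homeo X T_inv by (rule homeo_T_inv)
  show ?thesis
  proof (induction k rule: int_induct[of _ 0])
    case (step1 i)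
    then show ?case
      using inv.iter_Suc[OF x, of i] iter_pred[OF x, of "- i"] by (simp only: minus_add_distrib) simp
  next
    case (step2 i)
    then show ?case
      using inv.iter_pred[OF x, of i] iter_Suc[OF x, of "- i"] T_inv_T_inv iter_in[OF x, of "- i"] by (simp add: algebra_simps)
  qed simp
qed

lemma not_homoclinic:
  assumes haus: "Hausdorff_space X" and a: "sink X T a \<or> source X T a" and x: "x \<in> topspace X" "x \<noteq> a"
    and lim: "limitin X (\<lambda>n. iter (int n) x) a sequentially" "limitin X (\<lambda>n. iter (- int n) x) a sequentially"
  shows False
proof -
  interpret inv: homeo X T_inv by (rule homeo_T_inv)
  from a show False
  proof
    assume "sink X T a"
    then show False using no_return_to_sink[OF haus _ x] lim by blast
  next
    assume "source X T a"
    then have "sink X T_inv a" by (simp only: source_def)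
    from inv.no_return_to_sink[OF haus this x]
    show False using lim(1) by (simp add: iter_T_inv[OF x(1)])
  qed
qed

text \<open>
  Every orbit near a sink converges to it; for a fixed point, this leaves only the sink itself.
\<close>

lemma isolated_fixed_point:
  assumes haus: "Hausdorff_space X" and a: "sink X T a \<or> source X T a"
  shows "\<exists>W. openin X W \<and> a \<in> W \<and> W \<inter> fixed_points X T \<subseteq> {a}"
proof -
  have *: "\<exists>W. openin X W \<and> a \<in> W \<and> W \<inter> fixed_points X T \<subseteq> {a}"
    if R: "sink X R a" "\<And>x. x \<in> fixed_points X T \<Longrightarrow> R x = x" for R
  proof -
    have "\<exists>W. openin X W \<and> a \<in> W \<and> (\<forall>x\<in>W. limitin X (\<lambda>n. (R ^^ n) x) a sequentially)"
      using R(1) unfolding sink_def by (elim conjE)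
    then obtain W where W: "openin X W" "a \<in> W" "\<forall>x\<in>W. limitin X (\<lambda>n. (R ^^ n) x) a sequentially"
      by (elim exE conjE)
    have "x = a" if x: "x \<in> W" "x \<in> fixed_points X T" for x
    proof -
      have "(R ^^ n) x = x" for n by (induction n) (simp_all add: R(2)[OF x(2)])
      then have "limitin X (\<lambda>n::nat. x) a sequentially" using bspec[OF W(3) x(1)] by simp
      moreover have "limitin X (\<lambda>n::nat. x) x sequentially"
        using x(2) by (simp add: fixed_points_def Abstract_Limits.limitin_const_iff)
      ultimately show "x = a"
        using limitin_Hausdorff_unique[OF _ _ sequentially_bot haus] by blast
    qed
    then have "W \<inter> fixed_points X T \<subseteq> {a}" by blast
    with W(1,2) show ?thesis by (intro exI[of _ W] conjI)
  qed
  from a show ?thesis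
  proof
    assume "sink X T a"
    then show ?thesis by (rule *) (simp add: fixed_points_def)
  next
    assume "source X T a"
    then have "sink X T_inv a" by (simp only: source_def)
    then show ?thesis
    proof (rule *)
      fix x assume "x \<in> fixed_points X T"
      then have "x \<in> topspace X" "T x = x" by (simp_all add: fixed_points_def)
      then show "T_inv x = x" using T_inv_T[of x] by simp
    qed
  qed
qed

lemma finite_fixed_points:
  assumes haus: "Hausdorff_space X" and comp: "compact_space X"
    and ss: "\<And>a. a \<in> fixed_points X T \<Longrightarrow> sink X T a \<or> source X T a"
  shows "finite (fixed_points X T)"
proof -
  have "closedin X (fixed_points X T)"
    unfolding fixed_points_def
    by (rule closedin_continuous_maps_eq[OF haus continuous_T continuous_map_id[unfolded id_def]])
  then have cpt: "compactin X (fixed_points X T)"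
    using comp closedin_compact_space by blast
  have "\<forall>a\<in>fixed_points X T. \<exists>W. openin X W \<and> a \<in> W \<and> W \<inter> fixed_points X T \<subseteq> {a}"
    using isolated_fixed_point[OF haus ss] by blast
  then obtain W where W: "\<And>a. a \<in> fixed_points X T \<Longrightarrow> openin X (W a) \<and> a \<in> W a \<and> W a \<inter> fixed_points X T \<subseteq> {a}"
    by metis
  obtain F where F: "finite F" "F \<subseteq> W ` fixed_points X T" "fixed_points X T \<subseteq> \<Union>F"
    using compactinD[OF cpt, of "W ` fixed_points X T"] W by blast
  then obtain G where G: "finite G" "G \<subseteq> fixed_points X T" "F = W ` G"
    using finite_subset_image by metis
  have "fixed_points X T \<subseteq> G"
  proof
    fix z assume z: "z \<in> fixed_points X T"
    then obtain g where g: "g \<in> G" "z \<in> W g" using F(3) G(3) by blast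
    then have "z = g" using W[of g] G(2) z by blast
    then show "z \<in> G" using g(1) by simp
  qed
  then show ?thesis using G(1) finite_subset by blast
qed

end

lemma limitin_even_odd:
  assumes "limitin X (\<lambda>n. u (2 * n)) a sequentially" "limitin X (\<lambda>n. u (2 * n + 1)) a sequentially"
  shows "limitin X u a sequentially"
  unfolding limitin_sequentially
proof (intro conjI allI impI)
  show "a \<in> topspace X" using assms(1) by (simp add: limitin_def)
  fix U assume U: "openin X U \<and> a \<in> U"
  obtain N1 where N1: "\<And>n. n \<ge> N1 \<Longrightarrow> u (2 * n) \<in> U"
    using assms(1) U unfolding limitin_sequentially by blast
  obtain N2 where N2: "\<And>n. n \<ge> N2 \<Longrightarrow> u (2 * n + 1) \<in> U"
    using assms(2) U unfolding limitin_sequentially by blast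
  show "\<exists>N. \<forall>n\<ge>N. u n \<in> U"
  proof (intro exI allI impI)
    fix n assume n: "2 * (N1 + N2) \<le> n"
    show "u n \<in> U"
    proof (cases "even n")
      case True
      then obtain m where "n = 2 * m" by blast
      then show ?thesis using N1[of m] n by simp
    next
      case False
      then obtain m where "n = 2 * m + 1" by (rule oddE)
      then show ?thesis using N2[of m] n by simp
    qed
  qed
qed

lemma (in homeo) limits_of_square:
  assumes x: "x \<in> topspace X" and ab: "T a = a" "T b = b"
    and lim: "limitin X (\<lambda>n. int_iter X (T \<circ> T) (int n) x) a sequentially"
      "limitin X (\<lambda>n. int_iter X (T \<circ> T) (- int n) x) b sequentially"
  shows "limitin X (\<lambda>n. iter (int n) x) a sequentially" "limitin X (\<lambda>n. iter (- int n) x) b sequentially"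
proof -
  show "limitin X (\<lambda>n. iter (int n) x) a sequentially"
  proof (rule limitin_even_odd)
    show ev: "limitin X (\<lambda>n. iter (int (2 * n)) x) a sequentially"
      using lim(1) by (simp add: iter_square[OF x])
    show "limitin X (\<lambda>n. iter (int (2 * n + 1)) x) a sequentially"
    proof -
      have "iter (int (2 * n + 1)) x = T (iter (int (2 * n)) x)" for n
        by (subst iter_Suc[OF x, symmetric]) (simp add: add.commute)
      then show ?thesis using limitin_T[OF ev] ab by simp
    qed
  qed
  show "limitin X (\<lambda>n. iter (- int n) x) b sequentially"
  proof (rule limitin_even_odd)
    show ev: "limitin X (\<lambda>n. iter (- int (2 * n)) x) b sequentially"
      using lim(2) by (simp add: iter_square[OF x])
    have "iter (- int (2 * n + 1)) x = T (iter (- int (2 * Suc n)) x)" for n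
      by (subst iter_Suc[OF x, symmetric]) simp
    then show "limitin X (\<lambda>n. iter (- int (2 * n + 1)) x) b sequentially"
      using limitin_T[OF limitin_subsequence[OF _ ev, of Suc]] ab by (simp add: strict_mono_Suc_iff comp_def)
  qed
qed

section \<open>Monotone dynamics on an arc\<close>

lemma int_threshold:
  fixes Q :: "int \<Rightarrow> bool"
  assumes down: "\<And>j k. j \<le> k \<Longrightarrow> Q k \<Longrightarrow> Q j" and a: "Q a" and b: "\<not> Q b"
  shows "\<exists>c. \<forall>k. Q k \<longleftrightarrow> k < c"
proof -
  have below: "k < b" if "Q k" for k
    using down[OF _ that, of b] b by (cases "k < b") auto
  define n where "n = (LEAST n. Q (b - int n))"
  have n: "Q (b - int n)"
    unfolding n_def by (rule LeastI[of _ "nat (b - a)"]) (use a below[OF a] in simp)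
  show ?thesis
  proof (intro exI[of _ "b - int n + 1"] allI iffI)
    fix k assume k: "Q k"
    then have "n \<le> nat (b - k)"
      unfolding n_def by (intro Least_le) (use below[OF k] in simp)
    then show "k < b - int n + 1" using below[OF k] by linarith
  next
    fix k assume "k < b - int n + 1"
    then show "Q k" by (intro down[OF _ n]) simp
  qed
qed

text \<open>
  A coordinate \<open>h\<close>, with inverse \<open>\<pi>\<close>, identifies an arc with the interval \<open>(\<alpha>, \<beta>)\<close> so that \<open>T\<close> acts on it by
  an increasing map without fixed points. The ends \<open>\<pi> \<alpha>\<close> and \<open>\<pi> \<beta>\<close> may be the same point, as on a
  circle cut open at one point.
\<close>

locale monotone_arc = homeo X T for X :: "'x topology" and T :: "'x \<Rightarrow> 'x" +
  fixes h :: "'x \<Rightarrow> real" and \<pi> :: "real \<Rightarrow> 'x" and \<alpha> \<beta> :: real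
  assumes hausdorff: "Hausdorff_space X"
    and continuous_\<pi>: "continuous_map (top_of_set {\<alpha>..\<beta>}) X \<pi>"
    and h_\<pi>: "\<And>y. \<alpha> < y \<Longrightarrow> y < \<beta> \<Longrightarrow> h (\<pi> y) = y"
    and \<pi>_h: "\<And>z. z \<in> topspace X \<Longrightarrow> \<alpha> < h z \<Longrightarrow> h z < \<beta> \<Longrightarrow> \<pi> (h z) = z"
    and invariant: "\<And>z. z \<in> topspace X \<Longrightarrow> \<alpha> < h z \<and> h z < \<beta> \<longleftrightarrow> \<alpha> < h (T z) \<and> h (T z) < \<beta>"
    and monotone: "\<And>z w. z \<in> topspace X \<Longrightarrow> w \<in> topspace X \<Longrightarrow> \<alpha> < h z \<Longrightarrow> h z < h w \<Longrightarrow> h w < \<beta> \<Longrightarrow> h (T z) < h (T w)"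
    and no_fixed: "\<And>z. z \<in> topspace X \<Longrightarrow> \<alpha> < h z \<Longrightarrow> h z < \<beta> \<Longrightarrow> T z \<noteq> z"
begin

text \<open>
  Reversing the coordinate exchanges orbits that move up and orbits that move down.
\<close>

lemma reflect: "monotone_arc X T (\<lambda>z. - h z) (\<lambda>y. \<pi> (- y)) (- \<beta>) (- \<alpha>)"
proof
  show "continuous_map (top_of_set {- \<beta>..- \<alpha>}) X (\<lambda>y. \<pi> (- y))"
  proof -
    have "continuous_map (top_of_set {- \<beta>..- \<alpha>}) (top_of_set {\<alpha>..\<beta>}) uminus"
      by (auto simp: continuous_map_in_subtopology intro!: continuous_intros)
    from continuous_map_compose[OF this continuous_\<pi>] show ?thesis by (simp add: comp_def)
  qed
  show "- \<beta> < - h z \<and> - h z < - \<alpha> \<longleftrightarrow> - \<beta> < - h (T z) \<and> - h (T z) < - \<alpha>" if "z \<in> topspace X" for z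
    using invariant[OF that] by auto
qed (use hausdorff h_\<pi> \<pi>_h monotone no_fixed homeomorphic in auto)

context
  fixes x assumes x: "x \<in> topspace X" "\<alpha> < h x" "h x < \<beta>"
begin

lemma orbit_in_arc: "\<alpha> < h (iter k x)" "h (iter k x) < \<beta>"
proof -
  have "\<alpha> < h (iter k x) \<and> h (iter k x) < \<beta>"
  proof (induction k rule: int_induct[of _ 0])
    case (step1 i)
    then show ?case using invariant[OF iter_in[OF x(1)]] iter_Suc[OF x(1), of i] by simp
  next
    case (step2 i)
    then show ?case using invariant[OF iter_in[OF x(1), of "i - 1"]] iter_Suc[OF x(1), of "i - 1"] by simp
  qed (use x in auto)
  then show "\<alpha> < h (iter k x)" "h (iter k x) < \<beta>" by auto
qed

lemma orbit_limitin:
  assumes "(\<lambda>n. h (iter (u n) x)) \<longlonglongrightarrow> L" "\<alpha> \<le> L" "L \<le> \<beta>"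
  shows "limitin X (\<lambda>n. iter (u n) x) (\<pi> L) sequentially"
proof -
  have "limitin (top_of_set {\<alpha>..\<beta>}) (\<lambda>n. h (iter (u n) x)) L sequentially"
    using assms orbit_in_arc by (auto simp: limitin_subtopology less_imp_le)
  from continuous_map_limit[OF continuous_\<pi> this]
  show ?thesis
    using \<pi>_h[OF iter_in[OF x(1)] orbit_in_arc] by (simp add: comp_def)
qed

text \<open>
  The limit of an orbit is a fixed point of \<open>T\<close>.
\<close>

lemma orbit_limit_is_end:
  assumes "(\<lambda>n. h (iter (u n) x)) \<longlonglongrightarrow> L" "(\<lambda>n. h (iter (u n + 1) x)) \<longlonglongrightarrow> L" "\<alpha> \<le> L" "L \<le> \<beta>"
  shows "L = \<alpha> \<or> L = \<beta>"
proof (rule ccontr)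
  assume "\<not> ?thesis"
  then have L: "\<alpha> < L" "L < \<beta>" using assms by auto
  have lim: "limitin X (\<lambda>n. iter (u n) x) (\<pi> L) sequentially"
    by (rule orbit_limitin[OF assms(1,3,4)])
  have "limitin X (\<lambda>n. T (iter (u n) x)) (\<pi> L) sequentially"
    using orbit_limitin[OF assms(2,3,4)] by (simp only: iter_Suc[OF x(1)])
  from limitin_Hausdorff_unique[OF limitin_T[OF lim] this sequentially_bot hausdorff]
  have "T (\<pi> L) = \<pi> L" .
  moreover have "\<pi> L \<in> topspace X" using lim by (simp add: limitin_def)
  ultimately show False
    using no_fixed[of "\<pi> L"] h_\<pi>[OF L] L by simp
qed

lemma orbit_increasing:
  assumes up: "h x < h (T x)"
  shows "strict_mono (\<lambda>k. h (iter k x))" "(\<lambda>n. h (iter (int n) x)) \<longlonglongrightarrow> \<beta>" "(\<lambda>n. h (iter (- int n) x)) \<longlonglongrightarrow> \<alpha>"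
proof -
  let ?v = "\<lambda>k. h (iter k x)"
  have inj: "?v k \<noteq> ?v (k + 1)" for k
    using no_fixed[OF iter_in[OF x(1)] orbit_in_arc] \<pi>_h[OF iter_in[OF x(1)] orbit_in_arc] iter_Suc[OF x(1)]
    by metis
  have step: "?v k < ?v (k + 1)" for k
  proof (induction k rule: int_induct[of _ 0])
    case base
    show ?case using up iter_1[OF x(1)] by simp
  next
    case (step1 i)
    then show ?case
      using monotone[OF iter_in[OF x(1)] iter_in[OF x(1)] orbit_in_arc(1) _ orbit_in_arc(2), of i "i + 1"]
        iter_Suc[OF x(1)] by metis
  next
    case (step2 i)
    show ?case
    proof (rule ccontr)
      assume "\<not> ?thesis"
      then have "?v i < ?v (i - 1)" using inj[of "i - 1"] by simp
      then have "?v (i + 1) < ?v i"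
        using monotone[OF iter_in[OF x(1)] iter_in[OF x(1)] orbit_in_arc(1) _ orbit_in_arc(2), of i "i - 1"]
          iter_Suc[OF x(1), of i] iter_Suc[OF x(1), of "i - 1"] by simp
      then show False using step2 by simp
    qed
  qed
  have plus: "?v k < ?v (k + int (Suc n))" for k n
  proof (induction n)
    case (Suc n)
    then show ?case using step[of "k + int (Suc n)"] by (simp add: algebra_simps)
  qed (use step in simp)
  show sm: "strict_mono ?v"
  proof (rule strict_monoI)
    fix k l :: int assume "k < l"
    then obtain n where "l = k + int (Suc n)"
      by (metis zless_iff_Suc_zadd)
    then show "?v k < ?v l" using plus by simp
  qed
  have mono: "?v k \<le> ?v l" if "k \<le> l" for k l
    by (rule strict_mono_leD[OF sm that])
  have "incseq (\<lambda>n. ?v (int n))" by (auto simp: incseq_def intro!: mono)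
  moreover have "\<And>n. ?v (int n) \<le> \<beta>" using orbit_in_arc by (auto intro: less_imp_le)
  ultimately obtain L where L: "(\<lambda>n. ?v (int n)) \<longlonglongrightarrow> L" "\<And>n. ?v (int n) \<le> L"
    using incseq_convergent by blast
  have "L = \<alpha> \<or> L = \<beta>"
  proof (rule orbit_limit_is_end[OF L(1)])
    show "(\<lambda>n. ?v (int n + 1)) \<longlonglongrightarrow> L" using LIMSEQ_Suc[OF L(1)] by (simp add: add.commute)
    show "\<alpha> \<le> L" using L(2)[of 0] x by simp
    show "L \<le> \<beta>" using L(1) orbit_in_arc by (intro LIMSEQ_le_const2[OF L(1)]) (auto intro: less_imp_le)
  qed
  then show "(\<lambda>n. ?v (int n)) \<longlonglongrightarrow> \<beta>" using L L(2)[of 0] x by auto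
  have "decseq (\<lambda>n. ?v (- int n))" by (auto simp: decseq_def intro!: mono)
  moreover have "\<And>n. \<alpha> \<le> ?v (- int n)" using orbit_in_arc by (auto intro: less_imp_le)
  ultimately obtain L where L: "(\<lambda>n. ?v (- int n)) \<longlonglongrightarrow> L" "\<And>n. L \<le> ?v (- int n)"
    using decseq_convergent by blast
  have "L = \<alpha> \<or> L = \<beta>"
  proof (rule orbit_limit_is_end[where u = "\<lambda>n. - int (Suc n)"])
    show "(\<lambda>n. ?v (- int (Suc n))) \<longlonglongrightarrow> L" by (rule LIMSEQ_Suc[OF L(1)])
    show "(\<lambda>n. ?v (- int (Suc n) + 1)) \<longlonglongrightarrow> L" using L(1) by simp
    show "L \<le> \<beta>" using L(2)[of 0] x by simp
    show "\<alpha> \<le> L" using orbit_in_arc by (intro LIMSEQ_le_const[OF L(1)]) (auto intro: less_imp_le)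
  qed
  then show "(\<lambda>n. ?v (- int n)) \<longlonglongrightarrow> \<alpha>" using L L(2)[of 0] x by auto
qed

end

lemma orbit_monotone:
  assumes x: "x \<in> topspace X" "\<alpha> < h x" "h x < \<beta>"
  obtains (increasing) "strict_mono (\<lambda>k. h (iter k x))"
      "(\<lambda>n. h (iter (int n) x)) \<longlonglongrightarrow> \<beta>" "(\<lambda>n. h (iter (- int n) x)) \<longlonglongrightarrow> \<alpha>"
  | (decreasing) "strict_mono (\<lambda>k. - h (iter k x))"
      "(\<lambda>n. h (iter (int n) x)) \<longlonglongrightarrow> \<alpha>" "(\<lambda>n. h (iter (- int n) x)) \<longlonglongrightarrow> \<beta>"
proof -
  have "h (T x) \<noteq> h x"
    using no_fixed[OF x] \<pi>_h[OF x] \<pi>_h[OF T_in[OF x(1)]] invariant[OF x(1)] x by metis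
  then consider "h x < h (T x)" | "h (T x) < h x" by linarith
  then show thesis
  proof cases
    case 1
    then show thesis using orbit_increasing[OF x] increasing by blast
  next
    case 2
    interpret r: monotone_arc X T "\<lambda>z. - h z" "\<lambda>y. \<pi> (- y)" "- \<beta>" "- \<alpha>" by (rule reflect)
    have "strict_mono (\<lambda>k. - h (iter k x))" "(\<lambda>n. - h (iter (int n) x)) \<longlonglongrightarrow> - \<alpha>"
       "(\<lambda>n. - h (iter (- int n) x)) \<longlonglongrightarrow> - \<beta>"
      using r.orbit_increasing[of x] x 2 by auto
    then show thesis using decreasing by (simp add: tendsto_minus_cancel_left)
  qed
qed

lemma orbit_limits:
  assumes x: "x \<in> topspace X" "\<alpha> < h x" "h x < \<beta>"
  shows "limitin X (\<lambda>n. iter (int n) x) (\<pi> \<beta>) sequentially \<and> limitin X (\<lambda>n. iter (- int n) x) (\<pi> \<alpha>) sequentially \<or>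
    limitin X (\<lambda>n. iter (int n) x) (\<pi> \<alpha>) sequentially \<and> limitin X (\<lambda>n. iter (- int n) x) (\<pi> \<beta>) sequentially"
proof -
  have ab: "\<alpha> \<le> \<beta>" using x by simp
  from x show ?thesis
    by (cases rule: orbit_monotone) (use orbit_limitin[OF x] ab in auto)
qed

end

section \<open>The circle and the interval\<close>

lemma frac_diff:
  assumes "x \<in> {0..<1}" "y \<in> {0..<1}"
  shows "frac (x - y) = (if y \<le> x then x - y else x - y + (1 :: real))"
proof (cases "y \<le> x")
  case True
  then show ?thesis using assms by (simp add: frac_eq)
next
  case False
  have "frac (x - y) = x - y + 1"
    unfolding frac_unique_iff using False assms by auto
  then show ?thesis using False by simp
qed

lemma frac_frac_diff: "frac (frac w - p) = frac (w - (p :: real))"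
  using floor_diff_of_int[of "w - p" "\<lfloor>w\<rfloor>"] by (simp add: frac_def algebra_simps)

lemma frac_frac_add: "frac (frac w + p) = frac (w + (p :: real))"
  using frac_frac_diff[of w "- p"] by simp

lemma open_frac_vimage:
  assumes "open B" "B \<subseteq> {0<..<1 :: real}"
  shows "open (frac -` B)"
proof -
  have "frac -` B = (\<Union>n :: int. (\<lambda>w. w - of_int n) -` B)"
  proof (intro equalityI subsetI)
    fix w assume "w \<in> frac -` B"
    then show "w \<in> (\<Union>n :: int. (\<lambda>w. w - of_int n) -` B)" by (auto simp: frac_def)
  next
    fix w assume "w \<in> (\<Union>n :: int. (\<lambda>w. w - of_int n) -` B)"
    then obtain n :: int where n: "w - of_int n \<in> B" by blast
    then have "frac w = w - of_int n" using assms(2) by (auto simp: frac_unique_iff)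
    then show "w \<in> frac -` B" using n by simp
  qed
  moreover have "open ((\<lambda>w :: real. w - of_int n) -` B)" for n
    by (intro open_vimage assms continuous_intros)
  ultimately show ?thesis by auto
qed

lemma circle_not_interval: "circle \<noteq> unit_interval"
proof
  assume "circle = unit_interval"
  then have "topspace circle = topspace unit_interval" by simp
  moreover have "(1 :: real) \<in> {0..1}" "(1 :: real) \<notin> {0..<1}" by auto
  ultimately show False by simp
qed

lemma continuous_map_frac: "continuous_map euclideanreal circle frac"
  by (rule quotient_imp_continuous_map[OF quotient_map_frac])

lemma continuous_map_circleI:
  "continuous_on UNIV (\<lambda>w. g (frac w)) \<Longrightarrow> continuous_map circle euclidean g"
  by (rule continuous_compose_quotient_map[OF quotient_map_frac]) (simp add: comp_def)

text \<open>
  A continuous function that vanishes only at \<open>a\<close>; on the circle, half of the squared chord length.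
\<close>

definition separating :: "real topology \<Rightarrow> real \<Rightarrow> real \<Rightarrow> real" where
  "separating M a z = (if M = circle then 1 - cos (2 * pi * (z - a)) else (z - a)\<^sup>2)"

lemma continuous_separating:
  assumes "M = circle \<or> M = unit_interval"
  shows "continuous_map M euclideanreal (separating M a)"
proof (cases "M = circle")
  case True
  have "cos (2 * pi * (frac w - a)) = cos (2 * pi * (w - a))" for w
  proof -
    have "2 * pi * (frac w - a) = 2 * pi * (w - a) - 2 * pi * of_int \<lfloor>w\<rfloor>"
      by (simp add: frac_def algebra_simps)
    then show ?thesis by (simp only: cos_diff cos_int_2pin sin_int_2pin mult_1_right mult_zero_right add_0_right)
  qed
  then show ?thesis
    unfolding True by (intro continuous_map_circleI) (auto simp: separating_def intro!: continuous_intros)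
next
  case False
  then show ?thesis
    using assms by (auto simp: separating_def unit_interval_def intro!: continuous_intros)
qed

lemma separating_nonneg: "separating M a z \<ge> 0"
  by (simp add: separating_def)

lemma separating_eq_0_iff:
  assumes M: "M = circle \<or> M = unit_interval" and "z \<in> topspace M" "a \<in> topspace M"
  shows "separating M a z = 0 \<longleftrightarrow> z = a"
proof (cases "M = circle")
  case True
  have "z = a" if "cos (2 * pi * (z - a)) = 1"
  proof -
    obtain n :: int where "2 * pi * (z - a) = of_int n * 2 * pi"
      using \<open>cos (2 * pi * (z - a)) = 1\<close> cos_one_2pi_int by blast
    then have n: "z - a = of_int n" by simp
    then have "\<bar>real_of_int n\<bar> < 1" using assms True by auto
    then have "n = 0" by linarith
    then show ?thesis using n by simp
  qed
  then show ?thesis using True by (auto simp: separating_def)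
qed (auto simp: separating_def)

lemma Hausdorff_circle_interval:
  assumes M: "M = circle \<or> M = unit_interval"
  shows "Hausdorff_space M"
  unfolding Hausdorff_space_def
proof (intro allI impI)
  fix x y assume xy: "x \<in> topspace M \<and> y \<in> topspace M \<and> x \<noteq> y"
  let ?d = "separating M x"
  have pos: "?d y > 0"
    using separating_nonneg[of M x y] separating_eq_0_iff[OF M, of y x] xy by (auto simp: less_le)
  have op: "openin M {z \<in> topspace M. ?d z \<in> B}" if "open B" for B
    using openin_continuous_map_preimage[OF continuous_separating[OF M], of B] that by simp
  show "\<exists>U V. openin M U \<and> openin M V \<and> x \<in> U \<and> y \<in> V \<and> disjnt U V"
  proof (intro exI conjI)
    show "openin M {z \<in> topspace M. ?d z \<in> {..<?d y / 2}}" "openin M {z \<in> topspace M. ?d z \<in> {?d y / 2<..}}"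
      by (rule op; simp)+
    show "x \<in> {z \<in> topspace M. ?d z \<in> {..<?d y / 2}}"
      using xy pos separating_eq_0_iff[OF M, of x x] by auto
    show "y \<in> {z \<in> topspace M. ?d z \<in> {?d y / 2<..}}" using xy pos by auto
    show "disjnt {z \<in> topspace M. ?d z \<in> {..<?d y / 2}} {z \<in> topspace M. ?d z \<in> {?d y / 2<..}}"
      by (auto simp: disjnt_def)
  qed
qed

lemma compact_circle_interval:
  assumes M: "M = circle \<or> M = unit_interval"
  shows "compact_space M"
proof (cases "M = circle")
  case True
  have "compactin euclideanreal {0..1}" by simp
  from image_compactin[OF this continuous_map_frac]
  have "compactin circle (frac ` {0..1})" .
  moreover have "frac ` {0..1} = {0..<1 :: real}"
  proof (intro equalityI subsetI)
    fix z :: real assume "z \<in> {0..<1}"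
    then have "z = frac z" "z \<in> {0..1}" by (auto simp: frac_eq)
    then show "z \<in> frac ` {0..1}" by blast
  qed (auto simp: frac_lt_1)
  ultimately show ?thesis by (simp add: True compact_space_def)
next
  case False
  then show ?thesis
    using M by (simp add: unit_interval_def compact_space_subtopology)
qed

lemma continuous_map_bounded:
  assumes M: "M = circle \<or> M = unit_interval" and \<phi>: "continuous_map M euclideanreal \<phi>"
  shows "\<exists>B. \<forall>z\<in>topspace M. \<bar>\<phi> z\<bar> \<le> B"
proof -
  have "compactin euclideanreal (\<phi> ` topspace M)"
    using image_compactin[OF _ \<phi>] compact_circle_interval[OF M] by (simp add: compact_space_def)
  then have "bounded (\<phi> ` topspace M)" by (simp add: compact_imp_bounded)
  then show ?thesis by (auto simp: bounded_iff)
qed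

text \<open>
  On the circle, the position relative to \<open>p\<close> in the positive direction; it jumps only at \<open>p\<close>.
\<close>

definition chart :: "real topology \<Rightarrow> real \<Rightarrow> real \<Rightarrow> real" where
  "chart M p z = (if M = circle then frac (z - p) else z)"

definition unchart :: "real topology \<Rightarrow> real \<Rightarrow> real \<Rightarrow> real" where
  "unchart M p y = (if M = circle then frac (y + p) else y)"

lemma chart_circle:
  "p \<in> {0..<1} \<Longrightarrow> z \<in> {0..<1} \<Longrightarrow> chart circle p z = (if p \<le> z then z - p else z - p + 1)"
  using frac_diff[of z p] by (simp add: chart_def)

lemma unchart_chart:
  assumes "M = circle \<or> M = unit_interval" "z \<in> topspace M"
  shows "unchart M p (chart M p z) = z"
  using assms circle_not_interval by (auto simp: unchart_def chart_def frac_frac_add frac_eq)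

lemma chart_unchart: "(M = circle \<Longrightarrow> 0 \<le> y \<and> y < 1) \<Longrightarrow> chart M p (unchart M p y) = y"
  by (auto simp: unchart_def chart_def frac_frac_diff frac_eq)

lemma chart_inj:
  assumes "M = circle \<or> M = unit_interval" "z \<in> topspace M" "w \<in> topspace M" "chart M p z = chart M p w"
  shows "z = w"
  using assms unchart_chart by metis

lemma chart_base_le:
  assumes "M = circle" "z \<in> topspace M"
  shows "chart M p p \<le> chart M p z"
  using assms by (simp add: chart_def)

lemma chart_interior_iff:
  assumes M: "M = circle" and S: "p \<in> topspace M" "z \<in> topspace M"
  shows "0 < chart M p z \<and> chart M p z < 1 \<longleftrightarrow> z \<noteq> p"
proof -
  have "0 \<le> chart M p z" "chart M p z < 1" by (simp_all add: chart_def M frac_lt_1)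
  moreover have "chart M p z = 0 \<longleftrightarrow> z = p"
    using chart_inj[of M z p p] S by (auto simp: chart_def M)
  ultimately show ?thesis by auto
qed

lemma open_arc_chart:
  assumes M: "M = circle \<or> M = unit_interval" and "p \<in> topspace M" "a \<in> topspace M" "b \<in> topspace M"
    and "chart M p a < chart M p b"
  shows "open_arc M a b = {z \<in> topspace M. chart M p a < chart M p z \<and> chart M p z < chart M p b}"
proof (cases "M = circle")
  case True
  have "z \<in> open_arc circle a b \<longleftrightarrow> chart circle p a < chart circle p z \<and> chart circle p z < chart circle p b"
    if "z \<in> {0..<1}" for z
    using assms that unfolding True open_arc_def
    by (simp add: chart_circle split: if_splits; linarith)
  moreover have "open_arc circle a b \<subseteq> {0..<1}"
    using assms unfolding True by (auto simp: open_arc_def)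
  ultimately show ?thesis unfolding True topspace_circle by blast
next
  case False
  then show ?thesis using assms by (auto simp: open_arc_def chart_def)
qed

lemma chart_endpoints_less:
  assumes M: "M = circle \<or> M = unit_interval" and "p \<in> topspace M" "q \<in> topspace M" "p \<noteq> q" "p < q \<or> M = circle"
  shows "chart M p p < chart M p q"
proof (cases "M = circle")
  case True
  then show ?thesis
    using assms chart_base_le[OF True, of q p] chart_inj[OF M, of p q p] by fastforce
qed (use assms in \<open>auto simp: chart_def\<close>)

lemma continuous_unchart:
  assumes M: "M = circle \<or> M = unit_interval" and "M = unit_interval \<Longrightarrow> A \<subseteq> {0..1}"
  shows "continuous_map (top_of_set A) M (unchart M p)"
proof (cases "M = circle")
  case True
  have "continuous_map (top_of_set A) euclideanreal (\<lambda>y. y + p)"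
    by (auto intro!: continuous_intros)
  from continuous_map_compose[OF this continuous_map_frac]
  show ?thesis using True by (simp add: unchart_def[abs_def] comp_def)
next
  case False
  then show ?thesis
    using assms by (auto simp: unchart_def[abs_def] unit_interval_def continuous_map_in_subtopology)
qed

section \<open>Morse--Smale homeomorphisms of period one\<close>

locale morse_smale =
  fixes M :: "real topology" and T :: "real \<Rightarrow> real"
  assumes space_cases: "M = circle \<or> M = unit_interval"
    and period_one: "morse_smale_period_one M T"
begin

sublocale homeo M T
  by standard (use period_one in \<open>simp only: morse_smale_period_one_def\<close>)

lemma T_inj: "x \<in> topspace M \<Longrightarrow> y \<in> topspace M \<Longrightarrow> T x = T y \<Longrightarrow> x = y"
  by (metis T_inv_T)

lemma periodic_fixed: "x \<in> periodic_points M T \<Longrightarrow> T x = x"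
  using period_one unfolding morse_smale_period_one_def by blast

lemma fixed_points_eq: "fixed_points M T = periodic_points M T"
proof (intro equalityI subsetI)
  fix x assume "x \<in> fixed_points M T"
  then show "x \<in> periodic_points M T"
    by (auto simp: fixed_points_def periodic_points_def intro!: exI[of _ 1])
next
  fix x assume "x \<in> periodic_points M T"
  then show "x \<in> fixed_points M T"
    using periodic_fixed by (auto simp: fixed_points_def periodic_points_def)
qed

lemma sink_or_source: "a \<in> fixed_points M T \<Longrightarrow> sink M T a \<or> source M T a"
  using period_one unfolding morse_smale_period_one_def fixed_points_eq by blast

lemma fixed_points_nonempty: "fixed_points M T \<noteq> {}"
  using period_one unfolding fixed_points_eq morse_smale_period_one_def by blast

lemma square_fixed: "x \<in> topspace M \<Longrightarrow> T (T x) = x \<Longrightarrow> T x = x"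
proof (rule periodic_fixed)
  assume "x \<in> topspace M" "T (T x) = x"
  then show "x \<in> periodic_points M T"
    by (auto simp: periodic_points_def numeral_2_eq_2 intro!: exI[of _ 2])
qed

lemma finite_fixed: "finite (fixed_points M T)"
  by (intro finite_fixed_points Hausdorff_circle_interval compact_circle_interval space_cases sink_or_source)

text \<open>
  Cut at the fixed point \<open>p\<close>, the circle becomes an interval that \<open>T\<close> maps to itself continuously and
  injectively.
\<close>

lemma circle_chart_monotone:
  assumes M: "M = circle" and p: "p \<in> fixed_points M T"
  defines "g \<equiv> \<lambda>y. chart M p (T (unchart M p y))"
  shows "strict_mono_on {0<..<1} g \<or> strict_antimono_on {0<..<1} g"
    and "g ` {0<..<1} \<subseteq> {0<..<1}"
proof -
  have pS: "p \<in> topspace M" "T p = p" using p by (auto simp: fixed_points_def)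
  have u: "unchart M p y \<in> topspace M" for y
    by (simp add: M unchart_def frac_lt_1)
  have cu: "chart M p (unchart M p y) = y" if "y \<in> {0<..<1}" for y
    using that by (intro chart_unchart) auto
  have chart01: "chart M p z \<in> {0<..<1} \<longleftrightarrow> z \<noteq> p" if "z \<in> topspace M" for z
    using chart_interior_iff[OF M pS(1) that] by simp
  have ne: "unchart M p y \<noteq> p" if "y \<in> {0<..<1}" for y
    using chart01[OF u[of y]] that unfolding cu[OF that] by simp
  show im: "g ` {0<..<1} \<subseteq> {0<..<1}"
  proof
    fix w assume "w \<in> g ` {0<..<1}"
    then obtain y where y: "y \<in> {0<..<1}" "w = g y" by blast
    have "T (unchart M p y) \<noteq> p"
      using T_inj[OF u pS(1)] ne[OF y(1)] pS(2) by metis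
    then show "w \<in> {0<..<1}" using chart01[OF T_in[OF u]] y by (simp add: g_def)
  qed
  have inj: "inj_on g {0<..<1}"
  proof (rule inj_onI)
    fix y w assume yw: "y \<in> {0<..<1}" "w \<in> {0<..<1}" "g y = g w"
    then have "T (unchart M p y) = T (unchart M p w)"
      unfolding g_def using chart_inj[OF space_cases T_in[OF u] T_in[OF u]] by blast
    then have "unchart M p y = unchart M p w" using T_inj[OF u u] by blast
    then show "y = w" using cu yw by metis
  qed
  have cont: "continuous_on {0<..<1} g"
    unfolding continuous_on_open_invariant
  proof (intro allI impI)
    fix B :: "real set" assume "open B"
    define B' where "B' = B \<inter> {0<..<1}"
    have "open (frac -` B')" unfolding B'_def using \<open>open B\<close> by (intro open_frac_vimage) auto
    then have "open ((\<lambda>w. w - p) -` (frac -` B'))" by (rule open_vimage) (auto intro!: continuous_intros)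
    moreover have "frac -` {z \<in> {0..<1}. frac (z - p) \<in> B'} = (\<lambda>w. w - p) -` (frac -` B')"
      by (auto simp: frac_frac_diff frac_lt_1)
    ultimately have "openin M {z \<in> topspace M. chart M p z \<in> B'}"
      by (auto simp: M openin_circle chart_def)
    then have op: "openin M {z \<in> topspace M. T z \<in> {z \<in> topspace M. chart M p z \<in> B'}}"
      by (rule openin_continuous_map_preimage[OF continuous_T])
    have "continuous_map euclideanreal M (unchart M p)"
      using continuous_unchart[OF space_cases, of UNIV p] M circle_not_interval by auto
    from openin_continuous_map_preimage[OF this op]
    have "open {y. unchart M p y \<in> {z \<in> topspace M. T z \<in> {z \<in> topspace M. chart M p z \<in> B'}}}"
      by simp
    moreover have "{y. unchart M p y \<in> {z \<in> topspace M. T z \<in> {z \<in> topspace M. chart M p z \<in> B'}}} \<inter> {0<..<1} = g -` B \<inter> {0<..<1}"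
      using u T_in[OF u] im by (auto simp: g_def B'_def image_subset_iff)
    ultimately show "\<exists>A. open A \<and> A \<inter> {0<..<1} = g -` B \<inter> {0<..<1}" by blast
  qed
  show "strict_mono_on {0<..<1} g \<or> strict_antimono_on {0<..<1} g"
    using injective_eq_monotone_map[OF _ cont] inj by simp
qed

lemma interval_monotone:
  assumes M: "M = unit_interval"
  shows "strict_mono_on {0..1} T \<or> strict_antimono_on {0..1} T"
proof -
  have "continuous_on {0..1} T"
    using continuous_T by (simp add: M unit_interval_def continuous_map_in_subtopology)
  moreover have "inj_on T {0..1}"
    using T_inj by (auto simp: inj_on_def M)
  ultimately show ?thesis
    using injective_eq_monotone_map[of "{0..1}" T] by simp
qed

text \<open>
  Whether \<open>T\<close> preserves or reverses the order of the chart, its square preserves it.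
\<close>

lemma square_chart_monotone:
  assumes p: "p \<in> fixed_points M T" and zw: "z \<in> topspace M" "w \<in> topspace M" "chart M p z < chart M p w"
  shows "chart M p (T (T z)) < chart M p (T (T w))"
proof (cases "M = circle")
  case M: True
  let ?g = "\<lambda>y. chart M p (T (unchart M p y))"
  have pS: "p \<in> topspace M" "T p = p" using p by (auto simp: fixed_points_def)
  have pos: "chart M p x > 0" if "x \<in> topspace M" "x \<noteq> p" for x
    using chart_interior_iff[OF M pS(1) that(1)] that(2) by simp
  have lt1: "chart M p x < 1" for x by (simp add: chart_def M frac_lt_1)
  have p0: "chart M p p = 0" by (simp add: chart_def M)
  have Tne: "T x \<noteq> p" if "x \<in> topspace M" "x \<noteq> p" for x
    using T_inj[OF that(1) pS(1)] pS(2) that(2) by auto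
  have g: "chart M p (T x) = ?g (chart M p x)" if "x \<in> topspace M" for x
    using unchart_chart[OF space_cases that] by simp
  have "0 \<le> chart M p z" by (simp add: chart_def M)
  then have "w \<noteq> p" using zw(3) p0 by auto
  show ?thesis
  proof (cases "z = p")
    case True
    then show ?thesis using pos[of "T (T w)"] p0 pS Tne T_in zw(2) \<open>w \<noteq> p\<close> by simp
  next
    case False
    have z01: "chart M p z \<in> {0<..<1}" "chart M p (T z) \<in> {0<..<1}"
      using pos zw(1) False Tne T_in lt1 by auto
    have w01: "chart M p w \<in> {0<..<1}" "chart M p (T w) \<in> {0<..<1}"
      using pos zw(2) \<open>w \<noteq> p\<close> Tne T_in lt1 by auto
    show ?thesis
      using circle_chart_monotone(1)[OF M p] z01 w01 zw(3)
      unfolding g[OF T_in[OF zw(1)]] g[OF T_in[OF zw(2)]] g[OF zw(1)] g[OF zw(2)]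
      by (elim disjE) (simp_all add: monotone_on_def)
  qed
next
  case False
  then have M: "M = unit_interval" using space_cases by simp
  have "z \<in> {0..1}" "w \<in> {0..1}" "T z \<in> {0..1}" "T w \<in> {0..1}" "z < w"
    using zw T_in[OF zw(1)] T_in[OF zw(2)] False by (auto simp: M chart_def)
  then show ?thesis
    using interval_monotone[OF M] False by (elim disjE) (simp_all add: monotone_on_def chart_def)
qed

text \<open>
  \<open>T \<circ> T\<close> is an increasing bijection of \<open>[0,1]\<close>, so it fixes both end points, which are therefore
  periodic points of \<open>T\<close>.
\<close>

lemma interval_ends_fixed:
  assumes M: "M = unit_interval"
  shows "T 0 = 0" "T 1 = 1"
proof -
  obtain p where p: "p \<in> fixed_points M T" using fixed_points_nonempty by blast
  have mono: "T (T z) < T (T w)" if "z \<in> topspace M" "w \<in> topspace M" "z < w" for z w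
    using square_chart_monotone[OF p that(1,2)] that(3) circle_not_interval by (simp add: chart_def M)
  have onto: "\<exists>w \<in> topspace M. T (T w) = y" if "y \<in> topspace M" for y
    using T_T_inv T_inv_in that by (intro bexI[of _ "T_inv (T_inv y)"]) auto
  have ends: "0 \<in> topspace M" "1 \<in> topspace M" and S: "\<And>z. z \<in> topspace M \<longleftrightarrow> 0 \<le> z \<and> z \<le> 1"
    by (auto simp: M)
  obtain w where w: "w \<in> topspace M" "T (T w) = 0" using onto[OF ends(1)] by blast
  have "w = 0"
  proof (rule ccontr)
    assume "w \<noteq> 0"
    then have "T (T 0) < T (T w)" using w(1) by (intro mono ends) (auto simp: S less_le)
    then show False using S[of "T (T 0)"] T_in ends w(2) by simp
  qed
  then show "T 0 = 0" using w square_fixed by simp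
  obtain v where v: "v \<in> topspace M" "T (T v) = 1" using onto[OF ends(2)] by blast
  have "v = 1"
  proof (rule ccontr)
    assume "v \<noteq> 1"
    then have "T (T v) < T (T 1)" using v(1) by (intro mono ends) (auto simp: S less_le)
    then show False using S[of "T (T 1)"] T_in ends v(2) by simp
  qed
  then show "T 1 = 1" using v square_fixed by simp
qed

text \<open>
  On the circle, the chart conjugates \<open>T\<close> to a lift of \<open>T\<close> that is normalized to fix \<open>0\<close>. On the interval,
  \<open>T\<close> cannot be decreasing, because it fixes both end points.
\<close>

lemma chart_monotone:
  assumes p: "p \<in> fixed_points M T" and zw: "z \<in> topspace M" "w \<in> topspace M" "chart M p z < chart M p w"
    and orient: "M = circle \<Longrightarrow> circle_orientation_preserving T"
  shows "chart M p (T z) < chart M p (T w)"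
proof (cases "M = circle")
  case M: True
  obtain G where G: "strict_mono G" "\<And>x. G (x + 1) = G x + 1" "\<And>x. T (frac x) = frac (G x)"
    using orient[OF M] by (auto simp: circle_orientation_preserving_def)
  have pS: "p \<in> {0..<1}" "T p = p" using p by (auto simp: fixed_points_def M)
  have Gp: "frac (G p) = p" using G(3)[of p] pS by (simp add: frac_eq[THEN iffD2])
  have "chart M p (T x) = G (chart M p x + p) - G p" if x: "x \<in> topspace M" for x
  proof -
    let ?y = "chart M p x"
    have y: "0 \<le> ?y" "?y < 1" by (simp_all add: chart_def M frac_lt_1)
    have "x = frac (?y + p)" using unchart_chart[OF space_cases x, of p] by (simp add: unchart_def M)
    then have "T x = frac (G (?y + p))" using G(3) by metis
    then have "chart M p (T x) = frac (G (?y + p) - p)"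
      by (simp add: chart_def M frac_frac_diff)
    also have "G (?y + p) - p = G (?y + p) - G p + of_int \<lfloor>G p\<rfloor>"
      using Gp by (simp add: frac_def)
    also have "frac \<dots> = G (?y + p) - G p"
    proof -
      have "G p \<le> G (?y + p)" using y G(1) by (simp add: strict_mono_less_eq)
      moreover have "G (?y + p) < G (p + 1)" using y G(1) by (simp add: strict_mono_less)
      ultimately show ?thesis using G(2)[of p] by (subst frac_unique_iff) auto
    qed
    finally show ?thesis .
  qed
  then show ?thesis using zw G(1) by (simp add: strict_mono_less)
next
  case False
  then have M: "M = unit_interval" using space_cases by simp
  have "\<not> strict_antimono_on {0..1} T"
  proof
    assume "strict_antimono_on {0..1} T"
    then have "T 1 < T 0" by (rule monotone_onD) auto
    then show False using interval_ends_fixed[OF M] by simp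
  qed
  then have "strict_mono_on {0..1} T" using interval_monotone[OF M] by blast
  then show ?thesis using zw False by (auto simp: chart_def M monotone_on_def)
qed

lemma monotone_arcI:
  assumes pq: "p \<in> fixed_points M T" "q \<in> fixed_points M T" "chart M p p < chart M p q"
    and noR: "\<And>z. z \<in> topspace M \<Longrightarrow> chart M p p < chart M p z \<Longrightarrow> chart M p z < chart M p q \<Longrightarrow> R z \<noteq> z"
    and R: "homeo M R" "R p = p" "R q = q"
    and mono: "\<And>z w. z \<in> topspace M \<Longrightarrow> w \<in> topspace M \<Longrightarrow> chart M p z < chart M p w \<Longrightarrow> chart M p (R z) < chart M p (R w)"
  shows "monotone_arc M R (chart M p) (unchart M p) (chart M p p) (chart M p q)"
proof -
  interpret R: homeo M R by (rule R(1))
  have S: "p \<in> topspace M" "q \<in> topspace M" using pq by (auto simp: fixed_points_def)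
  have iff: "chart M p z < chart M p w \<longleftrightarrow> chart M p (R z) < chart M p (R w)" if "z \<in> topspace M" "w \<in> topspace M" for z w
    using mono[OF that] mono[OF that(2,1)] chart_inj[OF space_cases that, of p]
    by (metis not_less_iff_gr_or_eq)
  show ?thesis
  proof
    show "Hausdorff_space M" by (rule Hausdorff_circle_interval[OF space_cases])
    show "continuous_map (top_of_set {chart M p p..chart M p q}) M (unchart M p)"
    proof (rule continuous_unchart[OF space_cases])
      assume M: "M = unit_interval"
      then show "{chart M p p..chart M p q} \<subseteq> {0..1}"
        using S circle_not_interval by (auto simp: chart_def)
    qed
    show "chart M p (unchart M p y) = y" if "chart M p p < y" "y < chart M p q" for y
    proof (rule chart_unchart)
      assume M: "M = circle"
      have "chart M p p \<ge> 0" "chart M p q < 1" by (simp_all add: chart_def M frac_lt_1)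
      then show "0 \<le> y \<and> y < 1" using that by simp
    qed
    show "unchart M p (chart M p z) = z" if "z \<in> topspace M" for z
      by (rule unchart_chart[OF space_cases that])
    show "chart M p p < chart M p z \<and> chart M p z < chart M p q \<longleftrightarrow>
        chart M p p < chart M p (R z) \<and> chart M p (R z) < chart M p q" if "z \<in> topspace M" for z
      using iff[OF S(1) that] iff[OF that S(2)] R by simp
  qed (use noR mono in auto)
qed

context
  fixes p q assumes consec: "consecutive_fixed_points M T p q"
begin

lemma consecutive_facts:
  "p \<in> fixed_points M T" "q \<in> fixed_points M T" "p \<in> topspace M" "q \<in> topspace M" "p \<noteq> q"
  "chart M p p < chart M p q"
  "open_arc M p q = {z \<in> topspace M. chart M p p < chart M p z \<and> chart M p z < chart M p q}"
  "\<And>z. z \<in> topspace M \<Longrightarrow> chart M p p < chart M p z \<Longrightarrow> chart M p z < chart M p q \<Longrightarrow> T z \<noteq> z"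
proof -
  show f: "p \<in> fixed_points M T" "q \<in> fixed_points M T" and ne: "p \<noteq> q"
    using consec by (auto simp: consecutive_fixed_points_def)
  then show S: "p \<in> topspace M" "q \<in> topspace M" by (auto simp: fixed_points_def)
  show lt: "chart M p p < chart M p q"
    using consec by (intro chart_endpoints_less[OF space_cases S ne]) (simp add: consecutive_fixed_points_def)
  show arc: "open_arc M p q = {z \<in> topspace M. chart M p p < chart M p z \<and> chart M p z < chart M p q}"
    by (rule open_arc_chart[OF space_cases S(1) S lt])
  show "T z \<noteq> z" if "z \<in> topspace M" "chart M p p < chart M p z" "chart M p z < chart M p q" for z
  proof
    assume "T z = z"
    then have "z \<in> open_arc M p q \<inter> fixed_points M T" using that arc by (simp add: fixed_points_def)
    then show False using consec unfolding consecutive_fixed_points_def by blast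
  qed
qed

lemma square_monotone_arc: "monotone_arc M (T \<circ> T) (chart M p) (unchart M p) (chart M p p) (chart M p q)"
proof (rule monotone_arcI)
  show "(T \<circ> T) z \<noteq> z" if "z \<in> topspace M" "chart M p p < chart M p z" "chart M p z < chart M p q" for z
    using square_fixed[OF that(1)] consecutive_facts(8)[OF that] by auto
qed (use consecutive_facts homeo_square square_chart_monotone in \<open>auto simp: fixed_points_def\<close>)

text \<open>
  The square of \<open>T\<close> is increasing on the arc and has no further fixed points there. The odd iterates
  of \<open>T\<close> follow the even ones, because \<open>T\<close> fixes both ends.
\<close>

theorem orbit_ends:
  assumes x: "x \<in> open_arc M p q"
  obtains a b where "{a, b} = {p, q}"
    "limitin M (\<lambda>n. iter (int n) x) a sequentially" "limitin M (\<lambda>n. iter (- int n) x) b sequentially"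
proof -
  interpret R: monotone_arc M "T \<circ> T" "chart M p" "unchart M p" "chart M p p" "chart M p q"
    by (rule square_monotone_arc)
  have xx: "x \<in> topspace M" "chart M p p < chart M p x" "chart M p x < chart M p q"
    using x consecutive_facts(7) by auto
  have ends: "unchart M p (chart M p p) = p" "unchart M p (chart M p q) = q"
    using unchart_chart[OF space_cases] consecutive_facts by auto
  have fx: "T p = p" "T q = q" using consecutive_facts by (auto simp: fixed_points_def)
  from R.orbit_limits[OF xx] show thesis
    unfolding ends
    using limits_of_square[OF xx(1) fx] limits_of_square[OF xx(1) fx(2,1)] that[of p q] that[of q p]
    by blast
qed

end

text \<open>
  If \<open>p\<close> were the only fixed point, then on the circle cut at \<open>p\<close> every other orbit of \<open>T \<circ> T\<close> would
  be homoclinic to \<open>p\<close>, which a sink or source does not admit.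
\<close>

lemma at_least_two_fixed_points:
  assumes M: "M = circle" and p: "p \<in> fixed_points M T"
  shows "\<exists>q \<in> fixed_points M T. q \<noteq> p"
proof (rule ccontr)
  assume "\<not> ?thesis"
  then have only: "\<And>z. z \<in> fixed_points M T \<Longrightarrow> z = p" by blast
  have pS: "p \<in> topspace M" "T p = p" using p by (auto simp: fixed_points_def)
  note chart01 = chart_interior_iff[OF M pS(1)]
  have haus: "Hausdorff_space M" by (rule Hausdorff_circle_interval[OF space_cases])
  interpret R: monotone_arc M "T \<circ> T" "chart M p" "unchart M p" 0 1
  proof -
    interpret sq: homeo M "T \<circ> T" by (rule homeo_square)
    show "monotone_arc M (T \<circ> T) (chart M p) (unchart M p) 0 1"
    proof
      show "Hausdorff_space M" by (rule haus)
      show "continuous_map (top_of_set {0..1}) M (unchart M p)"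
        by (rule continuous_unchart[OF space_cases]) simp
      show "chart M p (unchart M p y) = y" if "0 < y" "y < 1" for y
        using that by (intro chart_unchart) simp
      show "unchart M p (chart M p z) = z" if "z \<in> topspace M" for z
        by (rule unchart_chart[OF space_cases that])
      show "0 < chart M p z \<and> chart M p z < 1 \<longleftrightarrow> 0 < chart M p ((T \<circ> T) z) \<and> chart M p ((T \<circ> T) z) < 1"
        if "z \<in> topspace M" for z
      proof -
        have "(T \<circ> T) z = p \<longleftrightarrow> z = p"
          using T_inj[OF T_in[OF that] pS(1)] T_inj[OF that pS(1)] pS(2) by auto
        then show ?thesis
          using chart01[OF that] chart01[OF sq.T_in[OF that]] by simp
      qed
      show "chart M p ((T \<circ> T) z) < chart M p ((T \<circ> T) w)"
        if "z \<in> topspace M" "w \<in> topspace M" "chart M p z < chart M p w" for z w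
        using square_chart_monotone[OF p that] by simp
      show "(T \<circ> T) z \<noteq> z" if "z \<in> topspace M" "0 < chart M p z" "chart M p z < 1" for z
      proof
        assume "(T \<circ> T) z = z"
        then have "T z = z" using square_fixed[OF that(1)] by simp
        then have "z = p" using only that(1) by (simp add: fixed_points_def)
        then show False using chart01[OF that(1)] that by simp
      qed
    qed
  qed
  define x where "x = unchart M p (1 / 2)"
  have x: "x \<in> topspace M" by (simp add: x_def unchart_def M frac_lt_1)
  have cx: "chart M p x = 1 / 2" unfolding x_def by (rule chart_unchart) simp
  have "x \<noteq> p" using chart01[OF x] cx by simp
  have ends: "unchart M p 0 = p" "unchart M p 1 = p"
    using pS(1) by (auto simp: unchart_def M frac_unique_iff)
  have "limitin M (\<lambda>n. int_iter M (T \<circ> T) (int n) x) p sequentially"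
    "limitin M (\<lambda>n. int_iter M (T \<circ> T) (- int n) x) p sequentially"
    using R.orbit_limits[OF x] cx unfolding ends by auto
  then show False
    using not_homoclinic[OF haus sink_or_source[OF p] x \<open>x \<noteq> p\<close>] limits_of_square[OF x pS(2) pS(2)] by blast
qed

lemma in_arc_of_consecutive:
  assumes x: "x \<in> topspace M" "x \<notin> fixed_points M T"
  shows "\<exists>p q. consecutive_fixed_points M T p q \<and> x \<in> open_arc M p q"
proof (cases "M = circle")
  case M: True
  let ?F = "fixed_points M T"
  let ?s = "chart M x"
  have FS: "?F \<subseteq> {0..<1}" by (auto simp: fixed_points_def M)
  have x01: "x \<in> {0..<1}" using x by (simp add: M)
  have fin: "finite (?s ` ?F)" "?s ` ?F \<noteq> {}" using finite_fixed fixed_points_nonempty by auto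
  \<comment> \<open>seen from \<open>x\<close>, the next fixed point ahead and the next one behind\<close>
  obtain q where q: "q \<in> ?F" "?s q = Min (?s ` ?F)" using Min_in[OF fin] by auto
  obtain p where p: "p \<in> ?F" "?s p = Max (?s ` ?F)" using Max_in[OF fin] by auto
  have between: "?s q \<le> ?s z" "?s z \<le> ?s p" if "z \<in> ?F" for z
    using that p q fin by auto
  have "p \<noteq> q"
  proof
    assume "p = q"
    obtain z where z: "z \<in> ?F" "z \<noteq> p" using at_least_two_fixed_points[OF M p(1)] by blast
    then have "?s z = ?s p" using between[OF z(1)] \<open>p = q\<close> by simp
    then have "z = p"
      using chart_inj[OF space_cases, of z p x] z(1) p(1) by (simp add: fixed_points_def)
    then show False using z by simp
  qed
  have p01: "p \<in> {0..<1}" and q01: "q \<in> {0..<1}" using p q FS by auto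
  have "?s q \<noteq> ?s p"
    using chart_inj[OF space_cases, of q p x] p01 q01 \<open>p \<noteq> q\<close> by (auto simp: M)
  then have qp: "?s q < ?s p" using between[OF p(1)] by simp
  have x0: "x \<noteq> p" "x \<noteq> q" using x(2) p q by auto
  have less: "chart M p p < chart M p q"
    by (rule chart_endpoints_less[OF space_cases]) (use p01 q01 \<open>p \<noteq> q\<close> M in auto)
  have arc: "open_arc M p q = {z \<in> topspace M. chart M p p < chart M p z \<and> chart M p z < chart M p q}"
    by (rule open_arc_chart[OF space_cases]) (use p01 q01 less M in auto)
  have "x \<in> open_arc M p q"
    using x01 p01 q01 x0 qp less unfolding arc unfolding M topspace_circle
    by (simp add: chart_circle split: if_splits; linarith)
  moreover have "z \<notin> open_arc M p q" if z: "z \<in> ?F" for z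
  proof -
    have "z \<in> {0..<1}" using z FS by auto
    moreover have "z \<noteq> x" using z x by auto
    ultimately show ?thesis
      using between[OF z] x01 p01 q01 x0 qp unfolding arc unfolding M topspace_circle
      by (simp add: chart_circle split: if_splits; linarith)
  qed
  ultimately show ?thesis
    using p q \<open>p \<noteq> q\<close> M unfolding consecutive_fixed_points_def by blast
next
  case False
  then have M: "M = unit_interval" using space_cases by simp
  let ?F = "fixed_points M T"
  have ends: "0 \<in> ?F" "1 \<in> ?F"
    using interval_ends_fixed[OF M] by (auto simp: fixed_points_def M)
  have x01: "0 < x" "x < 1"
    using x ends by (auto simp: M less_le)
  define p where "p = Max (?F \<inter> {..<x})"
  define q where "q = Min (?F \<inter> {x<..})"
  have fin: "finite (?F \<inter> {..<x})" "finite (?F \<inter> {x<..})" using finite_fixed by auto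
  have ne: "?F \<inter> {..<x} \<noteq> {}" "?F \<inter> {x<..} \<noteq> {}" using ends x01 by auto
  have p: "p \<in> ?F" "p < x" using Max_in[OF fin(1) ne(1)] by (auto simp: p_def)
  have q: "q \<in> ?F" "x < q" using Min_in[OF fin(2) ne(2)] by (auto simp: q_def)
  have "z \<notin> ?F" if "p < z" "z < q" for z
  proof
    assume z: "z \<in> ?F"
    consider "z < x" | "z = x" | "x < z" by linarith
    then show False
    proof cases
      case 1
      then have "z \<le> p" unfolding p_def using z fin by (intro Max_ge) auto
      then show False using that by simp
    next
      case 3
      then have "q \<le> z" unfolding q_def using z fin by (intro Min_le) auto
      then show False using that by simp
    qed (use x z in simp)
  qed
  then show ?thesis
    using p q x False by (intro exI[of _ p] exI[of _ q]) (auto simp: consecutive_fixed_points_def open_arc_def)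
qed

text \<open>
  In the chart based at \<open>p\<close>, the iterates \<open>T\<^sup>k x\<close> depend monotonically on \<open>k\<close> and the two subarcs are an initial
  and a final piece of the arc.
\<close>

lemma orbit_threshold:
  assumes orient: "M = circle \<Longrightarrow> circle_orientation_preserving T"
    and consec: "consecutive_fixed_points M T p q" and x: "x \<in> open_arc M p q"
    and \<gamma>: "\<gamma> \<in> open_arc M p q" and J: "J \<in> {closed_arc M p \<gamma>, closed_arc M \<gamma> q}"
  shows "(\<exists>c. \<forall>k. iter k x \<in> J \<longleftrightarrow> k < c) \<or> (\<exists>c. \<forall>k. iter k x \<in> J \<longleftrightarrow> k > c)"
proof -
  let ?h = "chart M p"
  note facts = consecutive_facts[OF consec]
  interpret A: monotone_arc M T "chart M p" "unchart M p" "chart M p p" "chart M p q"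
  proof (rule monotone_arcI)
    show "T p = p" "T q = q" using facts(1,2) by (simp_all add: fixed_points_def)
    show "chart M p (T z) < chart M p (T w)"
      if "z \<in> topspace M" "w \<in> topspace M" "chart M p z < chart M p w" for z w
      using chart_monotone[OF facts(1) that orient] .
  qed (fact facts homeo_axioms)+
  have xx: "x \<in> topspace M" "?h p < ?h x" "?h x < ?h q"
    using x unfolding facts(7) by simp_all
  have gg: "\<gamma> \<in> topspace M" "?h p < ?h \<gamma>" "?h \<gamma> < ?h q"
    using \<gamma> unfolding facts(7) by simp_all
  let ?v = "\<lambda>k. ?h (iter k x)"
  have v: "iter k x \<in> topspace M" "?h p < ?v k" "?v k < ?h q" for k
    by (rule iter_in[OF xx(1)] A.orbit_in_arc[OF xx])+
  have eq: "iter k x = \<gamma> \<longleftrightarrow> ?v k = ?h \<gamma>" for k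
    using chart_inj[OF space_cases v(1) gg(1)] by blast
  have ne: "iter k x \<noteq> p" "iter k x \<noteq> q" for k
    using v(2,3)[of k] by (metis less_irrefl)+
  have left: "iter k x \<in> closed_arc M p \<gamma> \<longleftrightarrow> ?v k \<le> ?h \<gamma>" for k
    unfolding closed_arc_def open_arc_chart[OF space_cases facts(3) facts(3) gg(1,2)]
      insert_iff mem_Collect_eq eq le_less
    using ne(1)[of k] v(1,2)[of k] by blast
  have right: "iter k x \<in> closed_arc M \<gamma> q \<longleftrightarrow> ?h \<gamma> \<le> ?v k" for k
    unfolding closed_arc_def open_arc_chart[OF space_cases facts(3) gg(1) facts(4) gg(3)]
      insert_iff mem_Collect_eq eq le_less eq_commute[of "?h \<gamma>"]
    using ne(2)[of k] v(1,3)[of k] by blast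
  have cross: "(\<exists>k. ?v k < ?h \<gamma>) \<and> (\<exists>k. ?h \<gamma> < ?v k)"
    if "(\<lambda>n. ?v (u n)) \<longlonglongrightarrow> ?h p" "(\<lambda>n. ?v (w n)) \<longlonglongrightarrow> ?h q" for u w :: "nat \<Rightarrow> int"
    using eventually_happens'[OF sequentially_bot order_tendstoD(2)[OF that(1) gg(2)]]
      eventually_happens'[OF sequentially_bot order_tendstoD(1)[OF that(2) gg(3)]] by blast
  have "(\<exists>k. ?v k < ?h \<gamma>) \<and> (\<exists>k. ?h \<gamma> < ?v k) \<and>
      ((\<forall>j k. j \<le> k \<longrightarrow> ?v j \<le> ?v k) \<or> (\<forall>j k. j \<le> k \<longrightarrow> ?v k \<le> ?v j))"
    using xx
  proof (cases rule: A.orbit_monotone)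
    case increasing
    have "?v j \<le> ?v k" if "j \<le> k" for j k
      by (rule strict_mono_leD[OF increasing(1) that])
    then show ?thesis using cross[OF increasing(3,2)] by blast
  next
    case decreasing
    have "?v k \<le> ?v j" if "j \<le> k" for j k
      using strict_mono_leD[OF decreasing(1) that] by simp
    then show ?thesis using cross[OF decreasing(2,3)] by blast
  qed
  then obtain a b where a: "?v a < ?h \<gamma>" and b: "?h \<gamma> < ?v b"
    and mono: "(\<forall>j k. j \<le> k \<longrightarrow> ?v j \<le> ?v k) \<or> (\<forall>j k. j \<le> k \<longrightarrow> ?v k \<le> ?v j)"
    by blast
  have J_iff: "(\<forall>k. iter k x \<in> J \<longleftrightarrow> ?v k \<le> ?h \<gamma>) \<or> (\<forall>k. iter k x \<in> J \<longleftrightarrow> ?h \<gamma> \<le> ?v k)"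
    using J left right by auto
  have "\<exists>a b. iter a x \<in> J \<and> iter b x \<notin> J"
    using J_iff a b by (metis less_imp_le not_le)
  then obtain a' b' where ab': "iter a' x \<in> J" "iter b' x \<notin> J" by blast
  have "(\<forall>j k. j \<le> k \<longrightarrow> iter k x \<in> J \<longrightarrow> iter j x \<in> J) \<or> (\<forall>j k. j \<le> k \<longrightarrow> iter j x \<in> J \<longrightarrow> iter k x \<in> J)"
    using J_iff mono by (elim disjE) (meson order_trans)+
  then show ?thesis
  proof
    assume "\<forall>j k. j \<le> k \<longrightarrow> iter k x \<in> J \<longrightarrow> iter j x \<in> J"
    then show ?thesis using int_threshold[of "\<lambda>k. iter k x \<in> J" a' b'] ab' by blast
  next
    assume "\<forall>j k. j \<le> k \<longrightarrow> iter j x \<in> J \<longrightarrow> iter k x \<in> J"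
    then obtain c where c: "\<forall>k. iter k x \<notin> J \<longleftrightarrow> k < c"
      using int_threshold[of "\<lambda>k. iter k x \<notin> J" b' a'] ab' by blast
    have "iter k x \<in> J \<longleftrightarrow> k > c - 1" for k
      using c[rule_format, of k] by linarith
    then show ?thesis by blast
  qed
qed

end

section \<open>Empirical measures and the weak* topology\<close>

lemma openin_sets_borel_of: "openin X U \<Longrightarrow> U \<in> sets (borel_of X)"
  unfolding borel_of_def
  by (subst sets_measure_of) (auto dest: openin_subset)

lemma borel_measurable_continuous_map:
  assumes "continuous_map X euclideanreal \<phi>"
  shows "\<phi> \<in> borel_measurable (borel_of X)"
proof (rule borel_measurableI)
  fix B :: "real set" assume "open B"
  have "\<phi> -` B \<inter> space (borel_of X) = {x \<in> topspace X. \<phi> x \<in> B}" by auto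
  then show "\<phi> -` B \<inter> space (borel_of X) \<in> sets (borel_of X)"
    using openin_continuous_map_preimage[OF assms, of B] \<open>open B\<close>
    by (simp add: openin_sets_borel_of)
qed

lemma dirac_sum_distr:
  assumes I: "finite I" and y: "\<And>i. i \<in> I \<Longrightarrow> y i \<in> topspace X"
  shows "dirac_sum X I c y = distr (point_measure I (\<lambda>i. ennreal (c i))) (borel_of X) y"
proof (rule measure_eqI)
  fix A assume "A \<in> sets (dirac_sum X I c y)"
  then have A: "A \<in> sets (borel_of X)" by simp
  have m: "y \<in> measurable (point_measure I (\<lambda>i. ennreal (c i))) (borel_of X)"
    using y by (simp add: point_measure_def measurable_count_space_eq1)
  have "emeasure (distr (point_measure I (\<lambda>i. ennreal (c i))) (borel_of X) y) A =
      (\<Sum>i\<in>y -` A \<inter> I. ennreal (c i))"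
    using I by (subst emeasure_distr[OF m A]) (simp add: emeasure_point_measure_finite space_point_measure)
  also have "\<dots> = (\<Sum>i\<in>I. ennreal (c i) * indicator A (y i))"
    using I by (intro sum.mono_neutral_cong_left) (auto simp: indicator_def)
  finally show "emeasure (dirac_sum X I c y) A = emeasure (distr (point_measure I (\<lambda>i. ennreal (c i))) (borel_of X) y) A"
    using A by (simp add: emeasure_dirac_sum)
qed simp

lemma integral_dirac_sum:
  assumes I: "finite I" and y: "\<And>i. i \<in> I \<Longrightarrow> y i \<in> topspace X" and c: "\<And>i. i \<in> I \<Longrightarrow> c i \<ge> 0"
    and \<phi>: "continuous_map X euclideanreal \<phi>"
  shows "(\<integral>x. \<phi> x \<partial>dirac_sum X I c y) = (\<Sum>i\<in>I. c i * \<phi> (y i))"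
proof -
  have m: "y \<in> measurable (point_measure I (\<lambda>i. ennreal (c i))) (borel_of X)"
    using y by (simp add: point_measure_def measurable_count_space_eq1)
  have "dirac_sum X I c y = distr (point_measure I (\<lambda>i. ennreal (c i))) (borel_of X) y"
    by (rule dirac_sum_distr[OF I y])
  then show ?thesis
    by (simp only:) (subst integral_distr[OF m borel_measurable_continuous_map[OF \<phi>]],
        simp add: lebesgue_integral_point_measure_finite[OF I c])
qed

lemma prob_space_dirac_sum:
  assumes I: "finite I" and y: "\<And>i. i \<in> I \<Longrightarrow> y i \<in> topspace X" and c: "\<And>i. i \<in> I \<Longrightarrow> c i \<ge> 0"
    and total: "(\<Sum>i\<in>I. c i) = 1"
  shows "prob_space (dirac_sum X I c y)"
proof
  have sp: "space (dirac_sum X I c y) = topspace X"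
    using sets_eq_imp_space_eq[OF sets_dirac_sum] by simp
  have top: "topspace X \<in> sets (borel_of X)" by (rule openin_sets_borel_of[OF openin_topspace])
  have "emeasure (dirac_sum X I c y) (topspace X) = (\<Sum>i\<in>I. ennreal (c i))"
    unfolding emeasure_dirac_sum[OF top] using y top by (intro sum.cong) auto
  also have "\<dots> = ennreal (\<Sum>i\<in>I. c i)" using c by (rule sum_ennreal)
  finally show "emeasure (dirac_sum X I c y) (space (dirac_sum X I c y)) = 1"
    by (simp add: sp total)
qed

lemma topspace_weak_star: "topspace (weak_star X) = {\<mu>. prob_space \<mu> \<and> sets \<mu> = sets (borel_of X)}"
  unfolding weak_star_def topspace_pullback_topology by auto

text \<open>
  The filter \<open>F\<close> plays the role of a subsequence.
\<close>

lemma accumulation_point_weak_starI: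
  assumes \<mu>: "prob_space \<mu>" "sets \<mu> = sets (borel_of X)"
    and s: "\<forall>\<^sub>F n in F. prob_space (s n) \<and> sets (s n) = sets (borel_of X)"
    and F: "F \<noteq> bot" "F \<le> sequentially"
    and lim: "\<And>\<phi>. continuous_map X euclideanreal \<phi> \<Longrightarrow> ((\<lambda>n. \<integral>x. \<phi> x \<partial>s n) \<longlongrightarrow> (\<integral>x. \<phi> x \<partial>\<mu>)) F"
  shows "\<mu> \<in> accumulation_points (weak_star X) s"
  unfolding accumulation_points_def
proof (intro CollectI conjI allI impI)
  let ?\<Phi> = "{\<phi>. continuous_map X euclideanreal \<phi>}"
  let ?ev = "\<lambda>\<mu>. \<lambda>\<phi>\<in>?\<Phi>. \<integral>x. \<phi> x \<partial>\<mu>"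
  show "\<mu> \<in> topspace (weak_star X)" using \<mu> by (simp add: topspace_weak_star)
  fix U assume U: "openin (weak_star X) U \<and> \<mu> \<in> U"
  then obtain W where W: "openin (product_topology (\<lambda>_. euclideanreal) ?\<Phi>) W"
    "U = ?ev -` W \<inter> {\<mu>. prob_space \<mu> \<and> sets \<mu> = sets (borel_of X)}"
    unfolding weak_star_def openin_pullback_topology by blast
  have "limitin (product_topology (\<lambda>_. euclideanreal) ?\<Phi>) (\<lambda>n. ?ev (s n)) (?ev \<mu>) F"
    unfolding limitin_componentwise using lim by simp
  then have "\<forall>\<^sub>F n in F. ?ev (s n) \<in> W"
    using W U unfolding limitin_def by blast
  then have ev: "\<forall>\<^sub>F n in F. s n \<in> U"
    using s by eventually_elim (simp add: W(2))
  show "\<exists>\<^sub>F n in sequentially. s n \<in> U"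
  proof (rule ccontr)
    assume "\<not> (\<exists>\<^sub>F n in sequentially. s n \<in> U)"
    then have "\<forall>\<^sub>F n in F. s n \<notin> U" using F(2) by (auto simp: not_frequently intro: filter_leD)
    then have "\<forall>\<^sub>F n in F. False" using ev by eventually_elim simp
    then show False using F(1) by (simp add: eventually_False)
  qed
qed

lemma accumulation_point_weak_starD:
  assumes \<mu>: "\<mu> \<in> accumulation_points (weak_star X) s"
    and \<phi>: "continuous_map X euclideanreal \<phi>" "continuous_map X euclideanreal \<psi>" and e: "e > 0"
  shows "\<exists>\<^sub>F n in sequentially. \<bar>(\<integral>x. \<phi> x \<partial>s n) - (\<integral>x. \<phi> x \<partial>\<mu>)\<bar> < e \<and> \<bar>(\<integral>x. \<psi> x \<partial>s n) - (\<integral>x. \<psi> x \<partial>\<mu>)\<bar> < e"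
proof -
  let ?\<Phi> = "{\<phi>. continuous_map X euclideanreal \<phi>}"
  let ?P = "product_topology (\<lambda>_. euclideanreal) ?\<Phi>"
  let ?ev = "\<lambda>\<mu>. \<lambda>\<phi>\<in>?\<Phi>. \<integral>x. \<phi> x \<partial>\<mu>"
  define W where "W = {v \<in> topspace ?P. v \<phi> \<in> ball (\<integral>x. \<phi> x \<partial>\<mu>) e} \<inter> {v \<in> topspace ?P. v \<psi> \<in> ball (\<integral>x. \<psi> x \<partial>\<mu>) e}"
  have W: "openin ?P W"
    unfolding W_def using \<phi>
    by (intro openin_Int openin_continuous_map_preimage[where Y = euclideanreal] continuous_map_product_projection) auto
  define U where "U = ?ev -` W \<inter> {\<mu>. prob_space \<mu> \<and> sets \<mu> = sets (borel_of X)}"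
  have "openin (weak_star X) U"
    unfolding weak_star_def openin_pullback_topology U_def using W by blast
  moreover have "\<mu> \<in> U"
    using \<mu> e \<phi> by (auto simp: accumulation_points_def topspace_weak_star U_def W_def)
  ultimately have "\<exists>\<^sub>F n in sequentially. s n \<in> U"
    using \<mu> by (simp add: accumulation_points_def)
  then show ?thesis
    by (rule frequently_elim1) (use \<phi> in \<open>auto simp: U_def W_def dist_real_def abs_minus_commute\<close>)
qed

section \<open>Time averages along an oscillating orbit\<close>

text \<open>
  The random orbit for one fixed path \<open>s\<close> of the walk.
\<close>

locale oscillating_orbit = morse_smale +
  fixes s :: "nat \<Rightarrow> int" and x a b :: real
  assumes oscillating: "oscillating s"
    and x: "x \<in> topspace M"
    and forward: "limitin M (\<lambda>n. iter (int n) x) a sequentially"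
    and backward: "limitin M (\<lambda>n. iter (- int n) x) b sequentially"
    and distinct: "a \<noteq> b"
begin

abbreviation V :: "nat \<Rightarrow> real" where "V \<equiv> freq (\<lambda>j. s j > 0)"

lemma ab: "a \<in> topspace M" "b \<in> topspace M"
  using forward backward by (auto simp: limitin_def)

text \<open>
  Outside the times with \<open>\<bar>s j\<bar> \<le> K\<close>, which have density zero, the orbit is as close as desired to the
  end that corresponds to the sign of \<open>s j\<close>.
\<close>

lemma time_average:
  assumes \<phi>: "continuous_map M euclideanreal \<phi>"
  shows "(\<lambda>n. (\<Sum>j<n. \<phi> (iter (s j) x)) / real n - (\<phi> a * V n + \<phi> b * (1 - V n))) \<longlonglongrightarrow> 0"
proof -
  let ?A = "\<lambda>n. (\<Sum>j<n. \<phi> (iter (s j) x)) / real n - (\<phi> a * V n + \<phi> b * (1 - V n))"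
  obtain B where B: "\<And>z. z \<in> topspace M \<Longrightarrow> \<bar>\<phi> z\<bar> \<le> B"
    using continuous_map_bounded[OF space_cases \<phi>] by blast
  have B0: "B \<ge> 0" using B[OF x] by simp
  have fw: "(\<lambda>n. \<phi> (iter (int n) x)) \<longlonglongrightarrow> \<phi> a"
    using continuous_map_limit[OF \<phi> forward] by (simp add: comp_def)
  have bw: "(\<lambda>n. \<phi> (iter (- int n) x)) \<longlonglongrightarrow> \<phi> b"
    using continuous_map_limit[OF \<phi> backward] by (simp add: comp_def)
  show ?thesis
  proof (rule LIMSEQ_I)
    fix e :: real assume e: "e > 0"
    obtain K1 where K1: "\<And>n. n \<ge> K1 \<Longrightarrow> \<bar>\<phi> (iter (int n) x) - \<phi> a\<bar> < e / 2"
      using LIMSEQ_D[OF fw, of "e / 2"] e by auto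
    obtain K2 where K2: "\<And>n. n \<ge> K2 \<Longrightarrow> \<bar>\<phi> (iter (- int n) x) - \<phi> b\<bar> < e / 2"
      using LIMSEQ_D[OF bw, of "e / 2"] e by auto
    define K where "K = int (K1 + K2)"
    let ?w = "\<lambda>j. of_bool (s j > 0) :: real"
    have point: "\<bar>\<phi> (iter (s j) x) - (\<phi> a * ?w j + \<phi> b * (1 - ?w j))\<bar> \<le> e / 2 + 2 * B * of_bool (\<bar>s j\<bar> \<le> K)" for j
    proof -
      consider "\<bar>s j\<bar> \<le> K" | "s j > K" | "s j < - K" by linarith
      then show ?thesis
      proof cases
        case 1
        have "\<bar>\<phi> (iter (s j) x)\<bar> \<le> B" "\<bar>\<phi> a\<bar> \<le> B" "\<bar>\<phi> b\<bar> \<le> B"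
          using B iter_in[OF x] ab by auto
        then show ?thesis using 1 e by (cases "s j > 0") auto
      next
        case 2
        then have "s j > 0" by (simp add: K_def)
        then obtain n where n: "s j = int n" using zero_less_imp_eq_int by blast
        then have "n \<ge> K1" using 2 by (simp add: K_def)
        then show ?thesis using K1[of n] 2 \<open>s j > 0\<close> by (simp add: n)
      next
        case 3
        then have "- s j > 0" by (simp add: K_def)
        then obtain n where "- s j = int n" using zero_less_imp_eq_int by blast
        then have n: "s j = - int n" by simp
        then have "n \<ge> K2" using 3 by (simp add: K_def)
        then show ?thesis using K2[of n] 3 \<open>- s j > 0\<close> by (simp add: n)
      qed
    qed
    have avg: "\<bar>?A n\<bar> \<le> e / 2 + 2 * B * freq (\<lambda>j. \<bar>s j\<bar> \<le> K) n"
      if n: "n > 0" for n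
    proof -
      have "?A n =
          (\<Sum>j<n. \<phi> (iter (s j) x) - (\<phi> a * ?w j + \<phi> b * (1 - ?w j))) / real n"
      proof -
        have collect: "(\<Sum>j<n. \<phi> a * ?w j + \<phi> b * (1 - ?w j)) = \<phi> a * (\<Sum>j<n. ?w j) + \<phi> b * (real n - (\<Sum>j<n. ?w j))"
          by (simp only: sum.distrib sum_distrib_left[symmetric] sum_subtractf) simp
        have gen: "A / m - (c * (S / m) + d * (1 - S / m)) = (A - (c * S + d * (m - S))) / m"
          if "m > 0" for A c d S m :: real
          using that by (simp add: field_simps)
        show ?thesis
          unfolding freq_def sum_subtractf collect by (rule gen) (use n in simp)
      qed
      also have "\<bar>\<dots>\<bar> \<le> (\<Sum>j<n. e / 2 + 2 * B * of_bool (\<bar>s j\<bar> \<le> K)) / real n"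
        using n by (simp only: abs_divide abs_of_nat)
          (intro divide_right_mono order_trans[OF sum_abs] sum_mono point, simp)
      also have "\<dots> = e / 2 + 2 * B * freq (\<lambda>j. \<bar>s j\<bar> \<le> K) n"
        using n by (simp add: sum.distrib freq_def add_divide_distrib sum_distrib_left[symmetric] del: sum_of_bool_eq)
      finally show ?thesis .
    qed
    have "(\<lambda>n. 2 * B * freq (\<lambda>j. \<bar>s j\<bar> \<le> K) n) \<longlonglongrightarrow> 2 * B * 0"
      using oscillating by (intro tendsto_mult_left) (simp add: oscillating_def)
    then have "\<forall>\<^sub>F n in sequentially. 2 * B * freq (\<lambda>j. \<bar>s j\<bar> \<le> K) n < e / 2"
      by (rule order_tendstoD(2)) (use e in simp)
    then obtain N where N: "\<And>n. n \<ge> N \<Longrightarrow> 2 * B * freq (\<lambda>j. \<bar>s j\<bar> \<le> K) n < e / 2"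
      unfolding eventually_sequentially by blast
    show "\<exists>no. \<forall>n\<ge>no. norm (?A n - 0) < e"
    proof (intro exI allI impI)
      fix n assume n: "N + 1 \<le> n"
      then show "norm (?A n - 0) < e"
        using avg[of n] N[of n] by (simp only: diff_zero real_norm_def) linarith
    qed
  qed
qed

text \<open>
  The test function that takes the value \<open>1\<close> at \<open>a\<close> and \<open>0\<close> at \<open>b\<close>: its time averages are \<open>V n + o(1)\<close>.
\<close>

definition \<phi>\<^sub>0 :: "real \<Rightarrow> real" where
  "\<phi>\<^sub>0 z = separating M b z / separating M b a"

lemma \<phi>\<^sub>0: "continuous_map M euclideanreal \<phi>\<^sub>0" "\<phi>\<^sub>0 a = 1" "\<phi>\<^sub>0 b = 0"
proof -
  have "separating M b a \<noteq> 0" "separating M b b = 0"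
    using separating_eq_0_iff[OF space_cases] ab distinct by auto
  then show "\<phi>\<^sub>0 a = 1" "\<phi>\<^sub>0 b = 0" by (auto simp: \<phi>\<^sub>0_def)
  show "continuous_map M euclideanreal \<phi>\<^sub>0"
    unfolding \<phi>\<^sub>0_def divide_inverse
    by (intro continuous_map_real_mult_right continuous_separating space_cases)
qed

lemma no_time_average: "\<not> convergent (\<lambda>n. (\<Sum>j<n. \<phi>\<^sub>0 (iter (s j) x)) / real n)"
proof
  let ?A = "\<lambda>n. (\<Sum>j<n. \<phi>\<^sub>0 (iter (s j) x)) / real n"
  assume "convergent ?A"
  then obtain L where "?A \<longlonglongrightarrow> L" by (auto simp: convergent_def)
  from tendsto_diff[OF this time_average[OF \<phi>\<^sub>0(1)]]
  have V: "V \<longlonglongrightarrow> L" by (simp add: \<phi>\<^sub>0)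
  have close: "\<bar>L - l\<bar> < 1 / 2" if "0 \<le> l" "l \<le> 1" for l
  proof -
    have "\<exists>\<^sub>F n in sequentially. \<bar>V n - l\<bar> < 1 / 4"
      by (rule oscillating_frequently_near[OF oscillating that]) simp
    moreover have "\<forall>\<^sub>F n in sequentially. \<bar>V n - L\<bar> < 1 / 4"
      using tendstoD[OF V, of "1 / 4"] by (simp add: dist_real_def)
    ultimately have "\<exists>\<^sub>F n in sequentially. \<bar>V n - l\<bar> < 1 / 4 \<and> \<bar>V n - L\<bar> < 1 / 4"
      by (rule frequently_rev_mp[OF _ eventually_mono]) auto
    then obtain n where "\<bar>V n - l\<bar> < 1 / 4 \<and> \<bar>V n - L\<bar> < 1 / 4"
      by (rule frequently_ex[elim_format]) blast
    then show ?thesis by linarith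
  qed
  show False using close[of 0] close[of 1] by linarith
qed

abbreviation empirical :: "nat \<Rightarrow> real measure" where
  "empirical n \<equiv> empirical_measure M (\<lambda>j. iter (s j) x) n"

lemma empirical_facts:
  assumes "n > 0"
  shows "prob_space (empirical n)" "sets (empirical n) = sets (borel_of M)"
    "continuous_map M euclideanreal \<phi> \<Longrightarrow> (\<integral>z. \<phi> z \<partial>empirical n) = (\<Sum>j<n. \<phi> (iter (s j) x)) / real n"
proof -
  show "prob_space (empirical n)"
    unfolding empirical_measure_def using assms iter_in[OF x] by (intro prob_space_dirac_sum) auto
  show "sets (empirical n) = sets (borel_of M)" by (simp add: empirical_measure_def)
  show "(\<integral>z. \<phi> z \<partial>empirical n) = (\<Sum>j<n. \<phi> (iter (s j) x)) / real n" if "continuous_map M euclideanreal \<phi>"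
    unfolding empirical_measure_def using iter_in[OF x] that
    by (subst integral_dirac_sum) (auto simp: sum_divide_distrib)
qed

lemma mix_facts:
  assumes "0 \<le> l" "l \<le> 1"
  shows "prob_space (dirac_mix M l a b)" "sets (dirac_mix M l a b) = sets (borel_of M)"
    "continuous_map M euclideanreal \<phi> \<Longrightarrow> (\<integral>z. \<phi> z \<partial>dirac_mix M l a b) = \<phi> a * l + \<phi> b * (1 - l)"
proof -
  show "prob_space (dirac_mix M l a b)"
    unfolding dirac_mix_def using assms ab by (intro prob_space_dirac_sum) (auto simp: UNIV_bool)
  show "sets (dirac_mix M l a b) = sets (borel_of M)" by (simp add: dirac_mix_def)
  show "(\<integral>z. \<phi> z \<partial>dirac_mix M l a b) = \<phi> a * l + \<phi> b * (1 - l)" if "continuous_map M euclideanreal \<phi>"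
    unfolding dirac_mix_def using assms ab that
    by (subst integral_dirac_sum) (auto simp: UNIV_bool mult.commute)
qed

lemma mixes_accumulate:
  assumes l: "0 \<le> l" "l \<le> 1"
  shows "dirac_mix M l a b \<in> accumulation_points (weak_star M) empirical"
proof (rule accumulation_point_weak_starI)
  \<comment> \<open>the coarsest way of letting \<open>n\<close> tend to infinity such that \<open>V n\<close> tends to \<open>l\<close>\<close>
  let ?F = "inf sequentially (filtercomap V (nhds l))"
  show "?F \<noteq> bot"
  proof
    assume "?F = bot"
    then have "eventually (\<lambda>_. False) ?F" by simp
    then obtain P Q where PQ: "eventually P sequentially" "eventually Q (filtercomap V (nhds l))" "\<And>n. \<not> (P n \<and> Q n)"
      unfolding eventually_inf by blast
    obtain R where R: "eventually R (nhds l)" "\<And>n. R (V n) \<Longrightarrow> Q n"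
      using PQ(2) unfolding eventually_filtercomap by blast
    obtain e where e: "e > 0" "\<And>y. dist y l < e \<Longrightarrow> R y"
      using R(1) unfolding eventually_nhds_metric by blast
    have "\<exists>\<^sub>F n in sequentially. \<bar>V n - l\<bar> < e"
      by (rule oscillating_frequently_near[OF oscillating l e(1)])
    then have "\<exists>\<^sub>F n in sequentially. \<bar>V n - l\<bar> < e \<and> P n"
      using PQ(1) by (rule frequently_rev_mp[OF _ eventually_mono]) auto
    then obtain n where "\<bar>V n - l\<bar> < e" "P n"
      by (rule frequently_ex[elim_format]) blast
    then show False using PQ(3)[of n] R(2)[of n] e(2)[of "V n"] by (simp add: dist_real_def)
  qed
  show "?F \<le> sequentially" by simp
  show "\<forall>\<^sub>F n in ?F. prob_space (empirical n) \<and> sets (empirical n) = sets (borel_of M)"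
    by (rule filter_leD[OF inf_le1], rule eventually_mono[OF eventually_gt_at_top[of 0]])
       (use empirical_facts in blast)
  fix \<phi> assume \<phi>: "continuous_map M euclideanreal \<phi>"
  have V: "(V \<longlongrightarrow> l) ?F"
    by (rule filterlim_mono[OF filterlim_filtercomap order_refl inf_le2])
  have "((\<lambda>n. ((\<Sum>j<n. \<phi> (iter (s j) x)) / real n - (\<phi> a * V n + \<phi> b * (1 - V n))) + (\<phi> a * V n + \<phi> b * (1 - V n)))
      \<longlongrightarrow> 0 + (\<phi> a * l + \<phi> b * (1 - l))) ?F"
    by (intro tendsto_intros V filterlim_mono[OF time_average[OF \<phi>] order_refl inf_le1])
  then have "((\<lambda>n. (\<Sum>j<n. \<phi> (iter (s j) x)) / real n) \<longlongrightarrow> (\<integral>z. \<phi> z \<partial>dirac_mix M l a b)) ?F"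
    by (simp add: mix_facts(3)[OF l \<phi>])
  moreover have "\<forall>\<^sub>F n in ?F. (\<Sum>j<n. \<phi> (iter (s j) x)) / real n = (\<integral>z. \<phi> z \<partial>empirical n)"
    by (rule filter_leD[OF inf_le1], rule eventually_mono[OF eventually_gt_at_top[of 0]])
       (use empirical_facts(3)[OF _ \<phi>] in simp)
  ultimately show "((\<lambda>n. \<integral>z. \<phi> z \<partial>empirical n) \<longlongrightarrow> (\<integral>z. \<phi> z \<partial>dirac_mix M l a b)) ?F"
    by (rule Lim_transform_eventually)
qed (use mix_facts l in auto)

text \<open>
  The integrals of all continuous functions against \<open>\<mu>\<close> agree with those against a mixture, whose
  weight \<open>l\<close> is read off from \<open>\<phi>\<^sub>0\<close>. Testing with a nonnegative function that vanishes only at \<open>a\<close> and \<open>b\<close>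
  shows that \<open>\<mu>\<close> lives on these two points, where the indicator function of a measurable set is
  itself an affine function of \<open>\<phi>\<^sub>0\<close>.
\<close>

lemma accumulation_is_mix:
  assumes \<mu>: "\<mu> \<in> accumulation_points (weak_star M) empirical"
  shows "\<exists>l \<in> {0..1}. \<mu> = dirac_mix M l a b"
proof -
  have \<mu>': "prob_space \<mu>" and sets: "sets \<mu> = sets (borel_of M)"
    using \<mu> by (auto simp: accumulation_points_def topspace_weak_star)
  interpret \<mu>: prob_space \<mu> by (rule \<mu>')
  have space: "space \<mu> = topspace M" using sets_eq_imp_space_eq[OF sets] by simp
  define l where "l = (\<integral>z. \<phi>\<^sub>0 z \<partial>\<mu>)"
  have approx: "\<exists>n. \<bar>V n - l\<bar> < 2 * e \<and> \<bar>(\<phi> a * V n + \<phi> b * (1 - V n)) - (\<integral>z. \<phi> z \<partial>\<mu>)\<bar> < 2 * e"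
    if \<phi>: "continuous_map M euclideanreal \<phi>" and e: "e > 0" for \<phi> e
  proof -
    have "\<forall>\<^sub>F n in sequentially. \<bar>(\<Sum>j<n. \<phi> (iter (s j) x)) / real n - (\<phi> a * V n + \<phi> b * (1 - V n))\<bar> < e"
      using tendstoD[OF time_average[OF \<phi>] e] by (simp add: dist_real_def)
    moreover have "\<forall>\<^sub>F n in sequentially. \<bar>(\<Sum>j<n. \<phi>\<^sub>0 (iter (s j) x)) / real n - V n\<bar> < e"
      using tendstoD[OF time_average[OF \<phi>\<^sub>0(1)] e] by (simp add: dist_real_def \<phi>\<^sub>0)
    ultimately have "\<forall>\<^sub>F n in sequentially. \<bar>(\<integral>z. \<phi> z \<partial>empirical n) - (\<phi> a * V n + \<phi> b * (1 - V n))\<bar> < e \<and>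
        \<bar>(\<integral>z. \<phi>\<^sub>0 z \<partial>empirical n) - V n\<bar> < e"
      using eventually_gt_at_top[of 0]
      by eventually_elim (simp add: empirical_facts(3)[OF _ \<phi>] empirical_facts(3)[OF _ \<phi>\<^sub>0(1)])
    from frequently_eventually_conj[OF accumulation_point_weak_starD[OF \<mu> \<phi> \<phi>\<^sub>0(1) e] this]
    obtain n where "\<bar>(\<integral>z. \<phi> z \<partial>empirical n) - (\<integral>z. \<phi> z \<partial>\<mu>)\<bar> < e" "\<bar>(\<integral>z. \<phi>\<^sub>0 z \<partial>empirical n) - l\<bar> < e"
      "\<bar>(\<integral>z. \<phi> z \<partial>empirical n) - (\<phi> a * V n + \<phi> b * (1 - V n))\<bar> < e"
      "\<bar>(\<integral>z. \<phi>\<^sub>0 z \<partial>empirical n) - V n\<bar> < e"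
      unfolding l_def by (rule frequently_ex[elim_format]) blast
    then have "\<bar>V n - l\<bar> < 2 * e" "\<bar>(\<phi> a * V n + \<phi> b * (1 - V n)) - (\<integral>z. \<phi> z \<partial>\<mu>)\<bar> < 2 * e"
      by linarith+
    then show ?thesis by blast
  qed
  have l: "0 \<le> l" "l \<le> 1"
  proof -
    show "0 \<le> l"
    proof (rule ccontr)
      assume "\<not> 0 \<le> l"
      then obtain n where "\<bar>V n - l\<bar> < 2 * (- l / 2)" using approx[OF \<phi>\<^sub>0(1), of "- l / 2"] by auto
      then show False using freq_nonneg[of "\<lambda>j. s j > 0" n] by linarith
    qed
    show "l \<le> 1"
    proof (rule ccontr)
      assume "\<not> l \<le> 1"
      then obtain n where "\<bar>V n - l\<bar> < 2 * ((l - 1) / 2)" using approx[OF \<phi>\<^sub>0(1), of "(l - 1) / 2"] by auto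
      then show False using freq_le_1[of "\<lambda>j. s j > 0" n] by (simp add: abs_if split: if_splits)
    qed
  qed
  have int: "(\<integral>z. \<phi> z \<partial>\<mu>) = \<phi> a * l + \<phi> b * (1 - l)" if \<phi>: "continuous_map M euclideanreal \<phi>" for \<phi>
  proof (rule ccontr)
    let ?d = "\<bar>(\<integral>z. \<phi> z \<partial>\<mu>) - (\<phi> a * l + \<phi> b * (1 - l))\<bar>"
    assume "\<not> ?thesis"
    then have d: "?d > 0" by simp
    \<comment> \<open>small enough that errors of size \<open>2 e\<close> in \<open>V n\<close> and in the integral cannot add up to the defect\<close>
    define e where "e = ?d / (2 * (1 + \<bar>\<phi> a\<bar> + \<bar>\<phi> b\<bar>))"
    have pos: "1 + \<bar>\<phi> a\<bar> + \<bar>\<phi> b\<bar> > 0" by simp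
    then have e: "e > 0" using d by (simp add: e_def)
    have "d = 2 * (d / (2 * c)) * c" if "c > 0" for c d :: real using that by simp
    from this[OF pos] have de: "?d = 2 * e * (1 + \<bar>\<phi> a\<bar> + \<bar>\<phi> b\<bar>)" unfolding e_def .
    obtain n where n: "\<bar>V n - l\<bar> < 2 * e" "\<bar>(\<phi> a * V n + \<phi> b * (1 - V n)) - (\<integral>z. \<phi> z \<partial>\<mu>)\<bar> < 2 * e"
      using approx[OF \<phi> e] by blast
    have "(\<phi> a * V n + \<phi> b * (1 - V n)) - (\<phi> a * l + \<phi> b * (1 - l)) = (\<phi> a - \<phi> b) * (V n - l)"
      by (simp add: algebra_simps)
    then have "\<bar>(\<phi> a * V n + \<phi> b * (1 - V n)) - (\<phi> a * l + \<phi> b * (1 - l))\<bar> \<le> (\<bar>\<phi> a\<bar> + \<bar>\<phi> b\<bar>) * (2 * e)"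
      using n(1) by (simp only: abs_mult) (intro mult_mono abs_triangle_ineq4, auto)
    then have "?d < 2 * e + (\<bar>\<phi> a\<bar> + \<bar>\<phi> b\<bar>) * (2 * e)" using n(2) by linarith
    then show False using de by (simp add: algebra_simps)
  qed
  have meas: "\<phi> \<in> borel_measurable \<mu>" if "continuous_map M euclideanreal \<phi>" for \<phi>
    using borel_measurable_continuous_map[OF that] measurable_cong_sets[OF sets refl] by blast
  have integ: "integrable \<mu> \<phi>" if \<phi>: "continuous_map M euclideanreal \<phi>" for \<phi>
  proof -
    obtain B where B: "\<And>z. z \<in> topspace M \<Longrightarrow> \<bar>\<phi> z\<bar> \<le> B"
      using continuous_map_bounded[OF space_cases \<phi>] by blast
    show ?thesis
      by (rule \<mu>.integrable_const_bound[where B = B]) (use B meas[OF \<phi>] in \<open>auto simp: space\<close>)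
  qed
  have supp: "AE z in \<mu>. z = a \<or> z = b"
  proof -
    let ?D = "\<lambda>z. separating M a z * separating M b z"
    have D: "continuous_map M euclideanreal ?D"
      by (intro continuous_map_real_mult continuous_separating space_cases)
    have "separating M a a = 0" "separating M b b = 0"
      using separating_eq_0_iff[OF space_cases] ab by auto
    then have "(\<integral>z. ?D z \<partial>\<mu>) = 0" by (simp add: int[OF D])
    then have "AE z in \<mu>. ?D z = 0"
      using integral_nonneg_eq_0_iff_AE[OF integ[OF D]] by (simp add: separating_nonneg)
    then show ?thesis
    proof (rule AE_mp, intro AE_I2 impI)
      fix z assume "z \<in> space \<mu>" "?D z = 0"
      then show "z = a \<or> z = b" using separating_eq_0_iff[OF space_cases] ab by (auto simp: space)
    qed
  qed
  have "\<mu> = dirac_mix M l a b"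
  proof (rule measure_eqI)
    show "sets \<mu> = sets (dirac_mix M l a b)" using sets mix_facts(2)[OF l] by simp
    fix A assume "A \<in> sets \<mu>"
    then have A: "A \<in> sets \<mu>" "A \<in> sets (borel_of M)" using sets by auto
    have "measure \<mu> A = (\<integral>z. indicator A z \<partial>\<mu>)" using A by simp
    also have "\<dots> = (\<integral>z. indicator A a * \<phi>\<^sub>0 z + indicator A b * (1 - \<phi>\<^sub>0 z) \<partial>\<mu>)"
    proof (rule integral_cong_AE)
      show "AE z in \<mu>. indicator A z = indicator A a * \<phi>\<^sub>0 z + indicator A b * (1 - \<phi>\<^sub>0 z)"
        using supp by eventually_elim (auto simp: \<phi>\<^sub>0)
      show "(\<lambda>z. indicator A a * \<phi>\<^sub>0 z + indicator A b * (1 - \<phi>\<^sub>0 z)) \<in> borel_measurable \<mu>"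
        using meas[OF \<phi>\<^sub>0(1)] by measurable
    qed (use A in measurable)
    also have "\<dots> = indicator A a * l + indicator A b * (1 - l)"
      using integ[OF \<phi>\<^sub>0(1)] \<mu>.prob_space by (simp add: l_def)
    finally have "emeasure \<mu> A = ennreal (indicator A a * l + indicator A b * (1 - l))"
      by (simp add: \<mu>.emeasure_eq_measure)
    also have "\<dots> = emeasure (dirac_mix M l a b) A"
      unfolding emeasure_dirac_mix[OF A(2)] emeasure_return[OF A(2)] using l
      by (auto simp: indicator_def simp flip: ennreal_plus)
    finally show "emeasure \<mu> A = emeasure (dirac_mix M l a b) A" .
  qed
  then show ?thesis using l by auto
qed

theorem accumulation_points_empirical:
  "accumulation_points (weak_star M) empirical = {dirac_mix M l a b | l. l \<in> {0..1}}"
  using mixes_accumulate accumulation_is_mix by fastforce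

end

lemma dirac_mix_swap:
  assumes "l \<in> {0..1}"
  shows "dirac_mix X l a b = dirac_mix X (1 - l) b a"
proof (rule measure_eqI)
  fix A assume "A \<in> sets (dirac_mix X l a b)"
  then have "A \<in> sets (borel_of X)" by (simp add: dirac_mix_def)
  then show "emeasure (dirac_mix X l a b) A = emeasure (dirac_mix X (1 - l) b a) A"
    by (simp add: emeasure_dirac_mix add.commute)
qed (simp add: dirac_mix_def)

lemma dirac_mixes_swap:
  "{dirac_mix X l a b | l. l \<in> {0..1}} = {dirac_mix X l b a | l. l \<in> {0..1}}"
proof -
  have "{dirac_mix X l a b | l. l \<in> {0..1}} \<subseteq> {dirac_mix X l b a | l. l \<in> {0..1}}" for a b
  proof clarify
    fix l :: real assume l: "l \<in> {0..1}"
    show "\<exists>l'. dirac_mix X l a b = dirac_mix X l' b a \<and> l' \<in> {0..1}"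
      using dirac_mix_swap[OF l, of X a b] l by (intro exI[of _ "1 - l"]) simp
  qed
  then show ?thesis by (intro equalityI)
qed

section \<open>The arcsine law and historical behavior\<close>

lemma AE_leb_not_in_finite:
  assumes M: "M = circle \<or> M = unit_interval" and F: "finite F"
  shows "AE x in leb M. x \<in> topspace M \<and> x \<notin> F"
proof -
  have S: "topspace M \<in> sets lborel" using M by auto
  have "F \<in> null_sets lborel" using F by (simp add: finite_imp_null_set_lborel)
  then have "AE x in lborel. x \<notin> F" by (rule AE_not_in)
  then show ?thesis
    unfolding leb_def using S by (subst AE_restrict_space_iff) (auto elim: eventually_mono)
qed

lemma sigma_finite_leb:
  assumes M: "M = circle \<or> M = unit_interval"
  shows "sigma_finite_measure (leb M)"
proof -
  have "emeasure (leb M) (space (leb M)) \<noteq> \<infinity>"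
    using M by (auto simp: leb_def emeasure_restrict_space space_restrict_space)
  then have "finite_measure (leb M)" by (rule finite_measureI)
  then show ?thesis by (simp add: finite_measure_def)
qed

lemma AE_pair_measureI:
  assumes "sigma_finite_measure N" and P: "AE x in M. P x" and Q: "AE y in N. Q y"
  shows "AE (x, y) in M \<Otimes>\<^sub>M N. P x \<and> Q y"
proof -
  interpret sigma_finite_measure N by fact
  obtain A where A: "{x \<in> space M. \<not> P x} \<subseteq> A" "A \<in> sets M" "emeasure M A = 0"
    using AE_E[OF P] by blast
  obtain B where B: "{y \<in> space N. \<not> Q y} \<subseteq> B" "B \<in> sets N" "emeasure N B = 0"
    using AE_E[OF Q] by blast
  have "A \<times> space N \<in> null_sets (M \<Otimes>\<^sub>M N)" "space M \<times> B \<in> null_sets (M \<Otimes>\<^sub>M N)"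
    using A B by (auto simp: null_sets_def emeasure_pair_measure_Times)
  then have "A \<times> space N \<union> space M \<times> B \<in> null_sets (M \<Otimes>\<^sub>M N)" by (rule null_sets.Un)
  moreover have "{z \<in> space (M \<Otimes>\<^sub>M N). \<not> (case z of (x, y) \<Rightarrow> P x \<and> Q y)} \<subseteq> A \<times> space N \<union> space M \<times> B"
    using A(1) B(1) by (auto simp: space_pair_measure)
  ultimately show ?thesis by (rule AE_I'[rotated -1, rotated])
qed

theorem proposition4:
  fixes M :: "real topology" and T :: "real \<Rightarrow> real"
    and \<mu> :: "'a::countable pmf" and \<Psi> :: "'a \<Rightarrow> int"
  defines "\<P> \<equiv> path_measure \<mu>"
    and "f \<equiv> \<lambda>a. int_iter M T (\<Psi> a)"
  assumes "M = circle \<or> M = unit_interval"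
    and "morse_smale_period_one M T"
    and "set_pmf \<mu> = UNIV"
    and "integrable \<P> (\<lambda>\<omega>. (real_of_int (\<Psi> (\<omega> 0)))\<^sup>2)"
    and "(\<integral>\<omega>. real_of_int (\<Psi> (\<omega> 0)) \<partial>\<P>) = 0"
    and "(\<integral>\<omega>. (real_of_int (\<Psi> (\<omega> 0)))\<^sup>2 \<partial>\<P>) > 0"
  shows "((M = circle \<longrightarrow> circle_orientation_preserving T) \<longrightarrow>
           (AE x in leb M.
              (\<exists>p q. consecutive_fixed_points M T p q \<and> x \<in> open_arc M p q) \<and>
              (\<forall>p q. consecutive_fixed_points M T p q \<and> x \<in> open_arc M p q \<longrightarrow>
                (\<forall>\<gamma> \<in> open_arc M p q. \<forall>J \<in> {closed_arc M p \<gamma>, closed_arc M \<gamma> q}. \<forall>\<alpha> \<in> {0<..<1}.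
                  (\<lambda>n. measure \<P> {\<omega> \<in> space \<P>.
                         (\<Sum>j<n. indicat_real J (rand_iter f \<omega> j x)) / real n \<le> \<alpha>})
                    \<longlonglongrightarrow> 2 / pi * arcsin (sqrt \<alpha>)))))
       \<and> historical_behavior_ae \<P> M (skew_product f)
       \<and> (\<forall>p q. consecutive_fixed_points M T p q \<longrightarrow>
           (AE \<omega> in \<P>. \<forall>x \<in> open_arc M p q.
              limit_measures M f \<omega> x = {dirac_mix M l p q | l. l \<in> {0..1}}))"
proof -
  interpret W: integer_walk \<mu> \<Psi>
  proof
    show "integrable \<mu> (\<lambda>a. (real_of_int (\<Psi> a))\<^sup>2)"
      using assms(6) integral_path_coordinate(2)[of \<mu> "\<lambda>a. (real_of_int (\<Psi> a))\<^sup>2" 0]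
      unfolding \<P>_def by blast
    show "(\<integral>a. real_of_int (\<Psi> a) \<partial>\<mu>) = 0"
      using assms(7) integral_path_coordinate(1)[of \<mu> "\<lambda>a. real_of_int (\<Psi> a)" 0]
      unfolding \<P>_def by simp
    show "(\<integral>a. (real_of_int (\<Psi> a))\<^sup>2 \<partial>\<mu>) > 0"
      using assms(8) integral_path_coordinate(1)[of \<mu> "\<lambda>a. (real_of_int (\<Psi> a))\<^sup>2" 0]
      unfolding \<P>_def by simp
  qed
  interpret D: morse_smale M T by standard fact+
  have orbit: "rand_iter f \<omega> j x = D.iter (W.walk j \<omega>) x" if "x \<in> topspace M" for \<omega> j x
    unfolding f_def W.walk_def by (rule D.rand_iter_eq[OF that])
  have arc_sub: "x \<in> topspace M" if "consecutive_fixed_points M T p q" "x \<in> open_arc M p q" for p q x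
    using that(2) D.consecutive_facts(7)[OF that(1)] by blast
  have oscillating_orbit: "\<exists>a b. {a, b} = {p, q} \<and> oscillating_orbit M T (\<lambda>j. W.walk j \<omega>) x a b"
    if pq: "consecutive_fixed_points M T p q" and x: "x \<in> open_arc M p q"
      and \<omega>: "oscillating (\<lambda>j. W.walk j \<omega>)" for p q x \<omega>
  proof -
    obtain a b where ab: "{a, b} = {p, q}"
      "limitin M (\<lambda>n. D.iter (int n) x) a sequentially" "limitin M (\<lambda>n. D.iter (- int n) x) b sequentially"
      by (rule D.orbit_ends[OF pq x])
    have "a \<noteq> b" using ab(1) D.consecutive_facts(5)[OF pq] by (auto simp: doubleton_eq_iff)
    then have "oscillating_orbit M T (\<lambda>j. W.walk j \<omega>) x a b"
      using ab \<omega> arc_sub[OF pq x] by unfold_locales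
    then show ?thesis using ab(1) by blast
  qed
  have good_points: "AE x in leb M. x \<in> topspace M \<and> x \<notin> fixed_points M T"
    by (rule AE_leb_not_in_finite[OF assms(3) D.finite_fixed])
  have law: "(\<lambda>n. measure \<P> {\<omega> \<in> space \<P>. (\<Sum>j<n. indicat_real J (rand_iter f \<omega> j x)) / real n \<le> \<alpha>})
      \<longlonglongrightarrow> 2 / pi * arcsin (sqrt \<alpha>)"
    if orient: "M = circle \<longrightarrow> circle_orientation_preserving T"
      and pq: "consecutive_fixed_points M T p q" and x: "x \<in> open_arc M p q"
      and \<gamma>: "\<gamma> \<in> open_arc M p q" and J: "J \<in> {closed_arc M p \<gamma>, closed_arc M \<gamma> q}" and \<alpha>: "\<alpha> \<in> {0<..<1}"
    for p q x \<gamma> J \<alpha>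
  proof -
    have events: "{\<omega> \<in> space \<P>. (\<Sum>j<n. indicat_real J (rand_iter f \<omega> j x)) / real n \<le> \<alpha>} =
        {\<omega>. freq (\<lambda>j. Q (W.walk j \<omega>)) n \<le> \<alpha>}"
      if Q: "\<forall>k. D.iter k x \<in> J \<longleftrightarrow> Q k" for Q n
      unfolding freq_def orbit[OF arc_sub[OF pq x]] \<P>_def W.space_path indicator_def Q[rule_format] by simp
    from D.orbit_threshold[OF _ pq x \<gamma> J] orient
    consider c where "\<forall>k. D.iter k x \<in> J \<longleftrightarrow> k < c" | c where "\<forall>k. D.iter k x \<in> J \<longleftrightarrow> k > c"
      by blast
    then show ?thesis
    proof cases
      case 1
      show ?thesis unfolding events[OF 1] unfolding \<P>_def by (rule W.arcsine_below[OF \<alpha>])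
    next
      case 2
      show ?thesis unfolding events[OF 2] unfolding \<P>_def by (rule W.arcsine_above[OF \<alpha>])
    qed
  qed
  have "historical_behavior_ae \<P> M (skew_product f)"
    unfolding historical_behavior_ae_skew_product \<P>_def
    using AE_pair_measureI[OF sigma_finite_leb[OF assms(3)] W.AE_oscillating good_points]
  proof (rule eventually_mono, clarify)
    fix \<omega> x assume \<omega>: "oscillating (\<lambda>j. W.walk j \<omega>)" and x: "x \<in> topspace M" "x \<notin> fixed_points M T"
    obtain p q where pq: "consecutive_fixed_points M T p q" "x \<in> open_arc M p q"
      using D.in_arc_of_consecutive[OF x] by blast
    obtain a b where "oscillating_orbit M T (\<lambda>j. W.walk j \<omega>) x a b"
      using oscillating_orbit[OF pq \<omega>] by blast
    then interpret O: oscillating_orbit M T "\<lambda>j. W.walk j \<omega>" x a b .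
    show "\<exists>\<phi>. continuous_map M euclideanreal \<phi> \<and> \<not> convergent (\<lambda>n. (\<Sum>j<n. \<phi> (rand_iter f \<omega> j x)) / real n)"
      using O.\<phi>\<^sub>0(1) O.no_time_average unfolding orbit[OF x(1)] by blast
  qed
  moreover have "AE \<omega> in \<P>. \<forall>x \<in> open_arc M p q. limit_measures M f \<omega> x = {dirac_mix M l p q | l. l \<in> {0..1}}"
    if pq: "consecutive_fixed_points M T p q" for p q
    unfolding \<P>_def using W.AE_oscillating
  proof (rule eventually_mono, intro ballI)
    fix \<omega> x assume \<omega>: "oscillating (\<lambda>j. W.walk j \<omega>)" and x: "x \<in> open_arc M p q"
    obtain a b where ab: "{a, b} = {p, q}" "oscillating_orbit M T (\<lambda>j. W.walk j \<omega>) x a b"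
      using oscillating_orbit[OF pq x \<omega>] by blast
    then interpret O: oscillating_orbit M T "\<lambda>j. W.walk j \<omega>" x a b by simp
    have "limit_measures M f \<omega> x = {dirac_mix M l a b | l. l \<in> {0..1}}"
      unfolding limit_measures_def orbit[OF arc_sub[OF pq x]] by (rule O.accumulation_points_empirical)
    also have "\<dots> = {dirac_mix M l p q | l. l \<in> {0..1}}"
      using ab(1) dirac_mixes_swap[of M a b] by (auto simp: doubleton_eq_iff)
    finally show "limit_measures M f \<omega> x = {dirac_mix M l p q | l. l \<in> {0..1}}" .
  qed
  moreover have "AE x in leb M.
      (\<exists>p q. consecutive_fixed_points M T p q \<and> x \<in> open_arc M p q) \<and>
      (\<forall>p q. consecutive_fixed_points M T p q \<and> x \<in> open_arc M p q \<longrightarrow>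
        (\<forall>\<gamma> \<in> open_arc M p q. \<forall>J \<in> {closed_arc M p \<gamma>, closed_arc M \<gamma> q}. \<forall>\<alpha> \<in> {0<..<1}.
          (\<lambda>n. measure \<P> {\<omega> \<in> space \<P>.
                 (\<Sum>j<n. indicat_real J (rand_iter f \<omega> j x)) / real n \<le> \<alpha>})
            \<longlonglongrightarrow> 2 / pi * arcsin (sqrt \<alpha>)))"
    if orient: "M = circle \<longrightarrow> circle_orientation_preserving T"
    using good_points
  proof (rule eventually_mono, intro conjI allI impI ballI)
    fix x assume "x \<in> topspace M \<and> x \<notin> fixed_points M T"
    then show "\<exists>p q. consecutive_fixed_points M T p q \<and> x \<in> open_arc M p q"
      using D.in_arc_of_consecutive by blast
  qed (use law[OF orient] in blast)
  ultimately show ?thesis by blast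
qed

end
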